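(* Let $\mathcal{C}$ be a slightly degenerate braided pivotal fusion category over $\Bbbk$ with pivotal structure $a$, Drinfeld isomorphism $u$, and $\varepsilon$ the non-unit simple object of its symmetric center. Let $\hat{\mathcal{C}}$ be the associated rigid monoidal supercategory. If $a_\varepsilon=u_\varepsilon$, then the pivotal structure on $\mathcal{C}$ gives rise to a pivotal structure on $\hat{\mathcal{C}}$ (the morphisms $a_X$, viewed as even morphisms of $\hat{\mathcal{C}}$, form a pivotal structure). If $a_\varepsilon=-u_\varepsilon$, then the pivotal structure on $\mathcal{C}$ gives rise, in the same way, to a superpivotal structure on $\hat{\mathcal{C}}$.
   Context: $\Bbbk$ is an algebraically closed field of characteristic $0$. $\mathrm{sVect}$ is the symmetric monoidal category of finite-dimensional superspaces and even maps, with braiding $v\otimes w\mapsto(-1)^{|v||w|}w\otimes v$. A braided pivotal fusion category $\mathcal{C}$ has a braiding $c$ and a pivotal structure $a_X\colon X\to X^{**}$ (isomorphism of monoidal functors). It is slightly degenerate if its symmetric center (the full subcategory of all $X$ with $c_{Y,X}c_{X,Y}=\mathrm{id}$ for all $Y$) is equivalent to $\mathrm{sVect}$ as a braided category; $\varepsilon$ is the non-unit simple object of the symmetric center, and an isomorphism $\xi\colon\varepsilon\otimes\varepsilon\to\mathbf 1$ is fixed. The Drinfeld isomorphism is $u_X=(\mathrm{ev}_X\otimes\mathrm{id})(c_{X,X^*}\otimes\mathrm{id})(\mathrm{id}_X\otimes\mathrm{coev}_{X^*})\colon X\to X^{**}$, where $\mathrm{ev}_X\colon X^*\otimes X\to\mathbf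 1$ and $\mathrm{coev}_X\colon\mathbf 1\to X\otimes X^*$. A supercategory is an $\mathrm{sVect}$-enriched category; a monoidal supercategory is a supercategory with a tensor superfunctor satisfying the superinterchange law $(g\otimes g')\circ(f\otimes f')=(-1)^{|g'||f|}(g\circ f)\otimes(g'\circ f')$, a unit, and even supernatural associativity and unit isomorphisms satisfying the usual axioms. It is rigid if every object has a left and a right dual with even evaluation and coevaluation morphisms satisfying the usual identities; the left dual of $f\colon X\to Y$ is $f^*=(\mathrm{ev}_Y\otimes\mathrm{id}_{X^*})\circ(\mathrm{id}_{Y^*}\otimes f\otimes\mathrm{id}_{X^*})\circ(\mathrm{id}_{Y^*}\otimes\mathrm{coev}_X)$. For a rigid monoidal supercategory, the superfunctors $\mathrm{Bid}$ and $\mathrm{sBid}$ both send $X$ to $X^{**}$; on homogeneous morphisms $\mathrm{Bid}(f)=f^{**}$ and $\mathrm{sBid}(f)=(-1)^{|f|}f^{**}$. A pivotal (resp. superpivotal) structure is an even monoidal supernatural isomorphism $\mathrm{id}\to\mathrm{Bid}$ (resp. $\mathrm{id}\to\mathrm{sBid}$); for an even family, supernaturality $F\to G$ means $\alpha_Y\circ F(f)=G(f)\circ\alpha_X$ for all $f\colon X\to Y$. The supercategory $\hat{\mathcal{C}}$ has the same objects as $\mathcal{C}$, with $\mathrm{Hom}_{\hat{\mathcal{C}}}(X,Y)_0=\mathrm{Hom}_{\mathcal{C}}(X,Y)$ and $\mathrm{Hom}_{\hat{\mathcal{C}}}(X,Y)_1=\mathrm{Hom}_{\mathcal{C}}(X,\varepsilon\otimes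 Y)$. Composition of $f\colon X\to Y$ and $g\colon Y\to Z$ is the obvious one ($g\circ f$ or $(\mathrm{id}_\varepsilon\otimes g)\circ f$ in $\mathcal{C}$) unless both are odd, in which case it is $(\xi\otimes\mathrm{id}_Z)\circ(\mathrm{id}_\varepsilon\otimes g)\circ f$. The tensor product of objects is that of $\mathcal{C}$; for homogeneous $f\colon X\to Y$, $f'\colon X'\to Y'$, $f\hat\otimes f'$ is: $f\otimes f'$ if both are even, or if $f$ is odd and $f'$ even; $(c_{Y,\varepsilon}\otimes\mathrm{id}_{Y'})\circ(f\otimes f')$ if $f$ is even and $f'$ odd; $(-\xi\otimes\mathrm{id}_{Y\otimes Y'})\circ(\mathrm{id}_\varepsilon\otimes c_{Y,\varepsilon}\otimes\mathrm{id}_{Y'})\circ(f\otimes f')$ if both are odd. $\hat{\mathcal{C}}$ is a rigid monoidal supercategory, with the same duals, evaluations and coevaluations as $\mathcal{C}$. Associativity constraints are suppressed. *)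

theory Defs
  imports "HOL-Computational_Algebra.Polynomial" "Jordan_Normal_Form.Matrix"
begin

section \<open>Linear categories\<close>

text \<open>
  Arrows form a single carrier with domain and codomain functions.  \<open>Zero X Y\<close> is the zero
  arrow \<open>X \<rightarrow> Y\<close>; \<open>Add\<close> is only meaningful on parallel arrows.
\<close>

record ('o, 'm, 'k) lincat =
  Obj :: "'o set"
  Arr :: "'m set"
  Dom :: "'m \<Rightarrow> 'o"
  Cod :: "'m \<Rightarrow> 'o"
  Ident :: "'o \<Rightarrow> 'm"  ("\<ii>\<index>")
  Comp :: "'m \<Rightarrow> 'm \<Rightarrow> 'm"  (infixr "\<cdot>\<index>" 55)
  Zero :: "'o \<Rightarrow> 'o \<Rightarrow> 'm"
  Add :: "'m \<Rightarrow> 'm \<Rightarrow> 'm"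
  Scale :: "'k \<Rightarrow> 'm \<Rightarrow> 'm"

definition Hom :: "('o, 'm, 'k, 'z) lincat_scheme \<Rightarrow> 'o \<Rightarrow> 'o \<Rightarrow> 'm set" where
  "Hom C X Y = {f \<in> Arr C. Dom C f = X \<and> Cod C f = Y}"

locale linear_category =
  fixes C :: "('o, 'm, 'k::field, 'z) lincat_scheme" (structure)
  assumes Dom_Obj: "f \<in> Arr C \<Longrightarrow> Dom C f \<in> Obj C"
    and Cod_Obj: "f \<in> Arr C \<Longrightarrow> Cod C f \<in> Obj C"
    and Ident_Hom: "X \<in> Obj C \<Longrightarrow> \<ii> X \<in> Hom C X X"
    and Comp_Hom: "\<lbrakk>f \<in> Hom C X Y; g \<in> Hom C Y Z\<rbrakk> \<Longrightarrow> g \<cdot> f \<in> Hom C X Z"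
    and Comp_assoc: "\<lbrakk>f \<in> Hom C X Y; g \<in> Hom C Y Z; h \<in> Hom C Z W\<rbrakk>
      \<Longrightarrow> (h \<cdot> g) \<cdot> f = h \<cdot> (g \<cdot> f)"
    and Comp_Ident_left: "f \<in> Hom C X Y \<Longrightarrow> \<ii> Y \<cdot> f = f"
    and Comp_Ident_right: "f \<in> Hom C X Y \<Longrightarrow> f \<cdot> \<ii> X = f"
    and Zero_Hom: "\<lbrakk>X \<in> Obj C; Y \<in> Obj C\<rbrakk> \<Longrightarrow> Zero C X Y \<in> Hom C X Y"
    and Add_Hom: "\<lbrakk>f \<in> Hom C X Y; g \<in> Hom C X Y\<rbrakk> \<Longrightarrow> Add C f g \<in> Hom C X Y"
    and Scale_Hom: "f \<in> Hom C X Y \<Longrightarrow> Scale C r f \<in> Hom C X Y"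
    and Add_assoc: "\<lbrakk>f \<in> Hom C X Y; g \<in> Hom C X Y; h \<in> Hom C X Y\<rbrakk>
      \<Longrightarrow> Add C (Add C f g) h = Add C f (Add C g h)"
    and Add_commute: "\<lbrakk>f \<in> Hom C X Y; g \<in> Hom C X Y\<rbrakk> \<Longrightarrow> Add C f g = Add C g f"
    and Add_Zero: "f \<in> Hom C X Y \<Longrightarrow> Add C f (Zero C X Y) = f"
    and Add_inverse: "f \<in> Hom C X Y \<Longrightarrow> \<exists>g \<in> Hom C X Y. Add C f g = Zero C X Y"
    and Scale_Add: "\<lbrakk>f \<in> Hom C X Y; g \<in> Hom C X Y\<rbrakk>
      \<Longrightarrow> Scale C r (Add C f g) = Add C (Scale C r f) (Scale C r g)"
    and Scale_plus: "f \<in> Hom C X Y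
      \<Longrightarrow> Scale C (r + s) f = Add C (Scale C r f) (Scale C s f)"
    and Scale_mult: "f \<in> Hom C X Y \<Longrightarrow> Scale C (r * s) f = Scale C r (Scale C s f)"
    and Scale_one: "f \<in> Hom C X Y \<Longrightarrow> Scale C 1 f = f"
    and Comp_Add_left: "\<lbrakk>f \<in> Hom C X Y; g \<in> Hom C Y Z; g' \<in> Hom C Y Z\<rbrakk>
      \<Longrightarrow> Add C g g' \<cdot> f = Add C (g \<cdot> f) (g' \<cdot> f)"
    and Comp_Add_right: "\<lbrakk>f \<in> Hom C X Y; f' \<in> Hom C X Y; g \<in> Hom C Y Z\<rbrakk>
      \<Longrightarrow> g \<cdot> Add C f f' = Add C (g \<cdot> f) (g \<cdot> f')"
    and Comp_Scale_left: "\<lbrakk>f \<in> Hom C X Y; g \<in> Hom C Y Z\<rbrakk>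
      \<Longrightarrow> Scale C r g \<cdot> f = Scale C r (g \<cdot> f)"
    and Comp_Scale_right: "\<lbrakk>f \<in> Hom C X Y; g \<in> Hom C Y Z\<rbrakk>
      \<Longrightarrow> g \<cdot> Scale C r f = Scale C r (g \<cdot> f)"

definition inverse_arr :: "('o, 'm, 'k, 'z) lincat_scheme \<Rightarrow> 'm \<Rightarrow> 'm \<Rightarrow> bool" where
  "inverse_arr C f g \<longleftrightarrow> f \<in> Arr C \<and> g \<in> Hom C (Cod C f) (Dom C f) \<and>
     g \<cdot>\<^bsub>C\<^esub> f = \<ii>\<^bsub>C\<^esub> (Dom C f) \<and> f \<cdot>\<^bsub>C\<^esub> g = \<ii>\<^bsub>C\<^esub> (Cod C f)"

definition iso_arr :: "('o, 'm, 'k, 'z) lincat_scheme \<Rightarrow> 'm \<Rightarrow> bool" where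
  "iso_arr C f \<longleftrightarrow> (\<exists>g. inverse_arr C f g)"

definition inv_arr :: "('o, 'm, 'k, 'z) lincat_scheme \<Rightarrow> 'm \<Rightarrow> 'm" where
  "inv_arr C f = (THE g. inverse_arr C f g)"

definition isomorphic :: "('o, 'm, 'k, 'z) lincat_scheme \<Rightarrow> 'o \<Rightarrow> 'o \<Rightarrow> bool" where
  "isomorphic C X Y \<longleftrightarrow> (\<exists>f \<in> Hom C X Y. iso_arr C f)"

definition full_subcategory ::
  "('o, 'm, 'k, 'z) lincat_scheme \<Rightarrow> 'o set \<Rightarrow> ('o, 'm, 'k, 'z) lincat_scheme" where
  "full_subcategory C S =
     C\<lparr>Obj := S, Arr := {f \<in> Arr C. Dom C f \<in> S \<and> Cod C f \<in> S}\<rparr>"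

subsection \<open>Abelian and semisimple categories\<close>

definition monic :: "('o, 'm, 'k, 'z) lincat_scheme \<Rightarrow> 'm \<Rightarrow> bool" where
  "monic C f \<longleftrightarrow> f \<in> Arr C \<and>
     (\<forall>W. \<forall>g \<in> Hom C W (Dom C f). \<forall>h \<in> Hom C W (Dom C f).
        f \<cdot>\<^bsub>C\<^esub> g = f \<cdot>\<^bsub>C\<^esub> h \<longrightarrow> g = h)"

definition epic :: "('o, 'm, 'k, 'z) lincat_scheme \<Rightarrow> 'm \<Rightarrow> bool" where
  "epic C f \<longleftrightarrow> f \<in> Arr C \<and>
     (\<forall>W. \<forall>g \<in> Hom C (Cod C f) W. \<forall>h \<in> Hom C (Cod C f) W.
        g \<cdot>\<^bsub>C\<^esub> f = h \<cdot>\<^bsub>C\<^esub> f \<longrightarrow> g = h)"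

definition is_kernel :: "('o, 'm, 'k, 'z) lincat_scheme \<Rightarrow> 'm \<Rightarrow> 'm \<Rightarrow> bool" where
  "is_kernel C f k \<longleftrightarrow> f \<in> Arr C \<and> k \<in> Arr C \<and> Cod C k = Dom C f \<and>
     f \<cdot>\<^bsub>C\<^esub> k = Zero C (Dom C k) (Cod C f) \<and>
     (\<forall>W. \<forall>g \<in> Hom C W (Dom C f). f \<cdot>\<^bsub>C\<^esub> g = Zero C W (Cod C f) \<longrightarrow>
        (\<exists>!h. h \<in> Hom C W (Dom C k) \<and> k \<cdot>\<^bsub>C\<^esub> h = g))"

definition is_cokernel :: "('o, 'm, 'k, 'z) lincat_scheme \<Rightarrow> 'm \<Rightarrow> 'm \<Rightarrow> bool" where
  "is_cokernel C f q \<longleftrightarrow> f \<in> Arr C \<and> q \<in> Arr C \<and> Dom C q = Cod C f \<and>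
     q \<cdot>\<^bsub>C\<^esub> f = Zero C (Dom C f) (Cod C q) \<and>
     (\<forall>W. \<forall>g \<in> Hom C (Cod C f) W. g \<cdot>\<^bsub>C\<^esub> f = Zero C (Dom C f) W \<longrightarrow>
        (\<exists>!h. h \<in> Hom C (Cod C q) W \<and> h \<cdot>\<^bsub>C\<^esub> q = g))"

text \<open>The case \<open>Xs = []\<close> says that \<open>X\<close> is a zero object.\<close>

definition is_direct_sum :: "('o, 'm, 'k, 'z) lincat_scheme \<Rightarrow> 'o \<Rightarrow> 'o list \<Rightarrow> bool" where
  "is_direct_sum C X Xs \<longleftrightarrow> X \<in> Obj C \<and> set Xs \<subseteq> Obj C \<and>
     (\<exists>i p :: nat \<Rightarrow> 'm.
        (\<forall>j < length Xs. i j \<in> Hom C (Xs ! j) X \<and> p j \<in> Hom C X (Xs ! j)) \<and>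
        (\<forall>j < length Xs. \<forall>l < length Xs.
           p j \<cdot>\<^bsub>C\<^esub> i l = (if j = l then \<ii>\<^bsub>C\<^esub> (Xs ! j) else Zero C (Xs ! l) (Xs ! j))) \<and>
        foldr (Add C) (map (\<lambda>j. i j \<cdot>\<^bsub>C\<^esub> p j) [0..<length Xs]) (Zero C X X) = \<ii>\<^bsub>C\<^esub> X)"

definition simple_object :: "('o, 'm, 'k, 'z) lincat_scheme \<Rightarrow> 'o \<Rightarrow> bool" where
  "simple_object C X \<longleftrightarrow> X \<in> Obj C \<and> \<ii>\<^bsub>C\<^esub> X \<noteq> Zero C X X \<and>
     (\<forall>f. monic C f \<and> Cod C f = X \<longrightarrow> f = Zero C (Dom C f) X \<or> iso_arr C f)"

locale abelian_category = linear_category +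
  assumes direct_sums: "set Xs \<subseteq> Obj C \<Longrightarrow> \<exists>X. is_direct_sum C X Xs"
    and kernels: "f \<in> Arr C \<Longrightarrow> \<exists>k. is_kernel C f k"
    and cokernels: "f \<in> Arr C \<Longrightarrow> \<exists>q. is_cokernel C f q"
    and monic_normal: "monic C k \<Longrightarrow> \<exists>f. is_kernel C f k"
    and epic_normal: "epic C q \<Longrightarrow> \<exists>f. is_cokernel C f q"

locale finite_semisimple_category = abelian_category +
  assumes Hom_finite_dim: "\<lbrakk>X \<in> Obj C; Y \<in> Obj C\<rbrakk> \<Longrightarrow>
      \<exists>bs. set bs \<subseteq> Hom C X Y \<and>
        (\<forall>f \<in> Hom C X Y. \<exists>cs. length cs = length bs \<and>
           f = foldr (Add C) (map2 (Scale C) cs bs) (Zero C X Y))"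
    and semisimple: "X \<in> Obj C \<Longrightarrow>
      \<exists>Xs. (\<forall>S \<in> set Xs. simple_object C S) \<and> is_direct_sum C X Xs"
    and finitely_many_simples: "\<exists>I. finite I \<and> I \<subseteq> Obj C \<and>
      (\<forall>X. simple_object C X \<longrightarrow> (\<exists>Y \<in> I. isomorphic C X Y))"

section \<open>Monoidal and braided categories\<close>

text \<open>
  The associator is \<open>Assoc X Y Z : (X \<otimes> Y) \<otimes> Z \<rightarrow> X \<otimes> (Y \<otimes> Z)\<close>, the unit constraints are
  \<open>LUnit X : \<one> \<otimes> X \<rightarrow> X\<close> and \<open>RUnit X : X \<otimes> \<one> \<rightarrow> X\<close>.  Nothing is assumed to be strict: in the
  formulas below, the constraints that are usually suppressed are written out.
\<close>

record ('o, 'm, 'k) moncat = "('o, 'm, 'k) lincat" +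
  TensorObj :: "'o \<Rightarrow> 'o \<Rightarrow> 'o"  (infixr "\<otimes>\<^sub>o\<index>" 70)
  TensorArr :: "'m \<Rightarrow> 'm \<Rightarrow> 'm"  (infixr "\<otimes>\<^sub>a\<index>" 70)
  UnitObj :: "'o"  ("\<I>\<index>")
  Assoc :: "'o \<Rightarrow> 'o \<Rightarrow> 'o \<Rightarrow> 'm"
  LUnit :: "'o \<Rightarrow> 'm"
  RUnit :: "'o \<Rightarrow> 'm"

locale linear_monoidal_category = linear_category C
  for C :: "('o, 'm, 'k::field, 'z) moncat_scheme" (structure) +
  assumes TensorObj_Obj: "\<lbrakk>X \<in> Obj C; Y \<in> Obj C\<rbrakk> \<Longrightarrow> X \<otimes>\<^sub>o Y \<in> Obj C"
    and UnitObj_Obj: "\<I> \<in> Obj C"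
    and TensorArr_Hom: "\<lbrakk>f \<in> Hom C X Y; g \<in> Hom C X' Y'\<rbrakk>
      \<Longrightarrow> f \<otimes>\<^sub>a g \<in> Hom C (X \<otimes>\<^sub>o X') (Y \<otimes>\<^sub>o Y')"
    and TensorArr_Ident: "\<lbrakk>X \<in> Obj C; Y \<in> Obj C\<rbrakk> \<Longrightarrow> \<ii> X \<otimes>\<^sub>a \<ii> Y = \<ii> (X \<otimes>\<^sub>o Y)"
    and TensorArr_Comp: "\<lbrakk>f \<in> Hom C X Y; g \<in> Hom C Y Z; f' \<in> Hom C X' Y'; g' \<in> Hom C Y' Z'\<rbrakk>
      \<Longrightarrow> (g \<otimes>\<^sub>a g') \<cdot> (f \<otimes>\<^sub>a f') = (g \<cdot> f) \<otimes>\<^sub>a (g' \<cdot> f')"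
    and TensorArr_Add_left: "\<lbrakk>f \<in> Hom C X Y; f' \<in> Hom C X Y; g \<in> Hom C X' Y'\<rbrakk>
      \<Longrightarrow> Add C f f' \<otimes>\<^sub>a g = Add C (f \<otimes>\<^sub>a g) (f' \<otimes>\<^sub>a g)"
    and TensorArr_Add_right: "\<lbrakk>f \<in> Hom C X Y; g \<in> Hom C X' Y'; g' \<in> Hom C X' Y'\<rbrakk>
      \<Longrightarrow> f \<otimes>\<^sub>a Add C g g' = Add C (f \<otimes>\<^sub>a g) (f \<otimes>\<^sub>a g')"
    and TensorArr_Scale_left: "\<lbrakk>f \<in> Hom C X Y; g \<in> Hom C X' Y'\<rbrakk>
      \<Longrightarrow> Scale C r f \<otimes>\<^sub>a g = Scale C r (f \<otimes>\<^sub>a g)"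
    and TensorArr_Scale_right: "\<lbrakk>f \<in> Hom C X Y; g \<in> Hom C X' Y'\<rbrakk>
      \<Longrightarrow> f \<otimes>\<^sub>a Scale C r g = Scale C r (f \<otimes>\<^sub>a g)"
    and Assoc_Hom: "\<lbrakk>X \<in> Obj C; Y \<in> Obj C; Z \<in> Obj C\<rbrakk>
      \<Longrightarrow> Assoc C X Y Z \<in> Hom C ((X \<otimes>\<^sub>o Y) \<otimes>\<^sub>o Z) (X \<otimes>\<^sub>o (Y \<otimes>\<^sub>o Z))"
    and Assoc_iso: "\<lbrakk>X \<in> Obj C; Y \<in> Obj C; Z \<in> Obj C\<rbrakk> \<Longrightarrow> iso_arr C (Assoc C X Y Z)"
    and Assoc_natural: "\<lbrakk>f \<in> Hom C X X'; g \<in> Hom C Y Y'; h \<in> Hom C Z Z'\<rbrakk>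
      \<Longrightarrow> Assoc C X' Y' Z' \<cdot> ((f \<otimes>\<^sub>a g) \<otimes>\<^sub>a h) = (f \<otimes>\<^sub>a (g \<otimes>\<^sub>a h)) \<cdot> Assoc C X Y Z"
    and LUnit_Hom: "X \<in> Obj C \<Longrightarrow> LUnit C X \<in> Hom C (\<I> \<otimes>\<^sub>o X) X"
    and LUnit_iso: "X \<in> Obj C \<Longrightarrow> iso_arr C (LUnit C X)"
    and LUnit_natural: "f \<in> Hom C X Y \<Longrightarrow> LUnit C Y \<cdot> (\<ii> \<I> \<otimes>\<^sub>a f) = f \<cdot> LUnit C X"
    and RUnit_Hom: "X \<in> Obj C \<Longrightarrow> RUnit C X \<in> Hom C (X \<otimes>\<^sub>o \<I>) X"
    and RUnit_iso: "X \<in> Obj C \<Longrightarrow> iso_arr C (RUnit C X)"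
    and RUnit_natural: "f \<in> Hom C X Y \<Longrightarrow> RUnit C Y \<cdot> (f \<otimes>\<^sub>a \<ii> \<I>) = f \<cdot> RUnit C X"
    and pentagon: "\<lbrakk>W \<in> Obj C; X \<in> Obj C; Y \<in> Obj C; Z \<in> Obj C\<rbrakk> \<Longrightarrow>
        Assoc C W X (Y \<otimes>\<^sub>o Z) \<cdot> Assoc C (W \<otimes>\<^sub>o X) Y Z =
        (\<ii> W \<otimes>\<^sub>a Assoc C X Y Z) \<cdot> Assoc C W (X \<otimes>\<^sub>o Y) Z \<cdot> (Assoc C W X Y \<otimes>\<^sub>a \<ii> Z)"
    and triangle: "\<lbrakk>X \<in> Obj C; Y \<in> Obj C\<rbrakk> \<Longrightarrow>
        (\<ii> X \<otimes>\<^sub>a LUnit C Y) \<cdot> Assoc C X \<I> Y = RUnit C X \<otimes>\<^sub>a \<ii> Y"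

locale braided_category = linear_monoidal_category C
  for C :: "('o, 'm, 'k::field, 'z) moncat_scheme" (structure) +
  fixes c :: "'o \<Rightarrow> 'o \<Rightarrow> 'm"
  assumes braid_Hom: "\<lbrakk>X \<in> Obj C; Y \<in> Obj C\<rbrakk> \<Longrightarrow> c X Y \<in> Hom C (X \<otimes>\<^sub>o Y) (Y \<otimes>\<^sub>o X)"
    and braid_iso: "\<lbrakk>X \<in> Obj C; Y \<in> Obj C\<rbrakk> \<Longrightarrow> iso_arr C (c X Y)"
    and braid_natural: "\<lbrakk>f \<in> Hom C X X'; g \<in> Hom C Y Y'\<rbrakk>
      \<Longrightarrow> c X' Y' \<cdot> (f \<otimes>\<^sub>a g) = (g \<otimes>\<^sub>a f) \<cdot> c X Y"
    and hexagon1: "\<lbrakk>X \<in> Obj C; Y \<in> Obj C; Z \<in> Obj C\<rbrakk> \<Longrightarrow>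
        Assoc C Y Z X \<cdot> c X (Y \<otimes>\<^sub>o Z) \<cdot> Assoc C X Y Z =
        (\<ii> Y \<otimes>\<^sub>a c X Z) \<cdot> Assoc C Y X Z \<cdot> (c X Y \<otimes>\<^sub>a \<ii> Z)"
    and hexagon2: "\<lbrakk>X \<in> Obj C; Y \<in> Obj C; Z \<in> Obj C\<rbrakk> \<Longrightarrow>
        inv_arr C (Assoc C Z X Y) \<cdot> c (X \<otimes>\<^sub>o Y) Z \<cdot> inv_arr C (Assoc C X Y Z) =
        (c X Z \<otimes>\<^sub>a \<ii> Y) \<cdot> inv_arr C (Assoc C X Z Y) \<cdot> (\<ii> X \<otimes>\<^sub>a c Y Z)"

text \<open>
  \<open>F\<close> and \<open>F'\<close> are the object and arrow parts of the functor, \<open>J X Y : F X \<otimes> F Y \<rightarrow> F (X \<otimes> Y)\<close>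
  and \<open>J0 : \<one> \<rightarrow> F \<one>\<close> its monoidal structure.
\<close>

definition braided_equivalence ::
  "('o, 'm, 'k::field, 'z) moncat_scheme \<Rightarrow> ('o \<Rightarrow> 'o \<Rightarrow> 'm) \<Rightarrow>
   ('p, 'n, 'k, 'y) moncat_scheme \<Rightarrow> ('p \<Rightarrow> 'p \<Rightarrow> 'n) \<Rightarrow>
   ('o \<Rightarrow> 'p) \<Rightarrow> ('m \<Rightarrow> 'n) \<Rightarrow> ('o \<Rightarrow> 'o \<Rightarrow> 'n) \<Rightarrow> 'n \<Rightarrow> bool" where
  "braided_equivalence C c D d F F' J J0 \<longleftrightarrow>
     \<comment> \<open>linear functor\<close>
     (\<forall>X \<in> Obj C. F X \<in> Obj D) \<and>
     (\<forall>f \<in> Arr C. F' f \<in> Hom D (F (Dom C f)) (F (Cod C f))) \<and>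
     (\<forall>X \<in> Obj C. F' (\<ii>\<^bsub>C\<^esub> X) = \<ii>\<^bsub>D\<^esub> (F X)) \<and>
     (\<forall>f \<in> Arr C. \<forall>g \<in> Arr C. Dom C g = Cod C f \<longrightarrow> F' (g \<cdot>\<^bsub>C\<^esub> f) = F' g \<cdot>\<^bsub>D\<^esub> F' f) \<and>
     (\<forall>f \<in> Arr C. \<forall>g \<in> Arr C. Dom C f = Dom C g \<and> Cod C f = Cod C g \<longrightarrow>
        F' (Add C f g) = Add D (F' f) (F' g)) \<and>
     (\<forall>f \<in> Arr C. \<forall>r. F' (Scale C r f) = Scale D r (F' f)) \<and>
     \<comment> \<open>fully faithful and essentially surjective\<close>
     (\<forall>X \<in> Obj C. \<forall>Y \<in> Obj C. bij_betw F' (Hom C X Y) (Hom D (F X) (F Y))) \<and>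
     (\<forall>A \<in> Obj D. \<exists>X \<in> Obj C. isomorphic D (F X) A) \<and>
     \<comment> \<open>monoidal\<close>
     (\<forall>X \<in> Obj C. \<forall>Y \<in> Obj C.
        J X Y \<in> Hom D (F X \<otimes>\<^sub>o\<^bsub>D\<^esub> F Y) (F (X \<otimes>\<^sub>o\<^bsub>C\<^esub> Y)) \<and> iso_arr D (J X Y)) \<and>
     J0 \<in> Hom D \<I>\<^bsub>D\<^esub> (F \<I>\<^bsub>C\<^esub>) \<and> iso_arr D J0 \<and>
     (\<forall>f \<in> Arr C. \<forall>g \<in> Arr C.
        F' (f \<otimes>\<^sub>a\<^bsub>C\<^esub> g) \<cdot>\<^bsub>D\<^esub> J (Dom C f) (Dom C g) =
        J (Cod C f) (Cod C g) \<cdot>\<^bsub>D\<^esub> (F' f \<otimes>\<^sub>a\<^bsub>D\<^esub> F' g)) \<and>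
     (\<forall>X \<in> Obj C. \<forall>Y \<in> Obj C. \<forall>Z \<in> Obj C.
        F' (Assoc C X Y Z) \<cdot>\<^bsub>D\<^esub> J (X \<otimes>\<^sub>o\<^bsub>C\<^esub> Y) Z \<cdot>\<^bsub>D\<^esub> (J X Y \<otimes>\<^sub>a\<^bsub>D\<^esub> \<ii>\<^bsub>D\<^esub> (F Z)) =
        J X (Y \<otimes>\<^sub>o\<^bsub>C\<^esub> Z) \<cdot>\<^bsub>D\<^esub> (\<ii>\<^bsub>D\<^esub> (F X) \<otimes>\<^sub>a\<^bsub>D\<^esub> J Y Z) \<cdot>\<^bsub>D\<^esub> Assoc D (F X) (F Y) (F Z)) \<and>
     (\<forall>X \<in> Obj C.
        F' (LUnit C X) \<cdot>\<^bsub>D\<^esub> J \<I>\<^bsub>C\<^esub> X \<cdot>\<^bsub>D\<^esub> (J0 \<otimes>\<^sub>a\<^bsub>D\<^esub> \<ii>\<^bsub>D\<^esub> (F X)) = LUnit D (F X) \<and>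
        F' (RUnit C X) \<cdot>\<^bsub>D\<^esub> J X \<I>\<^bsub>C\<^esub> \<cdot>\<^bsub>D\<^esub> (\<ii>\<^bsub>D\<^esub> (F X) \<otimes>\<^sub>a\<^bsub>D\<^esub> J0) = RUnit D (F X)) \<and>
     \<comment> \<open>braided\<close>
     (\<forall>X \<in> Obj C. \<forall>Y \<in> Obj C.
        F' (c X Y) \<cdot>\<^bsub>D\<^esub> J X Y = J Y X \<cdot>\<^bsub>D\<^esub> d (F X) (F Y))"

definition braided_equivalent ::
  "('o, 'm, 'k::field, 'z) moncat_scheme \<Rightarrow> ('o \<Rightarrow> 'o \<Rightarrow> 'm) \<Rightarrow>
   ('p, 'n, 'k, 'y) moncat_scheme \<Rightarrow> ('p \<Rightarrow> 'p \<Rightarrow> 'n) \<Rightarrow> bool" where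
  "braided_equivalent C c D d \<longleftrightarrow> (\<exists>F F' J J0. braided_equivalence C c D d F F' J J0)"

subsection \<open>Superspaces\<close>

text \<open>
  A finite-dimensional superspace is represented by the list of parities (\<open>True\<close> for odd) of an
  ordered homogeneous basis, and an even linear map \<open>xs \<rightarrow> ys\<close> by its matrix, which may only have
  nonzero entries between basis vectors of the same parity.  If \<open>e\<^sub>i\<close> and \<open>f\<^sub>j\<close> are the bases
  of \<open>xs\<close> and \<open>ys\<close>, then \<open>e\<^sub>i \<otimes> f\<^sub>j\<close> is the basis vector of \<open>xs \<otimes> ys\<close> with index
  \<open>i * length ys + j\<close>; with this indexing the tensor product is strictly associative and unital.
\<close>

definition super_tensor :: "bool list \<Rightarrow> bool list \<Rightarrow> bool list" where
  "super_tensor xs ys = concat (map (\<lambda>x. map (\<lambda>y. x \<noteq> y) ys) xs)"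

definition kronecker :: "'k::semiring_0 mat \<Rightarrow> 'k mat \<Rightarrow> 'k mat" where
  "kronecker A B = mat (dim_row A * dim_row B) (dim_col A * dim_col B)
     (\<lambda>(i, j). A $$ (i div dim_row B, j div dim_col B) * B $$ (i mod dim_row B, j mod dim_col B))"

definition sVect :: "(bool list, bool list \<times> bool list \<times> 'k::field mat, 'k) moncat" where
  "sVect = \<lparr>
     Obj = UNIV,
     Arr = {(xs, ys, A). A \<in> carrier_mat (length ys) (length xs) \<and>
       (\<forall>i < length ys. \<forall>j < length xs. ys ! i \<noteq> xs ! j \<longrightarrow> A $$ (i, j) = 0)},
     Dom = (\<lambda>(xs, ys, A). xs),
     Cod = (\<lambda>(xs, ys, A). ys),
     Ident = (\<lambda>xs. (xs, xs, 1\<^sub>m (length xs))),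
     Comp = (\<lambda>(ys', zs, B) (xs, ys, A). (xs, zs, B * A)),
     Zero = (\<lambda>xs ys. (xs, ys, 0\<^sub>m (length ys) (length xs))),
     Add = (\<lambda>(xs, ys, A) (xs', ys', B). (xs, ys, A + B)),
     Scale = (\<lambda>r (xs, ys, A). (xs, ys, r \<cdot>\<^sub>m A)),
     TensorObj = super_tensor,
     TensorArr = (\<lambda>(xs, ys, A) (xs', ys', B).
       (super_tensor xs xs', super_tensor ys ys', kronecker A B)),
     UnitObj = [False],
     Assoc = (\<lambda>xs ys zs.
       let ws = super_tensor xs (super_tensor ys zs) in (ws, ws, 1\<^sub>m (length ws))),
     LUnit = (\<lambda>xs. (xs, xs, 1\<^sub>m (length xs))),
     RUnit = (\<lambda>xs. (xs, xs, 1\<^sub>m (length xs)))\<rparr>"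

text \<open>The matrix of \<open>e\<^sub>i \<otimes> f\<^sub>j \<mapsto> (-1)\<^bsup>|i||j|\<^esup> f\<^sub>j \<otimes> e\<^sub>i\<close>.\<close>

definition sVect_braid ::
  "bool list \<Rightarrow> bool list \<Rightarrow> bool list \<times> bool list \<times> 'k::field mat" where
  "sVect_braid xs ys = (super_tensor xs ys, super_tensor ys xs,
     mat (length ys * length xs) (length xs * length ys)
       (\<lambda>(r, s). let i = s div length ys; j = s mod length ys in
          if r = j * length xs + i then (if xs ! i \<and> ys ! j then -1 else 1) else 0))"

subsection \<open>Symmetric center\<close>

definition symmetric_center ::
  "('o, 'm, 'k, 'z) moncat_scheme \<Rightarrow> ('o \<Rightarrow> 'o \<Rightarrow> 'm) \<Rightarrow> ('o, 'm, 'k, 'z) moncat_scheme" where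
  "symmetric_center C c = full_subcategory C
     {X \<in> Obj C. \<forall>Y \<in> Obj C. c Y X \<cdot>\<^bsub>C\<^esub> c X Y = \<ii>\<^bsub>C\<^esub> (X \<otimes>\<^sub>o\<^bsub>C\<^esub> Y)}"

definition slightly_degenerate ::
  "('o, 'm, 'k::field, 'z) moncat_scheme \<Rightarrow> ('o \<Rightarrow> 'o \<Rightarrow> 'm) \<Rightarrow> bool" where
  "slightly_degenerate C c \<longleftrightarrow>
     braided_equivalent (symmetric_center C c) c (sVect :: (_, _, 'k) moncat) sVect_braid"

section \<open>Duality and pivotal structures\<close>

text \<open>\<open>Ev X : X\<^sup>* \<otimes> X \<rightarrow> \<one>\<close> and \<open>Coev X : \<one> \<rightarrow> X \<otimes> X\<^sup>*\<close> for the chosen left dual \<open>X\<^sup>*\<close>.\<close>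

record ('o, 'm, 'k) rigidcat = "('o, 'm, 'k) moncat" +
  Dual :: "'o \<Rightarrow> 'o"
  Ev :: "'o \<Rightarrow> 'm"
  Coev :: "'o \<Rightarrow> 'm"

text \<open>
  \<open>(e \<otimes> id\<^sub>B) \<circ> (id\<^sub>A \<otimes> h) : A \<rightarrow> B\<close> for \<open>e : A \<otimes> X \<rightarrow> \<one>\<close> and \<open>h : \<one> \<rightarrow> X \<otimes> B\<close>.
\<close>

definition snake ::
  "('o, 'm, 'k, 'z) moncat_scheme \<Rightarrow> 'o \<Rightarrow> 'o \<Rightarrow> 'o \<Rightarrow> 'm \<Rightarrow> 'm \<Rightarrow> 'm" where
  "snake C A X B e h =
     LUnit C B \<cdot>\<^bsub>C\<^esub> (e \<otimes>\<^sub>a\<^bsub>C\<^esub> \<ii>\<^bsub>C\<^esub> B) \<cdot>\<^bsub>C\<^esub> inv_arr C (Assoc C A X B)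
       \<cdot>\<^bsub>C\<^esub> (\<ii>\<^bsub>C\<^esub> A \<otimes>\<^sub>a\<^bsub>C\<^esub> h) \<cdot>\<^bsub>C\<^esub> inv_arr C (RUnit C A)"

definition is_left_dual ::
  "('o, 'm, 'k, 'z) moncat_scheme \<Rightarrow> 'o \<Rightarrow> 'o \<Rightarrow> 'm \<Rightarrow> 'm \<Rightarrow> bool" where
  "is_left_dual C X D e h \<longleftrightarrow> X \<in> Obj C \<and> D \<in> Obj C \<and>
     e \<in> Hom C (D \<otimes>\<^sub>o\<^bsub>C\<^esub> X) \<I>\<^bsub>C\<^esub> \<and> h \<in> Hom C \<I>\<^bsub>C\<^esub> (X \<otimes>\<^sub>o\<^bsub>C\<^esub> D) \<and>
     RUnit C X \<cdot>\<^bsub>C\<^esub> (\<ii>\<^bsub>C\<^esub> X \<otimes>\<^sub>a\<^bsub>C\<^esub> e) \<cdot>\<^bsub>C\<^esub> Assoc C X D X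
       \<cdot>\<^bsub>C\<^esub> (h \<otimes>\<^sub>a\<^bsub>C\<^esub> \<ii>\<^bsub>C\<^esub> X) \<cdot>\<^bsub>C\<^esub> inv_arr C (LUnit C X) = \<ii>\<^bsub>C\<^esub> X \<and>
     snake C D X D e h = \<ii>\<^bsub>C\<^esub> D"

text \<open>A right dual of \<open>X\<close> is an object having \<open>X\<close> as a left dual.\<close>

locale rigid_category = linear_monoidal_category C
  for C :: "('o, 'm, 'k::field, 'z) rigidcat_scheme" (structure) +
  assumes left_dual: "X \<in> Obj C \<Longrightarrow> is_left_dual C X (Dual C X) (Ev C X) (Coev C X)"
    and right_dual: "X \<in> Obj C \<Longrightarrow> \<exists>D e h. is_left_dual C D X e h"

locale fusion_category = rigid_category C + finite_semisimple_category C
  for C :: "('o, 'm, 'k::field, 'z) rigidcat_scheme" (structure) +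
  assumes End_unit: "bij_betw (\<lambda>r. Scale C r (\<ii> \<I>)) UNIV (Hom C \<I> \<I>)"

definition dual_arr :: "('o, 'm, 'k, 'z) rigidcat_scheme \<Rightarrow> 'm \<Rightarrow> 'm" where
  "dual_arr C f = (let X = Dom C f; Y = Cod C f; X' = Dual C X; Y' = Dual C Y in
     LUnit C X' \<cdot>\<^bsub>C\<^esub> (Ev C Y \<otimes>\<^sub>a\<^bsub>C\<^esub> \<ii>\<^bsub>C\<^esub> X') \<cdot>\<^bsub>C\<^esub> ((\<ii>\<^bsub>C\<^esub> Y' \<otimes>\<^sub>a\<^bsub>C\<^esub> f) \<otimes>\<^sub>a\<^bsub>C\<^esub> \<ii>\<^bsub>C\<^esub> X')
       \<cdot>\<^bsub>C\<^esub> inv_arr C (Assoc C Y' X X') \<cdot>\<^bsub>C\<^esub> (\<ii>\<^bsub>C\<^esub> Y' \<otimes>\<^sub>a\<^bsub>C\<^esub> Coev C X) \<cdot>\<^bsub>C\<^esub> inv_arr C (RUnit C Y'))"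

definition Bid :: "('o, 'm, 'k, 'z) rigidcat_scheme \<Rightarrow> 'm \<Rightarrow> 'm" where
  "Bid C f = dual_arr C (dual_arr C f)"

text \<open>
  The canonical isomorphisms \<open>Y\<^sup>* \<otimes> X\<^sup>* \<rightarrow> (X \<otimes> Y)\<^sup>*\<close> and \<open>\<one> \<rightarrow> \<one>\<^sup>*\<close>.  They induce the
  monoidal structure \<open>X\<^sup>*\<^sup>* \<otimes> Y\<^sup>*\<^sup>* \<rightarrow> (X \<otimes> Y)\<^sup>*\<^sup>*\<close>, \<open>\<one> \<rightarrow> \<one>\<^sup>*\<^sup>*\<close> of the bidual functor.
\<close>

definition dual_tensor :: "('o, 'm, 'k, 'z) rigidcat_scheme \<Rightarrow> 'o \<Rightarrow> 'o \<Rightarrow> 'm" where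
  "dual_tensor C X Y = (let X' = Dual C X; Y' = Dual C Y; T = X \<otimes>\<^sub>o\<^bsub>C\<^esub> Y in
     snake C (Y' \<otimes>\<^sub>o\<^bsub>C\<^esub> X') T (Dual C T)
       (Ev C Y \<cdot>\<^bsub>C\<^esub> (\<ii>\<^bsub>C\<^esub> Y' \<otimes>\<^sub>a\<^bsub>C\<^esub> (LUnit C Y \<cdot>\<^bsub>C\<^esub> (Ev C X \<otimes>\<^sub>a\<^bsub>C\<^esub> \<ii>\<^bsub>C\<^esub> Y)
            \<cdot>\<^bsub>C\<^esub> inv_arr C (Assoc C X' X Y))) \<cdot>\<^bsub>C\<^esub> Assoc C Y' X' T)
       (Coev C T))"

definition dual_unit :: "('o, 'm, 'k, 'z) rigidcat_scheme \<Rightarrow> 'm" where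
  "dual_unit C = snake C \<I>\<^bsub>C\<^esub> \<I>\<^bsub>C\<^esub> (Dual C \<I>\<^bsub>C\<^esub>) (LUnit C \<I>\<^bsub>C\<^esub>) (Coev C \<I>\<^bsub>C\<^esub>)"

definition bidual_tensor :: "('o, 'm, 'k, 'z) rigidcat_scheme \<Rightarrow> 'o \<Rightarrow> 'o \<Rightarrow> 'm" where
  "bidual_tensor C X Y =
     dual_arr C (inv_arr C (dual_tensor C X Y)) \<cdot>\<^bsub>C\<^esub> dual_tensor C (Dual C Y) (Dual C X)"

definition bidual_unit :: "('o, 'm, 'k, 'z) rigidcat_scheme \<Rightarrow> 'm" where
  "bidual_unit C = dual_arr C (inv_arr C (dual_unit C)) \<cdot>\<^bsub>C\<^esub> dual_unit C"

text \<open>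
  \<open>\<alpha>\<close> is a monoidal natural isomorphism from the identity functor to the functor that sends an
  object \<open>X\<close> to \<open>X\<^sup>*\<^sup>*\<close> and an arrow \<open>f\<close> to \<open>B f\<close>.
\<close>

definition monoidal_iso_to_bidual ::
  "('o, 'm, 'k, 'z) rigidcat_scheme \<Rightarrow> ('m \<Rightarrow> 'm) \<Rightarrow> ('o \<Rightarrow> 'm) \<Rightarrow> bool" where
  "monoidal_iso_to_bidual C B \<alpha> \<longleftrightarrow>
     (\<forall>X \<in> Obj C. \<alpha> X \<in> Hom C X (Dual C (Dual C X)) \<and> iso_arr C (\<alpha> X)) \<and>
     (\<forall>f \<in> Arr C. \<alpha> (Cod C f) \<cdot>\<^bsub>C\<^esub> f = B f \<cdot>\<^bsub>C\<^esub> \<alpha> (Dom C f)) \<and>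
     (\<forall>X \<in> Obj C. \<forall>Y \<in> Obj C.
        \<alpha> (X \<otimes>\<^sub>o\<^bsub>C\<^esub> Y) = bidual_tensor C X Y \<cdot>\<^bsub>C\<^esub> (\<alpha> X \<otimes>\<^sub>a\<^bsub>C\<^esub> \<alpha> Y)) \<and>
     \<alpha> \<I>\<^bsub>C\<^esub> = bidual_unit C"

locale braided_pivotal_fusion_category = fusion_category C + braided_category C c
  for C :: "('o, 'm, 'k::field, 'z) rigidcat_scheme" (structure)
    and c :: "'o \<Rightarrow> 'o \<Rightarrow> 'm" +
  fixes a :: "'o \<Rightarrow> 'm"
  assumes pivotal: "monoidal_iso_to_bidual C (Bid C) a"

definition drinfeld ::
  "('o, 'm, 'k, 'z) rigidcat_scheme \<Rightarrow> ('o \<Rightarrow> 'o \<Rightarrow> 'm) \<Rightarrow> 'o \<Rightarrow> 'm" where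
  "drinfeld C c X = (let X' = Dual C X; X'' = Dual C X' in
     LUnit C X'' \<cdot>\<^bsub>C\<^esub> (Ev C X \<otimes>\<^sub>a\<^bsub>C\<^esub> \<ii>\<^bsub>C\<^esub> X'') \<cdot>\<^bsub>C\<^esub> (c X X' \<otimes>\<^sub>a\<^bsub>C\<^esub> \<ii>\<^bsub>C\<^esub> X'')
       \<cdot>\<^bsub>C\<^esub> inv_arr C (Assoc C X X' X'') \<cdot>\<^bsub>C\<^esub> (\<ii>\<^bsub>C\<^esub> X \<otimes>\<^sub>a\<^bsub>C\<^esub> Coev C X') \<cdot>\<^bsub>C\<^esub> inv_arr C (RUnit C X))"

section \<open>Rigid monoidal supercategories\<close>

text \<open>
  \<open>EvenPart\<close> and \<open>OddPart\<close> are the projections of the superspaces \<open>Hom X Y\<close> onto their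
  homogeneous components.  Pivotal and superpivotal structures only involve this data (and the
  bidual superfunctors built from it), so the predicates below do not restate the supercategory
  axioms for \<open>S\<close>.
\<close>

record ('o, 'm, 'k) rigid_supercat = "('o, 'm, 'k) rigidcat" +
  EvenPart :: "'m \<Rightarrow> 'm"
  OddPart :: "'m \<Rightarrow> 'm"

definition even_arr :: "('o, 'm, 'k, 'z) rigid_supercat_scheme \<Rightarrow> 'm \<Rightarrow> bool" where
  "even_arr S f \<longleftrightarrow> f \<in> Arr S \<and> EvenPart S f = f"

text \<open>The linear extension of \<open>f \<mapsto> (-1)\<^bsup>|f|\<^esup> f\<^sup>*\<^sup>*\<close>.\<close>

definition sBid :: "('o, 'm, 'k::ring_1, 'z) rigid_supercat_scheme \<Rightarrow> 'm \<Rightarrow> 'm" where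
  "sBid S f = Add S (Bid S (EvenPart S f)) (Scale S (-1) (Bid S (OddPart S f)))"

definition pivotal_structure ::
  "('o, 'm, 'k, 'z) rigid_supercat_scheme \<Rightarrow> ('o \<Rightarrow> 'm) \<Rightarrow> bool" where
  "pivotal_structure S \<alpha> \<longleftrightarrow>
     (\<forall>X \<in> Obj S. even_arr S (\<alpha> X)) \<and> monoidal_iso_to_bidual S (Bid S) \<alpha>"

definition superpivotal_structure ::
  "('o, 'm, 'k::ring_1, 'z) rigid_supercat_scheme \<Rightarrow> ('o \<Rightarrow> 'm) \<Rightarrow> bool" where
  "superpivotal_structure S \<alpha> \<longleftrightarrow>
     (\<forall>X \<in> Obj S. even_arr S (\<alpha> X)) \<and> monoidal_iso_to_bidual S (sBid S) \<alpha>"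

section \<open>The supercategory associated to a slightly degenerate category\<close>

text \<open>
  An arrow \<open>X \<rightarrow> Y\<close> is a pair \<open>(f0, f1)\<close> of its even part \<open>f0 : X \<rightarrow> Y\<close> and its odd part
  \<open>f1 : X \<rightarrow> \<epsilon> \<otimes> Y\<close>, so \<open>f0\<close> determines domain and codomain.  Composition and tensor product are
  the bilinear extensions of the usual formulas for homogeneous arrows.
\<close>

definition as_even :: "('o, 'm, 'k, 'z) moncat_scheme \<Rightarrow> 'o \<Rightarrow> 'm \<Rightarrow> 'm \<times> 'm" where
  "as_even C \<epsilon> f = (f, Zero C (Dom C f) (\<epsilon> \<otimes>\<^sub>o\<^bsub>C\<^esub> Cod C f))"

text \<open>\<open>\<xi> \<otimes> id\<^sub>Z : \<epsilon> \<otimes> (\<epsilon> \<otimes> Z) \<rightarrow> Z\<close>\<close>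

definition xi_cancel :: "('o, 'm, 'k, 'z) moncat_scheme \<Rightarrow> 'o \<Rightarrow> 'm \<Rightarrow> 'o \<Rightarrow> 'm" where
  "xi_cancel C \<epsilon> \<xi> Z =
     LUnit C Z \<cdot>\<^bsub>C\<^esub> (\<xi> \<otimes>\<^sub>a\<^bsub>C\<^esub> \<ii>\<^bsub>C\<^esub> Z) \<cdot>\<^bsub>C\<^esub> inv_arr C (Assoc C \<epsilon> \<epsilon> Z)"

text \<open>\<open>c\<^bsub>Y,\<epsilon>\<^esub> \<otimes> id\<^bsub>Y'\<^esub> : Y \<otimes> (\<epsilon> \<otimes> Y') \<rightarrow> \<epsilon> \<otimes> (Y \<otimes> Y')\<close>\<close>

definition eps_pull ::
  "('o, 'm, 'k, 'z) moncat_scheme \<Rightarrow> ('o \<Rightarrow> 'o \<Rightarrow> 'm) \<Rightarrow> 'o \<Rightarrow> 'o \<Rightarrow> 'o \<Rightarrow> 'm" where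
  "eps_pull C c \<epsilon> Y Y' =
     Assoc C \<epsilon> Y Y' \<cdot>\<^bsub>C\<^esub> (c Y \<epsilon> \<otimes>\<^sub>a\<^bsub>C\<^esub> \<ii>\<^bsub>C\<^esub> Y') \<cdot>\<^bsub>C\<^esub> inv_arr C (Assoc C Y \<epsilon> Y')"

definition hat_supercategory ::
  "('o, 'm, 'k::field, 'z) rigidcat_scheme \<Rightarrow> ('o \<Rightarrow> 'o \<Rightarrow> 'm) \<Rightarrow> 'o \<Rightarrow> 'm \<Rightarrow>
   ('o, 'm \<times> 'm, 'k) rigid_supercat" where
  "hat_supercategory C c \<epsilon> \<xi> = \<lparr>
     Obj = Obj C,
     Arr = {(f0, f1). f0 \<in> Arr C \<and> f1 \<in> Hom C (Dom C f0) (\<epsilon> \<otimes>\<^sub>o\<^bsub>C\<^esub> Cod C f0)},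
     Dom = (\<lambda>(f0, f1). Dom C f0),
     Cod = (\<lambda>(f0, f1). Cod C f0),
     Ident = (\<lambda>X. as_even C \<epsilon> (\<ii>\<^bsub>C\<^esub> X)),
     Comp = (\<lambda>(g0, g1) (f0, f1).
       (Add C (g0 \<cdot>\<^bsub>C\<^esub> f0) (xi_cancel C \<epsilon> \<xi> (Cod C g0) \<cdot>\<^bsub>C\<^esub> (\<ii>\<^bsub>C\<^esub> \<epsilon> \<otimes>\<^sub>a\<^bsub>C\<^esub> g1) \<cdot>\<^bsub>C\<^esub> f1),
        Add C (g1 \<cdot>\<^bsub>C\<^esub> f0) ((\<ii>\<^bsub>C\<^esub> \<epsilon> \<otimes>\<^sub>a\<^bsub>C\<^esub> g0) \<cdot>\<^bsub>C\<^esub> f1))),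
     Zero = (\<lambda>X Y. (Zero C X Y, Zero C X (\<epsilon> \<otimes>\<^sub>o\<^bsub>C\<^esub> Y))),
     Add = (\<lambda>(f0, f1) (g0, g1). (Add C f0 g0, Add C f1 g1)),
     Scale = (\<lambda>r (f0, f1). (Scale C r f0, Scale C r f1)),
     TensorObj = TensorObj C,
     TensorArr = (\<lambda>(f0, f1) (f0', f1'). let Y = Cod C f0; Y' = Cod C f0' in
       (Add C (f0 \<otimes>\<^sub>a\<^bsub>C\<^esub> f0')
          (Scale C (-1) (xi_cancel C \<epsilon> \<xi> (Y \<otimes>\<^sub>o\<^bsub>C\<^esub> Y') \<cdot>\<^bsub>C\<^esub> (\<ii>\<^bsub>C\<^esub> \<epsilon> \<otimes>\<^sub>a\<^bsub>C\<^esub> eps_pull C c \<epsilon> Y Y')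
             \<cdot>\<^bsub>C\<^esub> Assoc C \<epsilon> Y (\<epsilon> \<otimes>\<^sub>o\<^bsub>C\<^esub> Y') \<cdot>\<^bsub>C\<^esub> (f1 \<otimes>\<^sub>a\<^bsub>C\<^esub> f1'))),
        Add C (Assoc C \<epsilon> Y Y' \<cdot>\<^bsub>C\<^esub> (f1 \<otimes>\<^sub>a\<^bsub>C\<^esub> f0'))
          (eps_pull C c \<epsilon> Y Y' \<cdot>\<^bsub>C\<^esub> (f0 \<otimes>\<^sub>a\<^bsub>C\<^esub> f1')))),
     UnitObj = UnitObj C,
     Assoc = (\<lambda>X Y Z. as_even C \<epsilon> (Assoc C X Y Z)),
     LUnit = (\<lambda>X. as_even C \<epsilon> (LUnit C X)),
     RUnit = (\<lambda>X. as_even C \<epsilon> (RUnit C X)),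
     Dual = Dual C,
     Ev = (\<lambda>X. as_even C \<epsilon> (Ev C X)),
     Coev = (\<lambda>X. as_even C \<epsilon> (Coev C X)),
     EvenPart = (\<lambda>(f0, f1). as_even C \<epsilon> f0),
     OddPart = (\<lambda>(f0, f1). (Zero C (Dom C f0) (Cod C f0), f1))\<rparr>"

end

theory Submission
  imports Defs
begin

text \<open>
  Everything that happens between even arrows is inherited from \<open>C\<close>, so the content is naturality
  on an odd arrow, that is, on an arrow \<open>f : X \<rightarrow> \<epsilon> \<otimes> Y\<close> of \<open>C\<close>.  Naturality of \<open>a\<close> at \<open>f\<close> and its
  monoidality give \<open>f\<^sup>*\<^sup>* \<circ> a\<^bsub>X\<^esub> = (a\<^bsub>\<epsilon>\<^esub> \<otimes> a\<^bsub>Y\<^esub>) \<circ> f\<close> up to the identification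
  \<open>(\<epsilon> \<otimes> Y)\<^sup>*\<^sup>* = \<epsilon>\<^sup>*\<^sup>* \<otimes> Y\<^sup>*\<^sup>*\<close>.  The bidual of \<open>f\<close> as an odd arrow arises from \<open>f\<^sup>*\<^sup>*\<close> by
  composing with \<open>u\<^bsub>\<epsilon>\<^esub>\<inverse> \<otimes> id\<close>: pulling the strand \<open>\<epsilon>\<close> to the left in both dualisations winds it
  around itself exactly as in the inverse Drinfeld isomorphism, and over- and undercrossings agree
  because \<open>\<epsilon>\<close> is transparent.  Hence the odd bidual of \<open>f\<close> composed with \<open>a\<^bsub>X\<^esub>\<close> is
  \<open>(u\<^bsub>\<epsilon>\<^esub>\<inverse> a\<^bsub>\<epsilon>\<^esub> \<otimes> a\<^bsub>Y\<^esub>) \<circ> f\<close>, which is \<open>\<plusminus> (id \<otimes> a\<^bsub>Y\<^esub>) \<circ> f\<close> when \<open>a\<^bsub>\<epsilon>\<^esub> = \<plusminus> u\<^bsub>\<epsilon>\<^esub>\<close>.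
\<close>

section \<open>Typed arrows\<close>

text \<open>
  With typing facts in the equational form \<open>arity C f = X \<Rrightarrow> Y\<close> the simplifier can compute the unknown
  objects in side conditions.  Injectivity of \<open>\<Rrightarrow>\<close> must not be a simp rule, since it would split these
  equations before the unknowns are instantiated.
\<close>

datatype 'o arity = Ill_typed | Arrow 'o 'o  (infix "\<Rrightarrow>" 60)

declare arity.inject [simp del]

text \<open>Everything outside \<open>Arr C\<close> is sent to \<open>Ill_typed\<close>, so one
  equation \<open>arity C f = X \<Rrightarrow> Y\<close> also carries
  \<open>f \<in> Arr C\<close>.\<close>

definition arity :: "('o, 'm, 'k, 'z) lincat_scheme \<Rightarrow> 'm \<Rightarrow> 'o arity" where
  "arity C f = (if f \<in> Arr C then Dom C f \<Rrightarrow> Cod C f else Ill_typed)"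

lemma arity_eq_iff: "arity C f = X \<Rrightarrow> Y \<longleftrightarrow> f \<in> Hom C X Y"
  by (auto simp: arity_def Hom_def arity.inject)

context linear_category
begin

abbreviation ty :: "'m \<Rightarrow> 'o arity" where "ty f \<equiv> arity C f"

lemma ty_Obj: "ty f = X \<Rrightarrow> Y \<Longrightarrow> X \<in> Obj C" "ty f = X \<Rrightarrow> Y \<Longrightarrow> Y \<in> Obj C"
  using Dom_Obj Cod_Obj by (auto simp: arity_eq_iff Hom_def)

lemma ty_ArrI: "f \<in> Arr C \<Longrightarrow> ty f = Dom C f \<Rrightarrow> Cod C f"
  by (simp add: arity_def)

lemma inverse_arr_iff: "ty f = X \<Rrightarrow> Y \<Longrightarrow>
    inverse_arr C f g \<longleftrightarrow> ty g = Y \<Rrightarrow> X \<and> g \<cdot> f = \<ii> X \<and> f \<cdot> g = \<ii> Y"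
  by (auto simp: inverse_arr_def arity_eq_iff Hom_def)

lemma ty_Dom [simp]: "ty f = X \<Rrightarrow> Y \<Longrightarrow> Dom C f = X"
  and ty_Cod [simp]: "ty f = X \<Rrightarrow> Y \<Longrightarrow> Cod C f = Y"
  and ty_Arr [simp]: "ty f = X \<Rrightarrow> Y \<Longrightarrow> f \<in> Arr C"
  by (auto simp: arity_eq_iff Hom_def)

text \<open>The middle objects are separate variables joined by \<open>Y' = Y\<close>: each typing
  premise is first solved by computation, and only then are the two objects compared. Many later
  rules on composites have the same form.\<close>

lemma ty_comp [simp]: "\<lbrakk>ty f = X \<Rrightarrow> Y; ty g = Y' \<Rrightarrow> Z; Y' = Y\<rbrakk> \<Longrightarrow> ty (g \<cdot> f) = X \<Rrightarrow> Z"
  using Comp_Hom by (auto simp: arity_eq_iff)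

lemma ty_ident [simp]: "X \<in> Obj C \<Longrightarrow> ty (\<ii> X) = X \<Rrightarrow> X"
  using Ident_Hom by (auto simp: arity_eq_iff)

lemma arr_assoc: "\<lbrakk>ty f = X \<Rrightarrow> Y; ty g = Y' \<Rrightarrow> Z; Y' = Y; ty h = Z' \<Rrightarrow> W; Z' = Z\<rbrakk>
    \<Longrightarrow> (h \<cdot> g) \<cdot> f = h \<cdot> g \<cdot> f"
  using Comp_assoc by (auto simp: arity_eq_iff)

lemma comp_id_left [simp]: "\<lbrakk>ty f = X \<Rrightarrow> Y; Y' = Y\<rbrakk> \<Longrightarrow> \<ii> Y' \<cdot> f = f"
  and comp_id_right [simp]: "\<lbrakk>ty f = X \<Rrightarrow> Y; X' = X\<rbrakk> \<Longrightarrow> f \<cdot> \<ii> X' = f"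
  using Comp_Ident_left Comp_Ident_right by (auto simp: arity_eq_iff)

text \<open>Composites are kept right-nested, where \<open>a \<cdot> b\<close> is no subterm of
  \<open>a \<cdot> b \<cdot> f\<close>; through \<open>THEN comp_rewrite\<close> an equation for two
  factors applies inside longer chains.\<close>

lemma comp_rewrite:
  assumes "a \<cdot> b = r" and "ty f = X \<Rrightarrow> Y" "ty b = Y' \<Rrightarrow> Z" "Y' = Y" "ty a = Z' \<Rrightarrow> W" "Z' = Z"
  shows "a \<cdot> b \<cdot> f = r \<cdot> f"
  using arr_assoc[OF assms(2-6)] assms(1) by simp

section \<open>Inverses and cancellation of isomorphisms\<close>

lemma inverse_arr_unique:
  assumes "inverse_arr C f g" "inverse_arr C f h"
  shows "g = h"
proof -
  obtain X Y where f: "ty f = X \<Rrightarrow> Y"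
    using assms(1) ty_ArrI by (metis inverse_arr_def)
  note gh = assms[unfolded inverse_arr_iff[OF f]]
  have "h = (g \<cdot> f) \<cdot> h"
    using f gh by simp
  also have "\<dots> = g \<cdot> f \<cdot> h"
    by (rule arr_assoc) (use f gh in auto)
  finally show ?thesis
    using f gh by simp
qed

lemma inv_arr_eqI: "inverse_arr C f g \<Longrightarrow> inv_arr C f = g"
  unfolding inv_arr_def using inverse_arr_unique by blast

lemma inverse_arr_inv_arr: "iso_arr C f \<Longrightarrow> inverse_arr C f (inv_arr C f)"
  unfolding iso_arr_def using inv_arr_eqI by metis

lemma
  assumes "iso_arr C f" "ty f = X \<Rrightarrow> Y"
  shows ty_inv: "ty (inv_arr C f) = Y \<Rrightarrow> X"
    and inv_left: "inv_arr C f \<cdot> f = \<ii> X"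
    and inv_right: "f \<cdot> inv_arr C f = \<ii> Y"
  using inverse_arr_inv_arr[OF assms(1)] by (auto simp: inverse_arr_iff[OF assms(2)])

lemma iso_arrI: "\<lbrakk>ty f = X \<Rrightarrow> Y; ty g = Y \<Rrightarrow> X; g \<cdot> f = \<ii> X; f \<cdot> g = \<ii> Y\<rbrakk> \<Longrightarrow> iso_arr C f"
  using inverse_arr_iff unfolding iso_arr_def by blast

lemma iso_ident [simp]: "X \<in> Obj C \<Longrightarrow> iso_arr C (\<ii> X)"
  by (rule iso_arrI[of _ X X "\<ii> X"]) simp_all

lemma iso_comp:
  assumes [simp]: "iso_arr C f" "iso_arr C g" "ty f = X \<Rrightarrow> Y" "ty g = Y \<Rrightarrow> Z"
  shows "iso_arr C (g \<cdot> f)"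
proof (rule iso_arrI)
  note [simp] = ty_inv[OF assms(1,3)] ty_inv[OF assms(2,4)] inv_left[OF assms(1,3)]
    inv_left[OF assms(2,4)] inv_right[OF assms(1,3)] inv_right[OF assms(2,4)]
  note [simp] = inv_left[OF assms(2,4), THEN comp_rewrite] inv_right[OF assms(1,3), THEN comp_rewrite] ty_Obj[OF assms(3)] ty_Obj[OF assms(4)]
  show "ty (g \<cdot> f) = X \<Rrightarrow> Z" "ty (inv_arr C f \<cdot> inv_arr C g) = Z \<Rrightarrow> X"
    by simp_all
  show "(inv_arr C f \<cdot> inv_arr C g) \<cdot> g \<cdot> f = \<ii> X" "(g \<cdot> f) \<cdot> inv_arr C f \<cdot> inv_arr C g = \<ii> Z"
    by (simp_all add: arr_assoc)
qed

lemma iso_cancel_left: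
  assumes "iso_arr C h" "h \<cdot> f = h \<cdot> g" "ty h = Y \<Rrightarrow> Z" "ty f = X \<Rrightarrow> Y" "ty g = X \<Rrightarrow> Y"
  shows "f = g"
proof -
  note [simp] = inv_left[OF assms(1,3)] ty_inv[OF assms(1,3)] assms(3-5)
  have "f = inv_arr C h \<cdot> h \<cdot> f" by (simp flip: arr_assoc)
  also have "\<dots> = g" unfolding assms(2) by (simp flip: arr_assoc)
  finally show ?thesis .
qed

lemma iso_cancel_right:
  assumes "iso_arr C h" "f \<cdot> h = g \<cdot> h" "ty h = Y \<Rrightarrow> Z" "ty f = Z \<Rrightarrow> W" "ty g = Z \<Rrightarrow> W"
  shows "f = g"
proof -
  note [simp] = inv_right[OF assms(1,3)] ty_inv[OF assms(1,3)] assms(3-5)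
  have "f = (f \<cdot> h) \<cdot> inv_arr C h" by (simp add: arr_assoc)
  also have "\<dots> = g" unfolding assms(2) by (simp add: arr_assoc)
  finally show ?thesis .
qed

lemma iso_inv_arr [simp]:
  assumes "iso_arr C f" "ty f = X \<Rrightarrow> Y"
  shows "iso_arr C (inv_arr C f)"
  using iso_arrI[OF ty_inv[OF assms] assms(2)] inv_left[OF assms] inv_right[OF assms] by simp

section \<open>Scalar multiples and zero arrows\<close>

lemma ty_scale [simp]: "ty f = X \<Rrightarrow> Y \<Longrightarrow> ty (Scale C r f) = X \<Rrightarrow> Y"
  using Scale_Hom by (auto simp: arity_eq_iff)

lemma scale_comp:
  assumes "ty f = X \<Rrightarrow> Y" "ty g = Y' \<Rrightarrow> Z" "Y' = Y"
  shows "Scale C r g \<cdot> f = Scale C r (g \<cdot> f)" "g \<cdot> Scale C r f = Scale C r (g \<cdot> f)"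
  using assms Comp_Scale_left Comp_Scale_right by (auto simp: arity_eq_iff)

lemma ty_zero [simp]: "\<lbrakk>X \<in> Obj C; Y \<in> Obj C\<rbrakk> \<Longrightarrow> ty (Zero C X Y) = X \<Rrightarrow> Y"
  using Zero_Hom by (auto simp: arity_eq_iff)

lemma add_zero [simp]:
  assumes "ty f = X \<Rrightarrow> Y" "X' = X" "Y' = Y"
  shows "Add C f (Zero C X' Y') = f" "Add C (Zero C X' Y') f = f"
proof -
  have f: "f \<in> Hom C X Y" and Z: "Zero C X Y \<in> Hom C X Y"
    using assms(1) Zero_Hom ty_Obj[OF assms(1)] by (simp_all add: arity_eq_iff)
  show "Add C f (Zero C X' Y') = f" "Add C (Zero C X' Y') f = f"
    using Add_Zero[OF f] Add_commute[OF f Z] assms(2,3) by simp_all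
qed

text \<open>Since 0 + 0 = 0, the arrow \<open>Scale C 0 f\<close> equals its own double, and in a
  group this forces it to be zero.\<close>

lemma scale_0:
  assumes "ty f = X \<Rrightarrow> Y"
  shows "Scale C 0 f = Zero C X Y"
proof -
  let ?z = "Scale C 0 f"
  have f: "f \<in> Hom C X Y"
    using assms by (simp add: arity_eq_iff)
  then have z: "?z \<in> Hom C X Y"
    by (rule Scale_Hom)
  have zz: "Add C ?z ?z = ?z"
    using Scale_plus[OF f, of 0 0] by simp
  obtain w where w: "w \<in> Hom C X Y" "Add C ?z w = Zero C X Y"
    using Add_inverse[OF z] by blast
  have "Zero C X Y = Add C (Add C ?z ?z) w"
    by (simp add: zz w(2))
  also have "\<dots> = ?z"
    using Add_assoc[OF z z w(1)] Add_Zero[OF z] by (simp add: w(2))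
  finally show ?thesis by simp
qed

lemma scale_zero [simp]:
  assumes [simp]: "X \<in> Obj C" "Y \<in> Obj C"
  shows "Scale C r (Zero C X Y) = Zero C X Y"
proof -
  have "Zero C X Y \<in> Hom C X Y"
    by (simp add: Zero_Hom)
  then have "Scale C (r * 0) (Zero C X Y) = Scale C r (Scale C 0 (Zero C X Y))"
    by (rule Scale_mult)
  then show ?thesis
    by (simp add: scale_0[of "Zero C X Y" X Y])
qed

lemma scale_one [simp]: "ty f = X \<Rrightarrow> Y \<Longrightarrow> Scale C 1 f = f"
  using Scale_one by (auto simp: arity_eq_iff)

lemma scale_scale: "ty f = X \<Rrightarrow> Y \<Longrightarrow> Scale C r (Scale C t f) = Scale C (r * t) f"
  using Scale_mult by (auto simp: arity_eq_iff)

text \<open>The zero arrow is \<open>Scale C 0\<close> of itself; the scalar moves out of the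
  composite, which is then zero by \<open>scale_0\<close>.\<close>

lemma comp_zero [simp]:
  "\<lbrakk>ty g = Y' \<Rrightarrow> Z; Y' = Y; X \<in> Obj C\<rbrakk> \<Longrightarrow> g \<cdot> Zero C X Y = Zero C X Z"
  "\<lbrakk>ty f = X \<Rrightarrow> Y'; Y' = Y; Z \<in> Obj C\<rbrakk> \<Longrightarrow> Zero C Y Z \<cdot> f = Zero C X Z"
proof -
  show "g \<cdot> Zero C X Y = Zero C X Z" if g: "ty g = Y' \<Rrightarrow> Z" and Y: "Y' = Y" and X: "X \<in> Obj C"
  proof -
    note [simp] = X g[unfolded Y] ty_Obj[OF g[unfolded Y]]
    have "g \<cdot> Scale C 0 (Zero C X Y) = Scale C 0 (g \<cdot> Zero C X Y)"
      by (rule scale_comp) auto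
    then show ?thesis
      by (simp add: scale_0[of "g \<cdot> Zero C X Y" X Z])
  qed
  show "Zero C Y Z \<cdot> f = Zero C X Z" if f: "ty f = X \<Rrightarrow> Y'" and Y: "Y' = Y" and Z: "Z \<in> Obj C"
  proof -
    note [simp] = Z f[unfolded Y] ty_Obj[OF f[unfolded Y]]
    have "Scale C 0 (Zero C Y Z) \<cdot> f = Scale C 0 (Zero C Y Z \<cdot> f)"
      by (rule scale_comp) auto
    then show ?thesis
      by (simp add: scale_0[of "Zero C Y Z \<cdot> f" X Z])
  qed
qed

end

section \<open>Coherence in monoidal categories\<close>

context linear_monoidal_category
begin

abbreviation lwhisker :: "'o \<Rightarrow> 'm \<Rightarrow> 'm" (infixr "\<rhd>" 65) where "X \<rhd> f \<equiv> \<ii> X \<otimes>\<^sub>a f"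
abbreviation rwhisker :: "'m \<Rightarrow> 'o \<Rightarrow> 'm" (infixl "\<lhd>" 66) where "f \<lhd> X \<equiv> f \<otimes>\<^sub>a \<ii> X"
abbreviation \<alpha> :: "'o \<Rightarrow> 'o \<Rightarrow> 'o \<Rightarrow> 'm" where "\<alpha> \<equiv> Assoc C"
abbreviation \<alpha>' :: "'o \<Rightarrow> 'o \<Rightarrow> 'o \<Rightarrow> 'm" where "\<alpha>' X Y Z \<equiv> inv_arr C (\<alpha> X Y Z)"
abbreviation lu :: "'o \<Rightarrow> 'm" where "lu \<equiv> LUnit C"
abbreviation lu' :: "'o \<Rightarrow> 'm" where "lu' X \<equiv> inv_arr C (lu X)"
abbreviation ru :: "'o \<Rightarrow> 'm" where "ru \<equiv> RUnit C"
abbreviation ru' :: "'o \<Rightarrow> 'm" where "ru' X \<equiv> inv_arr C (ru X)"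

declare TensorObj_Obj [simp] UnitObj_Obj [simp] TensorArr_Ident [simp]
  Assoc_iso [simp] LUnit_iso [simp] RUnit_iso [simp]

lemma ty_tensor [simp]:
  "\<lbrakk>ty f = X \<Rrightarrow> Y; ty g = X' \<Rrightarrow> Y'\<rbrakk> \<Longrightarrow> ty (f \<otimes>\<^sub>a g) = X \<otimes>\<^sub>o X' \<Rrightarrow> Y \<otimes>\<^sub>o Y'"
  using TensorArr_Hom by (auto simp: arity_eq_iff)

lemma ty_constraints [simp]:
  "\<lbrakk>X \<in> Obj C; Y \<in> Obj C; Z \<in> Obj C\<rbrakk> \<Longrightarrow> ty (\<alpha> X Y Z) = (X \<otimes>\<^sub>o Y) \<otimes>\<^sub>o Z \<Rrightarrow> X \<otimes>\<^sub>o Y \<otimes>\<^sub>o Z"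
  "X \<in> Obj C \<Longrightarrow> ty (lu X) = \<I> \<otimes>\<^sub>o X \<Rrightarrow> X"
  "X \<in> Obj C \<Longrightarrow> ty (ru X) = X \<otimes>\<^sub>o \<I> \<Rrightarrow> X"
  using Assoc_Hom LUnit_Hom RUnit_Hom by (auto simp: arity_eq_iff)

lemma constraint_inverses [simp]:
  "\<lbrakk>X \<in> Obj C; Y \<in> Obj C; Z \<in> Obj C\<rbrakk> \<Longrightarrow> ty (\<alpha>' X Y Z) = X \<otimes>\<^sub>o Y \<otimes>\<^sub>o Z \<Rrightarrow> (X \<otimes>\<^sub>o Y) \<otimes>\<^sub>o Z"
  "X \<in> Obj C \<Longrightarrow> ty (lu' X) = X \<Rrightarrow> \<I> \<otimes>\<^sub>o X"
  "X \<in> Obj C \<Longrightarrow> ty (ru' X) = X \<Rrightarrow> X \<otimes>\<^sub>o \<I>"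
  "\<lbrakk>X \<in> Obj C; Y \<in> Obj C; Z \<in> Obj C\<rbrakk> \<Longrightarrow> \<alpha> X Y Z \<cdot> \<alpha>' X Y Z = \<ii> (X \<otimes>\<^sub>o Y \<otimes>\<^sub>o Z)"
  "\<lbrakk>X \<in> Obj C; Y \<in> Obj C; Z \<in> Obj C\<rbrakk> \<Longrightarrow> \<alpha>' X Y Z \<cdot> \<alpha> X Y Z = \<ii> ((X \<otimes>\<^sub>o Y) \<otimes>\<^sub>o Z)"
  "X \<in> Obj C \<Longrightarrow> lu X \<cdot> lu' X = \<ii> X"
  "X \<in> Obj C \<Longrightarrow> lu' X \<cdot> lu X = \<ii> (\<I> \<otimes>\<^sub>o X)"
  "X \<in> Obj C \<Longrightarrow> ru X \<cdot> ru' X = \<ii> X"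
  "X \<in> Obj C \<Longrightarrow> ru' X \<cdot> ru X = \<ii> (X \<otimes>\<^sub>o \<I>)"
  by (auto intro!: ty_inv inv_left inv_right)

lemma constraint_inverses_assoc [simp]:
  "\<lbrakk>X \<in> Obj C; Y \<in> Obj C; Z \<in> Obj C; ty f = W \<Rrightarrow> V; V = X \<otimes>\<^sub>o Y \<otimes>\<^sub>o Z\<rbrakk>
    \<Longrightarrow> \<alpha> X Y Z \<cdot> \<alpha>' X Y Z \<cdot> f = f"
  "\<lbrakk>X \<in> Obj C; Y \<in> Obj C; Z \<in> Obj C; ty f = W \<Rrightarrow> V; V = (X \<otimes>\<^sub>o Y) \<otimes>\<^sub>o Z\<rbrakk>
    \<Longrightarrow> \<alpha>' X Y Z \<cdot> \<alpha> X Y Z \<cdot> f = f"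
  "\<lbrakk>X \<in> Obj C; ty f = W \<Rrightarrow> X\<rbrakk> \<Longrightarrow> lu X \<cdot> lu' X \<cdot> f = f"
  "\<lbrakk>X \<in> Obj C; ty f = W \<Rrightarrow> V; V = \<I> \<otimes>\<^sub>o X\<rbrakk> \<Longrightarrow> lu' X \<cdot> lu X \<cdot> f = f"
  by (simp_all flip: arr_assoc)

lemma tensor_comp: "\<lbrakk>ty f = X \<Rrightarrow> Y; ty g = Y1 \<Rrightarrow> Z; Y1 = Y; ty f' = X' \<Rrightarrow> Y'; ty g' = Y2 \<Rrightarrow> Z'; Y2 = Y'\<rbrakk>
    \<Longrightarrow> (g \<otimes>\<^sub>a g') \<cdot> (f \<otimes>\<^sub>a f') = (g \<cdot> f) \<otimes>\<^sub>a (g' \<cdot> f')"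
  using TensorArr_Comp by (auto simp: arity_eq_iff)

lemma lwhisker_comp: "\<lbrakk>X \<in> Obj C; ty f = A \<Rrightarrow> B; ty g = B' \<Rrightarrow> D; B' = B\<rbrakk>
    \<Longrightarrow> X \<rhd> (g \<cdot> f) = (X \<rhd> g) \<cdot> (X \<rhd> f)"
  by (simp add: tensor_comp)

lemma rwhisker_comp: "\<lbrakk>X \<in> Obj C; ty f = A \<Rrightarrow> B; ty g = B' \<Rrightarrow> D; B' = B\<rbrakk>
    \<Longrightarrow> (g \<cdot> f) \<lhd> X = (g \<lhd> X) \<cdot> (f \<lhd> X)"
  by (simp add: tensor_comp)

lemma interchange:
  assumes [simp]: "ty f = A \<Rrightarrow> B" "ty g = A' \<Rrightarrow> B'"
  shows "(f \<lhd> B') \<cdot> (A \<rhd> g) = f \<otimes>\<^sub>a g" "(B \<rhd> g) \<cdot> (f \<lhd> A') = f \<otimes>\<^sub>a g"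
  using ty_Obj[OF assms(1)] ty_Obj[OF assms(2)] by (simp_all add: tensor_comp)

lemma lwhisker_iso_cancel [simp]:
  assumes [simp]: "iso_arr C f" "ty f = A \<Rrightarrow> B" "X \<in> Obj C"
  shows "(X \<rhd> f) \<cdot> (X \<rhd> inv_arr C f) = \<ii> (X \<otimes>\<^sub>o B)" "(X \<rhd> inv_arr C f) \<cdot> (X \<rhd> f) = \<ii> (X \<otimes>\<^sub>o A)"
  using ty_Obj[OF assms(2)] ty_inv[OF assms(1,2)] inv_left[OF assms(1,2)] inv_right[OF assms(1,2)]
  by (simp_all add: tensor_comp)

lemma lwhisker_iso_cancel_assoc [simp]:
  assumes [simp]: "iso_arr C f" "ty f = A \<Rrightarrow> B" "X \<in> Obj C"
  shows "\<lbrakk>ty h = W \<Rrightarrow> V; V = X \<otimes>\<^sub>o B\<rbrakk> \<Longrightarrow> (X \<rhd> f) \<cdot> (X \<rhd> inv_arr C f) \<cdot> h = h"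
    "\<lbrakk>ty h = W \<Rrightarrow> V; V = X \<otimes>\<^sub>o A\<rbrakk> \<Longrightarrow> (X \<rhd> inv_arr C f) \<cdot> (X \<rhd> f) \<cdot> h = h"
  using ty_inv[OF assms(1,2)] by (simp_all flip: arr_assoc)

lemma lwhisker2_iso_cancel [simp]:
  assumes [simp]: "iso_arr C f" "ty f = A \<Rrightarrow> B" "X \<in> Obj C" "Y \<in> Obj C"
  shows "\<lbrakk>ty h = W \<Rrightarrow> V; V = X \<otimes>\<^sub>o Y \<otimes>\<^sub>o B\<rbrakk> \<Longrightarrow> (X \<rhd> Y \<rhd> f) \<cdot> (X \<rhd> Y \<rhd> inv_arr C f) \<cdot> h = h"
    "\<lbrakk>ty h = W \<Rrightarrow> V; V = X \<otimes>\<^sub>o Y \<otimes>\<^sub>o A\<rbrakk> \<Longrightarrow> (X \<rhd> Y \<rhd> inv_arr C f) \<cdot> (X \<rhd> Y \<rhd> f) \<cdot> h = h"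
  using ty_inv[OF assms(1,2)] ty_Obj[OF assms(2)] inv_left[OF assms(1,2)] inv_right[OF assms(1,2)]
  by (simp_all flip: arr_assoc lwhisker_comp)

section \<open>Associators and unit constraints under whiskering\<close>

lemma assoc_natural:
  assumes "ty f = X \<Rrightarrow> X'" "ty g = Y \<Rrightarrow> Y'" "ty h = Z \<Rrightarrow> Z'"
  shows "(f \<otimes>\<^sub>a g) \<otimes>\<^sub>a h = \<alpha>' X' Y' Z' \<cdot> (f \<otimes>\<^sub>a g \<otimes>\<^sub>a h) \<cdot> \<alpha> X Y Z"
proof -
  have "\<alpha> X' Y' Z' \<cdot> ((f \<otimes>\<^sub>a g) \<otimes>\<^sub>a h) = (f \<otimes>\<^sub>a g \<otimes>\<^sub>a h) \<cdot> \<alpha> X Y Z"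
    using Assoc_natural assms by (auto simp: arity_eq_iff)
  from this[symmetric] show ?thesis
    using ty_Obj[OF assms(1)] ty_Obj[OF assms(2)] ty_Obj[OF assms(3)] assms by simp
qed

lemma assoc_natural_ident:
  assumes "X \<in> Obj C" "Y \<in> Obj C" "ty h = Z \<Rrightarrow> Z'"
  shows "(X \<otimes>\<^sub>o Y) \<rhd> h = \<alpha>' X Y Z' \<cdot> (X \<rhd> Y \<rhd> h) \<cdot> \<alpha> X Y Z"
  using assoc_natural[of "\<ii> X" X X "\<ii> Y" Y Y h] assms by simp

text \<open>The pentagon solved for \<open>\<alpha> W X Y \<lhd> Z\<close>, so that right whiskering
  can be removed from associators.\<close>

lemma assoc_rwhisker:
  assumes [simp]: "W \<in> Obj C" "X \<in> Obj C" "Y \<in> Obj C" "Z \<in> Obj C"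
  shows "\<alpha> W X Y \<lhd> Z = \<alpha>' W (X \<otimes>\<^sub>o Y) Z \<cdot> (W \<rhd> \<alpha>' X Y Z) \<cdot> \<alpha> W X (Y \<otimes>\<^sub>o Z) \<cdot> \<alpha> (W \<otimes>\<^sub>o X) Y Z"
  by (simp add: pentagon)

text \<open>A left inverse suffices, since \<open>f \<lhd> X\<close> is invertible with inverse
  \<open>inv_arr C f \<lhd> X\<close>. This yields the rules for whiskered inverse constraints from
  those for the constraints.\<close>

lemma inverse_rwhisker:
  assumes "iso_arr C f" "ty f = A \<Rrightarrow> B" "X \<in> Obj C"
    "ty g = B \<otimes>\<^sub>o X \<Rrightarrow> A \<otimes>\<^sub>o X" "g \<cdot> (f \<lhd> X) = \<ii> (A \<otimes>\<^sub>o X)"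
  shows "inv_arr C f \<lhd> X = g"
proof -
  note [simp] = assms ty_inv[OF assms(1,2)] inv_right[OF assms(1,2)] ty_Obj[OF assms(2)]
  have "inv_arr C f \<lhd> X = \<ii> (A \<otimes>\<^sub>o X) \<cdot> (inv_arr C f \<lhd> X)" by simp
  also have "\<dots> = (g \<cdot> (f \<lhd> X)) \<cdot> (inv_arr C f \<lhd> X)" by (simp only: assms(5))
  also have "\<dots> = g \<cdot> ((f \<lhd> X) \<cdot> (inv_arr C f \<lhd> X))" by (simp only: arr_assoc ty_tensor ty_ident assms(1-4) ty_Obj[OF assms(2)] ty_inv[OF assms(1,2)])
  also have "\<dots> = g" by (simp add: tensor_comp)
  finally show ?thesis .
qed

lemma assoc_inv_rwhisker:
  assumes [simp]: "W \<in> Obj C" "X \<in> Obj C" "Y \<in> Obj C" "Z \<in> Obj C"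
  shows "\<alpha>' W X Y \<lhd> Z = \<alpha>' (W \<otimes>\<^sub>o X) Y Z \<cdot> \<alpha>' W X (Y \<otimes>\<^sub>o Z) \<cdot> (W \<rhd> \<alpha> X Y Z) \<cdot> \<alpha> W (X \<otimes>\<^sub>o Y) Z"
  by (rule inverse_rwhisker[of _ "(W \<otimes>\<^sub>o X) \<otimes>\<^sub>o Y" "W \<otimes>\<^sub>o X \<otimes>\<^sub>o Y"])
     (simp_all add: arr_assoc assoc_rwhisker)

lemma lunit_natural: "ty f = X \<Rrightarrow> Y \<Longrightarrow> lu Y \<cdot> (\<I> \<rhd> f) = f \<cdot> lu X"
  using LUnit_natural by (auto simp: arity_eq_iff)

lemma iso_tensor:
  assumes "iso_arr C f" "iso_arr C g" "ty f = A \<Rrightarrow> B" "ty g = A' \<Rrightarrow> B'"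
  shows "iso_arr C (f \<otimes>\<^sub>a g)"
proof (rule iso_arrI)
  note [simp] = assms ty_inv[OF assms(1,3)] ty_inv[OF assms(2,4)] inv_left[OF assms(1,3)]
    inv_left[OF assms(2,4)] inv_right[OF assms(1,3)] inv_right[OF assms(2,4)]
    ty_Obj[OF assms(3)] ty_Obj[OF assms(4)]
  show "ty (f \<otimes>\<^sub>a g) = A \<otimes>\<^sub>o A' \<Rrightarrow> B \<otimes>\<^sub>o B'"
    "ty (inv_arr C f \<otimes>\<^sub>a inv_arr C g) = B \<otimes>\<^sub>o B' \<Rrightarrow> A \<otimes>\<^sub>o A'"
    by simp_all
  show "(inv_arr C f \<otimes>\<^sub>a inv_arr C g) \<cdot> (f \<otimes>\<^sub>a g) = \<ii> (A \<otimes>\<^sub>o A')"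
    "(f \<otimes>\<^sub>a g) \<cdot> (inv_arr C f \<otimes>\<^sub>a inv_arr C g) = \<ii> (B \<otimes>\<^sub>o B')"
    by (simp_all add: tensor_comp)
qed

text \<open>Tensoring with the unit is faithful, being naturally isomorphic to the identity functor
  through \<open>lu\<close>.\<close>

lemma unit_lwhisker_inj:
  assumes "\<I> \<rhd> f = \<I> \<rhd> g" "ty f = X \<Rrightarrow> Y" "ty g = X \<Rrightarrow> Y"
  shows "f = g"
proof (rule iso_cancel_right)
  show "f \<cdot> lu X = g \<cdot> lu X"
    using assms by (simp flip: lunit_natural)
qed (use assms ty_Obj[OF assms(2)] in auto)

text \<open>Kelly's argument: after tensoring with \<open>\<I>\<close> on the left, both sides agree
  by the pentagon and the triangle, and this tensoring is faithful.\<close>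

lemma lunit_rwhisker:
  assumes [simp]: "X \<in> Obj C" "Y \<in> Obj C"
  shows "lu X \<lhd> Y = lu (X \<otimes>\<^sub>o Y) \<cdot> \<alpha> \<I> X Y"
proof (rule unit_lwhisker_inj)
  have "(\<I> \<rhd> (lu (X \<otimes>\<^sub>o Y) \<cdot> \<alpha> \<I> X Y)) \<cdot> \<alpha> \<I> (\<I> \<otimes>\<^sub>o X) Y \<cdot> (\<alpha> \<I> \<I> X \<lhd> Y)
      = \<alpha> \<I> X Y \<cdot> ((ru \<I> \<lhd> X) \<lhd> Y)"
    by (simp add: lwhisker_comp arr_assoc assoc_rwhisker assoc_natural
        triangle[THEN comp_rewrite])
  also have "\<dots> = (\<I> \<rhd> (lu X \<lhd> Y)) \<cdot> \<alpha> \<I> (\<I> \<otimes>\<^sub>o X) Y \<cdot> (\<alpha> \<I> \<I> X \<lhd> Y)"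
    by (simp flip: triangle add: rwhisker_comp assoc_natural arr_assoc)
  finally have "((\<I> \<rhd> (lu X \<lhd> Y)) \<cdot> \<alpha> \<I> (\<I> \<otimes>\<^sub>o X) Y) \<cdot> (\<alpha> \<I> \<I> X \<lhd> Y)
    = ((\<I> \<rhd> (lu (X \<otimes>\<^sub>o Y) \<cdot> \<alpha> \<I> X Y)) \<cdot> \<alpha> \<I> (\<I> \<otimes>\<^sub>o X) Y) \<cdot> (\<alpha> \<I> \<I> X \<lhd> Y)"
    by (simp add: arr_assoc)
  then have "(\<I> \<rhd> (lu X \<lhd> Y)) \<cdot> \<alpha> \<I> (\<I> \<otimes>\<^sub>o X) Y
    = (\<I> \<rhd> (lu (X \<otimes>\<^sub>o Y) \<cdot> \<alpha> \<I> X Y)) \<cdot> \<alpha> \<I> (\<I> \<otimes>\<^sub>o X) Y"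
    by (rule iso_cancel_right[rotated]) (simp_all add: iso_tensor)
  then show "\<I> \<rhd> (lu X \<lhd> Y) = \<I> \<rhd> (lu (X \<otimes>\<^sub>o Y) \<cdot> \<alpha> \<I> X Y)"
    by (rule iso_cancel_right[rotated]) simp_all
qed simp_all

lemma lunit_inv_rwhisker:
  assumes [simp]: "X \<in> Obj C" "Y \<in> Obj C"
  shows "lu' X \<lhd> Y = \<alpha>' \<I> X Y \<cdot> lu' (X \<otimes>\<^sub>o Y)"
  by (rule inverse_rwhisker[of _ "\<I> \<otimes>\<^sub>o X" X]) (simp_all add: arr_assoc lunit_rwhisker)

lemma runit_natural: "ty f = X \<Rrightarrow> Y \<Longrightarrow> ru Y \<cdot> (f \<lhd> \<I>) = f \<cdot> ru X"
  using RUnit_natural by (auto simp: arity_eq_iff)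

lemma lunit_inv_natural:
  assumes "ty f = X \<Rrightarrow> Y"
  shows "lu' Y \<cdot> f = (\<I> \<rhd> f) \<cdot> lu' X"
proof -
  note [simp] = assms ty_Obj[OF assms]
  have "lu' Y \<cdot> f = lu' Y \<cdot> (f \<cdot> lu X) \<cdot> lu' X" by (simp add: arr_assoc)
  also have "\<dots> = (\<I> \<rhd> f) \<cdot> lu' X" by (simp flip: lunit_natural add: arr_assoc)
  finally show ?thesis .
qed

lemma triangle_inv:
  assumes [simp]: "X \<in> Obj C" "Y \<in> Obj C"
  shows "ru' X \<lhd> Y = \<alpha>' X \<I> Y \<cdot> (X \<rhd> lu' Y)"
  by (rule inverse_rwhisker[of _ "X \<otimes>\<^sub>o \<I>" "X"]) (simp_all add: arr_assoc flip: triangle)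

text \<open>
  These rules move all constraints into a normal form in which every product is nested to the right.
\<close>

lemmas coherence = arr_assoc lwhisker_comp rwhisker_comp assoc_natural assoc_natural_ident
  assoc_rwhisker assoc_inv_rwhisker lunit_rwhisker lunit_inv_rwhisker triangle_inv

text \<open>By naturality of the right unit constraint, \<open>f\<close> is
  \<open>f \<lhd> \<I>\<close> composed with isomorphisms on both sides.\<close>

lemma iso_rwhisker_unit:
  assumes "iso_arr C (f \<lhd> \<I>)" "ty f = X \<Rrightarrow> Y"
  shows "iso_arr C f"
proof -
  note [simp] = assms ty_Obj[OF assms(2)]
  have "ru Y \<cdot> (f \<lhd> \<I>) = f \<cdot> ru X"
    using runit_natural assms(2) by blast
  then have "(ru Y \<cdot> (f \<lhd> \<I>)) \<cdot> ru' X = f"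
    by (simp add: arr_assoc)
  moreover have "iso_arr C ((ru Y \<cdot> (f \<lhd> \<I>)) \<cdot> ru' X)"
    by (rule iso_comp[of _ _ X "X \<otimes>\<^sub>o \<I>" Y] iso_comp[of _ _ "X \<otimes>\<^sub>o \<I>" "Y \<otimes>\<^sub>o \<I>" Y] iso_inv_arr | simp)+
  ultimately show ?thesis by simp
qed

lemma scale_tensor:
  assumes "ty f = X \<Rrightarrow> Y" "ty g = X' \<Rrightarrow> Y'"
  shows "Scale C r f \<otimes>\<^sub>a g = Scale C r (f \<otimes>\<^sub>a g)" "f \<otimes>\<^sub>a Scale C r g = Scale C r (f \<otimes>\<^sub>a g)"
  using assms TensorArr_Scale_left TensorArr_Scale_right by (auto simp: arity_eq_iff)

lemma tensor_zero [simp]: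
  assumes "ty f = X \<Rrightarrow> Y" "A \<in> Obj C" "B \<in> Obj C"
  shows "f \<otimes>\<^sub>a Zero C A B = Zero C (X \<otimes>\<^sub>o A) (Y \<otimes>\<^sub>o B)"
    and "Zero C A B \<otimes>\<^sub>a f = Zero C (A \<otimes>\<^sub>o X) (B \<otimes>\<^sub>o Y)"
proof -
  note [simp] = assms
  have "f \<otimes>\<^sub>a Scale C 0 (Zero C A B) = Scale C 0 (f \<otimes>\<^sub>a Zero C A B)"
    "Scale C 0 (Zero C A B) \<otimes>\<^sub>a f = Scale C 0 (Zero C A B \<otimes>\<^sub>a f)"
    by (rule scale_tensor; simp)+
  then show "f \<otimes>\<^sub>a Zero C A B = Zero C (X \<otimes>\<^sub>o A) (Y \<otimes>\<^sub>o B)"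
    "Zero C A B \<otimes>\<^sub>a f = Zero C (A \<otimes>\<^sub>o X) (B \<otimes>\<^sub>o Y)"
    by (simp_all add: scale_0[of "f \<otimes>\<^sub>a Zero C A B" "X \<otimes>\<^sub>o A" "Y \<otimes>\<^sub>o B"]
        scale_0[of "Zero C A B \<otimes>\<^sub>a f" "A \<otimes>\<^sub>o X" "B \<otimes>\<^sub>o Y"])
qed

text \<open>
  The following arrows act on right-nested products, with a spectator \<open>Z\<close> as last factor.  The
  associators and unit constraints are absorbed, so string diagrams can be computed with as if \<open>C\<close> were
  strict; sliding one part of a diagram past another is naturality in \<open>Z\<close>.
\<close>

definition cap :: "'m \<Rightarrow> 'o \<Rightarrow> 'o \<Rightarrow> 'o \<Rightarrow> 'm" where
  "cap k A B Z = lu Z \<cdot> (k \<lhd> Z) \<cdot> \<alpha>' A B Z"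

definition cup :: "'m \<Rightarrow> 'o \<Rightarrow> 'o \<Rightarrow> 'o \<Rightarrow> 'm" where
  "cup h A B Z = \<alpha> A B Z \<cdot> (h \<lhd> Z) \<cdot> lu' Z"

definition spl :: "'m \<Rightarrow> 'o \<Rightarrow> 'o \<Rightarrow> 'o \<Rightarrow> 'm" where
  "spl f A B Z = \<alpha> A B Z \<cdot> (f \<lhd> Z)"

lemma ty_action [simp]:
  "\<lbrakk>ty k = A \<otimes>\<^sub>o B \<Rrightarrow> \<I>; A \<in> Obj C; B \<in> Obj C; Z \<in> Obj C\<rbrakk>
    \<Longrightarrow> ty (cap k A B Z) = A \<otimes>\<^sub>o B \<otimes>\<^sub>o Z \<Rrightarrow> Z"
  "\<lbrakk>ty h = \<I> \<Rrightarrow> A \<otimes>\<^sub>o B; A \<in> Obj C; B \<in> Obj C; Z \<in> Obj C\<rbrakk>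
    \<Longrightarrow> ty (cup h A B Z) = Z \<Rrightarrow> A \<otimes>\<^sub>o B \<otimes>\<^sub>o Z"
  "\<lbrakk>ty f = X \<Rrightarrow> A \<otimes>\<^sub>o B; A \<in> Obj C; B \<in> Obj C; Z \<in> Obj C\<rbrakk>
    \<Longrightarrow> ty (spl f A B Z) = X \<otimes>\<^sub>o Z \<Rrightarrow> A \<otimes>\<^sub>o B \<otimes>\<^sub>o Z"
  by (simp_all add: cap_def cup_def spl_def)

lemma rwhisker_natural:
  assumes [simp]: "ty f = X \<Rrightarrow> Y" "ty z = Z \<Rrightarrow> Z'"
  shows "(Y \<rhd> z) \<cdot> (f \<lhd> Z) = (f \<lhd> Z') \<cdot> (X \<rhd> z)"
  by (simp add: interchange)

lemma assoc_lwhisker_natural: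
  assumes [simp]: "X \<in> Obj C" "Y \<in> Obj C" "ty z = Z \<Rrightarrow> Z'"
  shows "\<alpha> X Y Z' \<cdot> ((X \<otimes>\<^sub>o Y) \<rhd> z) = (X \<rhd> Y \<rhd> z) \<cdot> \<alpha> X Y Z"
    "((X \<otimes>\<^sub>o Y) \<rhd> z) \<cdot> \<alpha>' X Y Z = \<alpha>' X Y Z' \<cdot> (X \<rhd> Y \<rhd> z)"
  using ty_Obj[OF assms(3)] by (simp_all add: assoc_natural_ident arr_assoc)

lemma cap_natural:
  assumes [simp]: "ty k = A \<otimes>\<^sub>o B \<Rrightarrow> \<I>" "A \<in> Obj C" "B \<in> Obj C" "ty z = Z \<Rrightarrow> Z'"
  shows "cap k A B Z' \<cdot> (A \<rhd> B \<rhd> z) = z \<cdot> cap k A B Z"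
proof -
  note [simp] = ty_Obj[OF assms(4)]
  have "cap k A B Z' \<cdot> (A \<rhd> B \<rhd> z) = lu Z' \<cdot> ((k \<lhd> Z') \<cdot> ((A \<otimes>\<^sub>o B) \<rhd> z)) \<cdot> \<alpha>' A B Z"
    by (simp add: cap_def arr_assoc assoc_lwhisker_natural(2))
  also have "\<dots> = (lu Z' \<cdot> (\<I> \<rhd> z)) \<cdot> (k \<lhd> Z) \<cdot> \<alpha>' A B Z"
    by (simp flip: rwhisker_natural add: arr_assoc)
  also have "\<dots> = z \<cdot> cap k A B Z"
    by (simp add: lunit_natural cap_def arr_assoc)
  finally show ?thesis .
qed

lemma cup_natural:
  assumes [simp]: "ty h = \<I> \<Rrightarrow> A \<otimes>\<^sub>o B" "A \<in> Obj C" "B \<in> Obj C" "ty z = Z \<Rrightarrow> Z'"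
  shows "(A \<rhd> B \<rhd> z) \<cdot> cup h A B Z = cup h A B Z' \<cdot> z"
proof -
  note [simp] = ty_Obj[OF assms(4)]
  have "cup h A B Z' \<cdot> z = \<alpha> A B Z' \<cdot> ((h \<lhd> Z') \<cdot> (\<I> \<rhd> z)) \<cdot> lu' Z"
    by (simp add: cup_def arr_assoc lunit_inv_natural)
  also have "\<dots> = (\<alpha> A B Z' \<cdot> ((A \<otimes>\<^sub>o B) \<rhd> z)) \<cdot> (h \<lhd> Z) \<cdot> lu' Z"
    by (simp flip: rwhisker_natural add: arr_assoc)
  also have "\<dots> = (A \<rhd> B \<rhd> z) \<cdot> cup h A B Z"
    by (simp add: assoc_lwhisker_natural cup_def arr_assoc)
  finally show ?thesis by simp
qed

lemma spl_natural:
  assumes [simp]: "ty f = X \<Rrightarrow> A \<otimes>\<^sub>o B" "A \<in> Obj C" "B \<in> Obj C" "ty z = Z \<Rrightarrow> Z'"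
  shows "(A \<rhd> B \<rhd> z) \<cdot> spl f A B Z = spl f A B Z' \<cdot> (X \<rhd> z)"
proof -
  note [simp] = ty_Obj[OF assms(4)] ty_Obj(1)[OF assms(1)]
  have "spl f A B Z' \<cdot> (X \<rhd> z) = (\<alpha> A B Z' \<cdot> ((A \<otimes>\<^sub>o B) \<rhd> z)) \<cdot> (f \<lhd> Z)"
    by (simp add: spl_def arr_assoc rwhisker_natural)
  also have "\<dots> = (A \<rhd> B \<rhd> z) \<cdot> spl f A B Z"
    by (simp add: assoc_lwhisker_natural spl_def arr_assoc)
  finally show ?thesis by simp
qed

lemmas cap_natural_assoc = cap_natural[THEN comp_rewrite]

section \<open>Snakes and zigzags in spectator form\<close>

lemma cap_comp:
  assumes [simp]: "ty e = A \<otimes>\<^sub>o B \<Rrightarrow> \<I>" "A \<in> Obj C" "B \<in> Obj C" "ty f = X \<Rrightarrow> B" "Z \<in> Obj C"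
  shows "cap (e \<cdot> (A \<rhd> f)) A X Z = cap e A B Z \<cdot> (A \<rhd> f \<lhd> Z)"
  using ty_Obj[OF assms(4)] by (simp add: cap_def coherence)

lemma cap_comp_left:
  assumes [simp]: "ty e = A \<otimes>\<^sub>o B \<Rrightarrow> \<I>" "A \<in> Obj C" "B \<in> Obj C" "ty f = X \<Rrightarrow> A" "Z \<in> Obj C"
  shows "cap (e \<cdot> (f \<lhd> B)) X B Z = cap e A B Z \<cdot> (f \<lhd> B \<otimes>\<^sub>o Z)"
  using ty_Obj[OF assms(4)] by (simp add: cap_def coherence)

lemma general_snake_rwhisker:
  assumes [simp]: "ty e = A \<otimes>\<^sub>o X \<Rrightarrow> P" "ty h = \<I> \<Rrightarrow> X \<otimes>\<^sub>o B"
    "A \<in> Obj C" "X \<in> Obj C" "B \<in> Obj C" "Z \<in> Obj C"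
  shows "\<alpha> P B Z \<cdot> (((e \<lhd> B) \<cdot> \<alpha>' A X B \<cdot> (A \<rhd> h) \<cdot> ru' A) \<lhd> Z)
    = (e \<lhd> (B \<otimes>\<^sub>o Z)) \<cdot> \<alpha>' A X (B \<otimes>\<^sub>o Z) \<cdot> (A \<rhd> cup h X B Z)"
  using ty_Obj[OF assms(1)] by (simp add: cup_def coherence)

lemma ty_snake [simp]:
  "\<lbrakk>ty e = A \<otimes>\<^sub>o X \<Rrightarrow> \<I>; ty h = \<I> \<Rrightarrow> X \<otimes>\<^sub>o B; A \<in> Obj C; X \<in> Obj C; B \<in> Obj C\<rbrakk>
  \<Longrightarrow> ty (snake C A X B e h) = A \<Rrightarrow> B"
  by (simp add: snake_def)

text \<open>In spectator form a snake is a cup followed by a cap; the constraints in its definition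
  are absorbed.\<close>

lemma snake_rwhisker:
  assumes [simp]: "ty e = A \<otimes>\<^sub>o X \<Rrightarrow> \<I>" "ty h = \<I> \<Rrightarrow> X \<otimes>\<^sub>o B"
    "A \<in> Obj C" "X \<in> Obj C" "B \<in> Obj C" "Z \<in> Obj C"
  shows "snake C A X B e h \<lhd> Z = cap e A X (B \<otimes>\<^sub>o Z) \<cdot> (A \<rhd> cup h X B Z)"
proof -
  have "snake C A X B e h \<lhd> Z
     = lu (B \<otimes>\<^sub>o Z) \<cdot> (\<alpha> \<I> B Z \<cdot> (((e \<lhd> B) \<cdot> \<alpha>' A X B \<cdot> (A \<rhd> h) \<cdot> ru' A) \<lhd> Z))"
    by (simp add: snake_def rwhisker_comp lunit_rwhisker arr_assoc)
  then show ?thesis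
    by (simp add: general_snake_rwhisker cap_def arr_assoc)
qed

lemma left_dual_ty:
  assumes "is_left_dual C X D e h"
  shows "X \<in> Obj C" "D \<in> Obj C" "ty e = D \<otimes>\<^sub>o X \<Rrightarrow> \<I>" "ty h = \<I> \<Rrightarrow> X \<otimes>\<^sub>o D"
  using assms by (auto simp: is_left_dual_def arity_eq_iff)

text \<open>Both identities come from \<open>is_left_dual\<close> by whiskering with
  \<open>Z\<close>: the first uses the triangle to remove the right unit constraint, the second is
  the snake identity.\<close>

lemma zigzag:
  assumes "is_left_dual C X D e h" and [simp]: "Z \<in> Obj C"
  shows "(X \<rhd> cap e D X Z) \<cdot> cup h X D (X \<otimes>\<^sub>o Z) = \<ii> (X \<otimes>\<^sub>o Z)"
    and "cap e D X (D \<otimes>\<^sub>o Z) \<cdot> (D \<rhd> cup h X D Z) = \<ii> (D \<otimes>\<^sub>o Z)"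
proof -
  note [simp] = left_dual_ty[OF assms(1)]
  have "(ru X \<cdot> (X \<rhd> e) \<cdot> \<alpha> X D X \<cdot> (h \<lhd> X) \<cdot> lu' X) \<lhd> Z = \<ii> (X \<otimes>\<^sub>o Z)"
    using assms by (simp add: is_left_dual_def)
  then show "(X \<rhd> cap e D X Z) \<cdot> cup h X D (X \<otimes>\<^sub>o Z) = \<ii> (X \<otimes>\<^sub>o Z)"
    by (simp flip: triangle add: cap_def cup_def coherence)
  show "cap e D X (D \<otimes>\<^sub>o Z) \<cdot> (D \<rhd> cup h X D Z) = \<ii> (D \<otimes>\<^sub>o Z)"
    using assms by (simp add: is_left_dual_def flip: snake_rwhisker)
qed

lemma rwhisker_unit_inj:
  assumes "f \<lhd> \<I> = g \<lhd> \<I>" "ty f = X \<Rrightarrow> Y" "ty g = X \<Rrightarrow> Y"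
  shows "f = g"
proof (rule iso_cancel_right)
  show "f \<cdot> ru X = g \<cdot> ru X"
    using assms by (simp flip: runit_natural)
qed (use assms ty_Obj[OF assms(2)] in auto)

text \<open>Leads from spectator form back to plain arrows: the unit as spectator loses no
  information.\<close>

lemma spl_inj:
  assumes "spl f A B \<I> = spl g A B \<I>" "ty f = X \<Rrightarrow> A \<otimes>\<^sub>o B" "ty g = X \<Rrightarrow> A \<otimes>\<^sub>o B" "A \<in> Obj C" "B \<in> Obj C"
  shows "f = g"
proof (rule rwhisker_unit_inj)
  show "f \<lhd> \<I> = g \<lhd> \<I>"
    using assms(1)[unfolded spl_def]
    by (rule iso_cancel_left[rotated]) (use assms in simp_all)
qed (use assms in simp_all)

end

section \<open>Duals\<close>

context rigid_category
begin

abbreviation dual :: "'o \<Rightarrow> 'o" ("_\<^sup>\<star>" [1000] 1000) where "X\<^sup>\<star> \<equiv> Dual C X"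
abbreviation ev :: "'o \<Rightarrow> 'o \<Rightarrow> 'm" where "ev X Z \<equiv> cap (Ev C X) X\<^sup>\<star> X Z"
abbreviation coev :: "'o \<Rightarrow> 'o \<Rightarrow> 'm" where "coev X Z \<equiv> cup (Coev C X) X X\<^sup>\<star> Z"

lemma dual_ty [simp]:
  assumes "X \<in> Obj C"
  shows "X\<^sup>\<star> \<in> Obj C" "ty (Ev C X) = X\<^sup>\<star> \<otimes>\<^sub>o X \<Rrightarrow> \<I>" "ty (Coev C X) = \<I> \<Rrightarrow> X \<otimes>\<^sub>o X\<^sup>\<star>"
  using left_dual_ty[OF left_dual[OF assms]] by simp_all

lemma zigzag_dual [simp]:
  assumes "X \<in> Obj C" "Z \<in> Obj C"
  shows "(X \<rhd> ev X Z) \<cdot> coev X (X \<otimes>\<^sub>o Z) = \<ii> (X \<otimes>\<^sub>o Z)"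
    "ev X (X\<^sup>\<star> \<otimes>\<^sub>o Z) \<cdot> (X\<^sup>\<star> \<rhd> coev X Z) = \<ii> (X\<^sup>\<star> \<otimes>\<^sub>o Z)"
  using zigzag[OF left_dual[OF assms(1)] assms(2)] by simp_all

text \<open>The evaluation slides past \<open>e\<close>, and the zigzag of \<open>X\<close> with its
  dual straightens. Thus the snake is the arrow from \<open>A\<close> to
  \<open>X\<^sup>\<star>\<close> that corresponds to the pairing \<open>e\<close>.\<close>

lemma ev_snake:
  assumes [simp]: "X \<in> Obj C" "A \<in> Obj C" "Z \<in> Obj C" "ty e = A \<otimes>\<^sub>o X \<Rrightarrow> \<I>"
  shows "ev X Z \<cdot> (snake C A X X\<^sup>\<star> e (Coev C X) \<lhd> X \<otimes>\<^sub>o Z) = cap e A X Z"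
proof -
  have "ev X Z \<cdot> (snake C A X X\<^sup>\<star> e (Coev C X) \<lhd> X \<otimes>\<^sub>o Z)
      = (ev X Z \<cdot> cap e A X (X\<^sup>\<star> \<otimes>\<^sub>o X \<otimes>\<^sub>o Z)) \<cdot> (A \<rhd> coev X (X \<otimes>\<^sub>o Z))"
    by (simp add: snake_rwhisker arr_assoc)
  also have "\<dots> = cap e A X Z \<cdot> (A \<rhd> ((X \<rhd> ev X Z) \<cdot> coev X (X \<otimes>\<^sub>o Z)))"
    by (simp add: lwhisker_comp arr_assoc del: zigzag_dual flip: cap_natural)
  finally show ?thesis by simp
qed

text \<open>The dual of \<open>f\<close> corresponds to the pairing of
  \<open>Y\<^sup>\<star>\<close> with \<open>X\<close> through \<open>f\<close>, so facts on snakes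
  apply to it.\<close>

lemma dual_arr_eq_snake:
  assumes [simp]: "ty f = X \<Rrightarrow> Y"
  shows "dual_arr C f = snake C Y\<^sup>\<star> X X\<^sup>\<star> (Ev C Y \<cdot> (Y\<^sup>\<star> \<rhd> f)) (Coev C X)"
  using ty_Obj[OF assms] by (simp add: dual_arr_def Let_def snake_def rwhisker_comp arr_assoc)

lemma ty_dual_arr [simp]: "ty f = X \<Rrightarrow> Y \<Longrightarrow> ty (dual_arr C f) = Y\<^sup>\<star> \<Rrightarrow> X\<^sup>\<star>"
  using ty_Obj[of f X Y] by (simp add: dual_arr_eq_snake)

lemma dual_arr_rwhisker:
  assumes [simp]: "ty f = X \<Rrightarrow> Y" "Z \<in> Obj C"
  shows "dual_arr C f \<lhd> Z = ev Y (X\<^sup>\<star> \<otimes>\<^sub>o Z) \<cdot> (Y\<^sup>\<star> \<rhd> f \<lhd> X\<^sup>\<star> \<otimes>\<^sub>o Z) \<cdot> (Y\<^sup>\<star> \<rhd> coev X Z)"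
  using ty_Obj[OF assms(1)] by (simp add: dual_arr_eq_snake snake_rwhisker cap_comp arr_assoc)

text \<open>This is \<open>ev_snake\<close> for the pairing that corresponds to
  \<open>dual_arr C f\<close>; it moves \<open>f\<close> from one leg of an evaluation to the
  other.\<close>

lemma ev_dual_arr:
  assumes [simp]: "ty f = X \<Rrightarrow> Y" "Z \<in> Obj C"
  shows "ev X Z \<cdot> (dual_arr C f \<lhd> X \<otimes>\<^sub>o Z) = ev Y Z \<cdot> (Y\<^sup>\<star> \<rhd> f \<lhd> Z)"
  using ty_Obj[OF assms(1)] by (simp add: dual_arr_eq_snake ev_snake cap_comp)

section \<open>Duals of tensor products and of the unit\<close>

definition Ev_tensor :: "'o \<Rightarrow> 'o \<Rightarrow> 'm" where
  "Ev_tensor X Y = Ev C Y \<cdot> (Y\<^sup>\<star> \<rhd> ev X Y) \<cdot> \<alpha> Y\<^sup>\<star> X\<^sup>\<star> (X \<otimes>\<^sub>o Y)"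

lemma ty_Ev_tensor [simp]:
  "\<lbrakk>X \<in> Obj C; Y \<in> Obj C\<rbrakk> \<Longrightarrow> ty (Ev_tensor X Y) = (Y\<^sup>\<star> \<otimes>\<^sub>o X\<^sup>\<star>) \<otimes>\<^sub>o X \<otimes>\<^sub>o Y \<Rrightarrow> \<I>"
  by (simp add: Ev_tensor_def)

text \<open>\<open>Ev_tensor\<close> is the nested pairing written out inside
  \<open>dual_tensor\<close>, so \<open>dual_tensor\<close> is the arrow corresponding to
  it.\<close>

lemma dual_tensor_eq_snake:
  assumes [simp]: "X \<in> Obj C" "Y \<in> Obj C"
  shows "dual_tensor C X Y = snake C (Y\<^sup>\<star> \<otimes>\<^sub>o X\<^sup>\<star>) (X \<otimes>\<^sub>o Y) (X \<otimes>\<^sub>o Y)\<^sup>\<star> (Ev_tensor X Y) (Coev C (X \<otimes>\<^sub>o Y))"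
  by (simp add: dual_tensor_def Let_def Ev_tensor_def cap_def)

lemma cap_Ev_tensor:
  assumes [simp]: "X \<in> Obj C" "Y \<in> Obj C" "Z \<in> Obj C"
  shows "cap (Ev_tensor X Y) (Y\<^sup>\<star> \<otimes>\<^sub>o X\<^sup>\<star>) (X \<otimes>\<^sub>o Y) Z
    = ev Y Z \<cdot> (Y\<^sup>\<star> \<rhd> ev X (Y \<otimes>\<^sub>o Z)) \<cdot> (Y\<^sup>\<star> \<rhd> X\<^sup>\<star> \<rhd> \<alpha> X Y Z) \<cdot> \<alpha> Y\<^sup>\<star> X\<^sup>\<star> ((X \<otimes>\<^sub>o Y) \<otimes>\<^sub>o Z)"
  by (simp add: Ev_tensor_def cap_def coherence)

text \<open>
  \<open>E\<close> and \<open>H\<close> exhibit \<open>A\<close> as a second left dual of \<open>T\<close>, and \<open>d\<close> is the comparison with \<open>T\<^sup>\<star>\<close>.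
\<close>

lemma iso_to_dual:
  assumes [simp]: "A \<in> Obj C" "T \<in> Obj C"
    and tyE [simp]: "\<And>Z. Z \<in> Obj C \<Longrightarrow> ty (E Z) = A \<otimes>\<^sub>o T \<otimes>\<^sub>o Z \<Rrightarrow> Z"
    and tyH [simp]: "\<And>Z. Z \<in> Obj C \<Longrightarrow> ty (H Z) = Z \<Rrightarrow> T \<otimes>\<^sub>o A \<otimes>\<^sub>o Z"
    and E_natural: "\<And>z Z Z'. ty z = Z \<Rrightarrow> Z' \<Longrightarrow> E Z' \<cdot> (A \<rhd> T \<rhd> z) = z \<cdot> E Z"
    and H_natural: "\<And>z Z Z'. ty z = Z \<Rrightarrow> Z' \<Longrightarrow> (T \<rhd> A \<rhd> z) \<cdot> H Z = H Z' \<cdot> z"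
    and zig1: "\<And>Z. Z \<in> Obj C \<Longrightarrow> (T \<rhd> E Z) \<cdot> H (T \<otimes>\<^sub>o Z) = \<ii> (T \<otimes>\<^sub>o Z)"
    and zig2: "\<And>Z. Z \<in> Obj C \<Longrightarrow> E (A \<otimes>\<^sub>o Z) \<cdot> (A \<rhd> H Z) = \<ii> (A \<otimes>\<^sub>o Z)"
    and d [simp]: "ty d = A \<Rrightarrow> T\<^sup>\<star>"
    and d_eq: "d \<lhd> \<I> = E (T\<^sup>\<star> \<otimes>\<^sub>o \<I>) \<cdot> (A \<rhd> coev T \<I>)"
  shows "iso_arr C d"
proof (rule iso_rwhisker_unit[OF _ d], rule iso_arrI)
  \<comment> \<open>The inverse is the snake with the two duals exchanged: \<open>ev T\<close>
    serves as cap and \<open>H\<close> as cup.\<close>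
  let ?v = "ev T (A \<otimes>\<^sub>o \<I>) \<cdot> (T\<^sup>\<star> \<rhd> H \<I>)"
  show "ty (d \<lhd> \<I>) = A \<otimes>\<^sub>o \<I> \<Rrightarrow> T\<^sup>\<star> \<otimes>\<^sub>o \<I>" "ty ?v = T\<^sup>\<star> \<otimes>\<^sub>o \<I> \<Rrightarrow> A \<otimes>\<^sub>o \<I>"
    by simp_all
  have "?v \<cdot> (d \<lhd> \<I>) = ev T (A \<otimes>\<^sub>o \<I>) \<cdot> ((T\<^sup>\<star> \<rhd> H \<I>) \<cdot> E (T\<^sup>\<star> \<otimes>\<^sub>o \<I>)) \<cdot> (A \<rhd> coev T \<I>)"
    by (simp add: d_eq arr_assoc)
  also have "\<dots> = (ev T (A \<otimes>\<^sub>o \<I>) \<cdot> E (T\<^sup>\<star> \<otimes>\<^sub>o T \<otimes>\<^sub>o A \<otimes>\<^sub>o \<I>)) \<cdot> (A \<rhd> T \<rhd> T\<^sup>\<star> \<rhd> H \<I>) \<cdot> (A \<rhd> coev T \<I>)"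
    by (subst E_natural[of "T\<^sup>\<star> \<rhd> H \<I>" "T\<^sup>\<star> \<otimes>\<^sub>o \<I>" "T\<^sup>\<star> \<otimes>\<^sub>o T \<otimes>\<^sub>o A \<otimes>\<^sub>o \<I>", symmetric]) (simp_all add: arr_assoc)
  also have "\<dots> = E (A \<otimes>\<^sub>o \<I>) \<cdot> (A \<rhd> ((T \<rhd> ev T (A \<otimes>\<^sub>o \<I>)) \<cdot> (T \<rhd> T\<^sup>\<star> \<rhd> H \<I>) \<cdot> coev T \<I>))"
    by (subst E_natural[of "ev T (A \<otimes>\<^sub>o \<I>)" "T\<^sup>\<star> \<otimes>\<^sub>o T \<otimes>\<^sub>o A \<otimes>\<^sub>o \<I>" "A \<otimes>\<^sub>o \<I>", symmetric]) (simp_all add: arr_assoc lwhisker_comp)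
  also have "\<dots> = E (A \<otimes>\<^sub>o \<I>) \<cdot> (A \<rhd> (((T \<rhd> ev T (A \<otimes>\<^sub>o \<I>)) \<cdot> coev T (T \<otimes>\<^sub>o A \<otimes>\<^sub>o \<I>)) \<cdot> H \<I>))"
    by (simp add: cup_natural arr_assoc del: zigzag_dual)
  finally show "?v \<cdot> (d \<lhd> \<I>) = \<ii> (A \<otimes>\<^sub>o \<I>)"
    by (simp add: zig2)
  have "(d \<lhd> \<I>) \<cdot> ?v = E (T\<^sup>\<star> \<otimes>\<^sub>o \<I>) \<cdot> ((A \<rhd> coev T \<I>) \<cdot> ev T (A \<otimes>\<^sub>o \<I>)) \<cdot> (T\<^sup>\<star> \<rhd> H \<I>)"
    by (simp add: d_eq arr_assoc)
  also have "\<dots> = (E (T\<^sup>\<star> \<otimes>\<^sub>o \<I>) \<cdot> ev T (A \<otimes>\<^sub>o T \<otimes>\<^sub>o T\<^sup>\<star> \<otimes>\<^sub>o \<I>)) \<cdot> (T\<^sup>\<star> \<rhd> T \<rhd> A \<rhd> coev T \<I>) \<cdot> (T\<^sup>\<star> \<rhd> H \<I>)"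
    by (subst cap_natural[of _ _ _ "A \<rhd> coev T \<I>" "A \<otimes>\<^sub>o \<I>" "A \<otimes>\<^sub>o T \<otimes>\<^sub>o T\<^sup>\<star> \<otimes>\<^sub>o \<I>", symmetric]) (simp_all add: arr_assoc)
  also have "\<dots> = ev T (T\<^sup>\<star> \<otimes>\<^sub>o \<I>) \<cdot> (T\<^sup>\<star> \<rhd> ((T \<rhd> E (T\<^sup>\<star> \<otimes>\<^sub>o \<I>)) \<cdot> (T \<rhd> A \<rhd> coev T \<I>) \<cdot> H \<I>))"
    by (subst cap_natural[of _ _ _ "E (T\<^sup>\<star> \<otimes>\<^sub>o \<I>)" "A \<otimes>\<^sub>o T \<otimes>\<^sub>o T\<^sup>\<star> \<otimes>\<^sub>o \<I>" "T\<^sup>\<star> \<otimes>\<^sub>o \<I>", symmetric]) (simp_all add: arr_assoc lwhisker_comp)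
  also have "\<dots> = ev T (T\<^sup>\<star> \<otimes>\<^sub>o \<I>) \<cdot> (T\<^sup>\<star> \<rhd> (((T \<rhd> E (T\<^sup>\<star> \<otimes>\<^sub>o \<I>)) \<cdot> H (T \<otimes>\<^sub>o T\<^sup>\<star> \<otimes>\<^sub>o \<I>)) \<cdot> coev T \<I>))"
    by (simp add: H_natural arr_assoc)
  finally show "(d \<lhd> \<I>) \<cdot> ?v = \<ii> (T\<^sup>\<star> \<otimes>\<^sub>o \<I>)"
    by (simp add: zig1)
qed

text \<open>Nested evaluations and coevaluations make
  \<open>Y\<^sup>\<star> \<otimes>\<^sub>o X\<^sup>\<star>\<close> a left dual of
  \<open>X \<otimes>\<^sub>o Y\<close>, and \<open>dual_tensor\<close> compares it with the chosen
  one.\<close>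

lemma iso_dual_tensor [simp]:
  assumes [simp]: "X \<in> Obj C" "Y \<in> Obj C"
  shows "iso_arr C (dual_tensor C X Y)"
proof -
  let ?A = "Y\<^sup>\<star> \<otimes>\<^sub>o X\<^sup>\<star>" and ?T = "X \<otimes>\<^sub>o Y"
  \<comment> \<open>\<open>E0\<close> and \<open>H0\<close> are the nested evaluation and
    coevaluation on fully right-nested products. Naturality and the zigzags are proved for them; the
    associators are added only in \<open>H\<close> and in the fact \<open>E\<close>.\<close>
  define E0 where "E0 Z = ev Y Z \<cdot> (Y\<^sup>\<star> \<rhd> ev X (Y \<otimes>\<^sub>o Z))" for Z
  define H0 where "H0 Z = (X \<rhd> coev Y (X\<^sup>\<star> \<otimes>\<^sub>o Z)) \<cdot> coev X Z" for Z
  define H where "H Z = \<alpha>' X Y (?A \<otimes>\<^sub>o Z) \<cdot> (X \<rhd> Y \<rhd> \<alpha>' Y\<^sup>\<star> X\<^sup>\<star> Z) \<cdot> H0 Z" for Z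
  have tyE0 [simp]: "ty (E0 Z) = Y\<^sup>\<star> \<otimes>\<^sub>o X\<^sup>\<star> \<otimes>\<^sub>o X \<otimes>\<^sub>o Y \<otimes>\<^sub>o Z \<Rrightarrow> Z" if "Z \<in> Obj C" for Z
    using that by (simp add: E0_def)
  have tyH0 [simp]: "ty (H0 Z) = Z \<Rrightarrow> X \<otimes>\<^sub>o Y \<otimes>\<^sub>o Y\<^sup>\<star> \<otimes>\<^sub>o X\<^sup>\<star> \<otimes>\<^sub>o Z" if "Z \<in> Obj C" for Z
    using that by (simp add: H0_def)
  have E: "cap (Ev_tensor X Y) ?A ?T Z = E0 Z \<cdot> (Y\<^sup>\<star> \<rhd> X\<^sup>\<star> \<rhd> \<alpha> X Y Z) \<cdot> \<alpha> Y\<^sup>\<star> X\<^sup>\<star> (?T \<otimes>\<^sub>o Z)"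
    if "Z \<in> Obj C" for Z
    using that by (simp add: cap_Ev_tensor E0_def arr_assoc)
  have E0_natural: "E0 Z' \<cdot> (Y\<^sup>\<star> \<rhd> X\<^sup>\<star> \<rhd> X \<rhd> Y \<rhd> z) = z \<cdot> E0 Z" if z [simp]: "ty z = Z \<Rrightarrow> Z'" for z Z Z'
  proof -
    note [simp] = ty_Obj[OF z]
    have "E0 Z' \<cdot> (Y\<^sup>\<star> \<rhd> X\<^sup>\<star> \<rhd> X \<rhd> Y \<rhd> z) = ev Y Z' \<cdot> (Y\<^sup>\<star> \<rhd> (ev X (Y \<otimes>\<^sub>o Z') \<cdot> (X\<^sup>\<star> \<rhd> X \<rhd> Y \<rhd> z)))"
      by (simp add: E0_def arr_assoc lwhisker_comp)
    also have "\<dots> = (ev Y Z' \<cdot> (Y\<^sup>\<star> \<rhd> Y \<rhd> z)) \<cdot> (Y\<^sup>\<star> \<rhd> ev X (Y \<otimes>\<^sub>o Z))"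
      by (simp add: cap_natural cap_natural_assoc arr_assoc lwhisker_comp)
    also have "\<dots> = z \<cdot> E0 Z"
      by (simp add: cap_natural_assoc arr_assoc E0_def)
    finally show ?thesis .
  qed
  have H0_natural: "(X \<rhd> Y \<rhd> Y\<^sup>\<star> \<rhd> X\<^sup>\<star> \<rhd> z) \<cdot> H0 Z = H0 Z' \<cdot> z" if z [simp]: "ty z = Z \<Rrightarrow> Z'" for z Z Z'
  proof -
    note [simp] = ty_Obj[OF z]
    have "(X \<rhd> Y \<rhd> Y\<^sup>\<star> \<rhd> X\<^sup>\<star> \<rhd> z) \<cdot> H0 Z = (X \<rhd> ((Y \<rhd> Y\<^sup>\<star> \<rhd> X\<^sup>\<star> \<rhd> z) \<cdot> coev Y (X\<^sup>\<star> \<otimes>\<^sub>o Z))) \<cdot> coev X Z"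
      by (simp add: H0_def arr_assoc lwhisker_comp)
    also have "\<dots> = (X \<rhd> coev Y (X\<^sup>\<star> \<otimes>\<^sub>o Z')) \<cdot> (X \<rhd> X\<^sup>\<star> \<rhd> z) \<cdot> coev X Z"
      by (simp add: cup_natural arr_assoc lwhisker_comp)
    also have "\<dots> = H0 Z' \<cdot> z"
      by (simp add: cup_natural arr_assoc H0_def)
    finally show ?thesis .
  qed
  have zig2: "E0 (Y\<^sup>\<star> \<otimes>\<^sub>o X\<^sup>\<star> \<otimes>\<^sub>o Z) \<cdot> (Y\<^sup>\<star> \<rhd> X\<^sup>\<star> \<rhd> H0 Z) = \<ii> (Y\<^sup>\<star> \<otimes>\<^sub>o X\<^sup>\<star> \<otimes>\<^sub>o Z)"
    if [simp]: "Z \<in> Obj C" for Z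
  proof -
    have "E0 (Y\<^sup>\<star> \<otimes>\<^sub>o X\<^sup>\<star> \<otimes>\<^sub>o Z) \<cdot> (Y\<^sup>\<star> \<rhd> X\<^sup>\<star> \<rhd> H0 Z)
      = ev Y (Y\<^sup>\<star> \<otimes>\<^sub>o X\<^sup>\<star> \<otimes>\<^sub>o Z) \<cdot> (Y\<^sup>\<star> \<rhd> ((ev X (Y \<otimes>\<^sub>o Y\<^sup>\<star> \<otimes>\<^sub>o X\<^sup>\<star> \<otimes>\<^sub>o Z) \<cdot> (X\<^sup>\<star> \<rhd> X \<rhd> coev Y (X\<^sup>\<star> \<otimes>\<^sub>o Z))) \<cdot> (X\<^sup>\<star> \<rhd> coev X Z)))"
      by (simp add: E0_def H0_def arr_assoc lwhisker_comp)
    also have "\<dots> = ev Y (Y\<^sup>\<star> \<otimes>\<^sub>o X\<^sup>\<star> \<otimes>\<^sub>o Z) \<cdot> (Y\<^sup>\<star> \<rhd> coev Y (X\<^sup>\<star> \<otimes>\<^sub>o Z))"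
      by (simp add: cap_natural arr_assoc)
    finally show ?thesis by simp
  qed
  have zig1: "(X \<rhd> Y \<rhd> E0 Z) \<cdot> H0 (X \<otimes>\<^sub>o Y \<otimes>\<^sub>o Z) = \<ii> (X \<otimes>\<^sub>o Y \<otimes>\<^sub>o Z)"
    if [simp]: "Z \<in> Obj C" for Z
  proof -
    have "(X \<rhd> Y \<rhd> E0 Z) \<cdot> H0 (X \<otimes>\<^sub>o Y \<otimes>\<^sub>o Z)
      = (X \<rhd> ((Y \<rhd> ev Y Z) \<cdot> (Y \<rhd> Y\<^sup>\<star> \<rhd> ev X (Y \<otimes>\<^sub>o Z)) \<cdot> coev Y (X\<^sup>\<star> \<otimes>\<^sub>o X \<otimes>\<^sub>o Y \<otimes>\<^sub>o Z))) \<cdot> coev X (X \<otimes>\<^sub>o Y \<otimes>\<^sub>o Z)"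
      by (simp add: E0_def H0_def arr_assoc lwhisker_comp)
    also have "\<dots> = (X \<rhd> (((Y \<rhd> ev Y Z) \<cdot> coev Y (Y \<otimes>\<^sub>o Z)) \<cdot> ev X (Y \<otimes>\<^sub>o Z))) \<cdot> coev X (X \<otimes>\<^sub>o Y \<otimes>\<^sub>o Z)"
      by (simp add: cup_natural arr_assoc del: zigzag_dual)
    finally show ?thesis by simp
  qed
  show ?thesis
  proof (rule iso_to_dual[of ?A ?T "cap (Ev_tensor X Y) ?A ?T" H])
    fix Z assume [simp]: "Z \<in> Obj C"
    show "ty (H Z) = Z \<Rrightarrow> ?T \<otimes>\<^sub>o ?A \<otimes>\<^sub>o Z"
      by (simp add: H_def)
    have "(?T \<rhd> cap (Ev_tensor X Y) ?A ?T Z) \<cdot> H (?T \<otimes>\<^sub>o Z)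
       = \<alpha>' X Y Z \<cdot> (X \<rhd> Y \<rhd> E0 Z) \<cdot> (X \<rhd> Y \<rhd> Y\<^sup>\<star> \<rhd> X\<^sup>\<star> \<rhd> \<alpha> X Y Z) \<cdot> H0 (?T \<otimes>\<^sub>o Z)"
      by (simp add: H_def E coherence)
    also have "\<dots> = \<alpha>' X Y Z \<cdot> ((X \<rhd> Y \<rhd> E0 Z) \<cdot> H0 (X \<otimes>\<^sub>o Y \<otimes>\<^sub>o Z)) \<cdot> \<alpha> X Y Z"
      by (simp add: H0_natural arr_assoc)
    finally show "(?T \<rhd> cap (Ev_tensor X Y) ?A ?T Z) \<cdot> H (?T \<otimes>\<^sub>o Z) = \<ii> (?T \<otimes>\<^sub>o Z)"
      by (simp add: zig1)
    have "cap (Ev_tensor X Y) ?A ?T (?A \<otimes>\<^sub>o Z) \<cdot> (?A \<rhd> H Z)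
       = (E0 (?A \<otimes>\<^sub>o Z) \<cdot> (Y\<^sup>\<star> \<rhd> X\<^sup>\<star> \<rhd> X \<rhd> Y \<rhd> \<alpha>' Y\<^sup>\<star> X\<^sup>\<star> Z)) \<cdot> (Y\<^sup>\<star> \<rhd> X\<^sup>\<star> \<rhd> H0 Z) \<cdot> \<alpha> Y\<^sup>\<star> X\<^sup>\<star> Z"
      by (simp add: H_def E coherence)
    also have "\<dots> = \<alpha>' Y\<^sup>\<star> X\<^sup>\<star> Z \<cdot> (E0 (Y\<^sup>\<star> \<otimes>\<^sub>o X\<^sup>\<star> \<otimes>\<^sub>o Z) \<cdot> (Y\<^sup>\<star> \<rhd> X\<^sup>\<star> \<rhd> H0 Z)) \<cdot> \<alpha> Y\<^sup>\<star> X\<^sup>\<star> Z"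
      by (simp add: E0_natural arr_assoc)
    finally show "cap (Ev_tensor X Y) ?A ?T (?A \<otimes>\<^sub>o Z) \<cdot> (?A \<rhd> H Z) = \<ii> (?A \<otimes>\<^sub>o Z)"
      by (simp add: zig2)
  next
    fix z Z Z' assume z [simp]: "ty z = Z \<Rrightarrow> Z'"
    note [simp] = ty_Obj[OF z]
    have "(?T \<rhd> ?A \<rhd> z) \<cdot> H Z = \<alpha>' X Y (?A \<otimes>\<^sub>o Z') \<cdot> (X \<rhd> Y \<rhd> \<alpha>' Y\<^sup>\<star> X\<^sup>\<star> Z') \<cdot> (X \<rhd> Y \<rhd> Y\<^sup>\<star> \<rhd> X\<^sup>\<star> \<rhd> z) \<cdot> H0 Z"
      by (simp add: H_def coherence)
    then show "(?T \<rhd> ?A \<rhd> z) \<cdot> H Z = H Z' \<cdot> z"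
      by (simp add: H_def H0_natural arr_assoc)
  qed (simp_all add: cap_natural dual_tensor_eq_snake snake_rwhisker)
qed

lemma ty_dual_tensor [simp]:
  "\<lbrakk>X \<in> Obj C; Y \<in> Obj C\<rbrakk> \<Longrightarrow> ty (dual_tensor C X Y) = Y\<^sup>\<star> \<otimes>\<^sub>o X\<^sup>\<star> \<Rrightarrow> (X \<otimes>\<^sub>o Y)\<^sup>\<star>"
  by (simp add: dual_tensor_eq_snake)

lemma ev_dual_tensor:
  "\<lbrakk>X \<in> Obj C; Y \<in> Obj C; Z \<in> Obj C\<rbrakk> \<Longrightarrow> ev (X \<otimes>\<^sub>o Y) Z \<cdot> (dual_tensor C X Y \<lhd> (X \<otimes>\<^sub>o Y) \<otimes>\<^sub>o Z)
    = cap (Ev_tensor X Y) (Y\<^sup>\<star> \<otimes>\<^sub>o X\<^sup>\<star>) (X \<otimes>\<^sub>o Y) Z"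
  by (simp add: dual_tensor_eq_snake ev_snake)

lemma ty_dual_unit [simp]: "ty (dual_unit C) = \<I> \<Rrightarrow> \<I>\<^sup>\<star>"
  by (simp add: dual_unit_def)

text \<open>The unit is its own left dual; in spectator form its evaluation and coevaluation are
  composites of two left unit constraints or of their inverses.\<close>

lemma iso_dual_unit [simp]: "iso_arr C (dual_unit C)"
proof (rule iso_to_dual[of \<I> \<I> "cap (lu \<I>) \<I> \<I>" "\<lambda>Z. lu' (\<I> \<otimes>\<^sub>o Z) \<cdot> lu' Z"])
  have cap: "cap (lu \<I>) \<I> \<I> Z = lu Z \<cdot> lu (\<I> \<otimes>\<^sub>o Z)" if "Z \<in> Obj C" for Z
    using that by (simp add: cap_def coherence)
  fix Z assume [simp]: "Z \<in> Obj C"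
  have "(\<I> \<rhd> (lu Z \<cdot> lu (\<I> \<otimes>\<^sub>o Z))) \<cdot> lu' (\<I> \<otimes>\<^sub>o \<I> \<otimes>\<^sub>o Z) = lu' Z \<cdot> lu Z \<cdot> lu (\<I> \<otimes>\<^sub>o Z)"
    by (subst lunit_inv_natural[of "lu Z \<cdot> lu (\<I> \<otimes>\<^sub>o Z)" "\<I> \<otimes>\<^sub>o \<I> \<otimes>\<^sub>o Z" Z, symmetric]) simp_all
  then show "(\<I> \<rhd> cap (lu \<I>) \<I> \<I> Z) \<cdot> lu' (\<I> \<otimes>\<^sub>o \<I> \<otimes>\<^sub>o Z) \<cdot> lu' (\<I> \<otimes>\<^sub>o Z) = \<ii> (\<I> \<otimes>\<^sub>o Z)"
    by (simp add: cap comp_rewrite)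
  have "lu (\<I> \<otimes>\<^sub>o \<I> \<otimes>\<^sub>o Z) \<cdot> (\<I> \<rhd> (lu' (\<I> \<otimes>\<^sub>o Z) \<cdot> lu' Z)) = (lu' (\<I> \<otimes>\<^sub>o Z) \<cdot> lu' Z) \<cdot> lu Z"
    by (subst lunit_natural) simp_all
  then show "cap (lu \<I>) \<I> \<I> (\<I> \<otimes>\<^sub>o Z) \<cdot> (\<I> \<rhd> (lu' (\<I> \<otimes>\<^sub>o Z) \<cdot> lu' Z)) = \<ii> (\<I> \<otimes>\<^sub>o Z)"
    by (simp add: cap arr_assoc)
next
  fix z Z Z' assume z [simp]: "ty z = Z \<Rrightarrow> Z'"
  note [simp] = ty_Obj[OF z]
  have "(\<I> \<rhd> \<I> \<rhd> z) \<cdot> lu' (\<I> \<otimes>\<^sub>o Z) \<cdot> lu' Z = ((\<I> \<rhd> \<I> \<rhd> z) \<cdot> lu' (\<I> \<otimes>\<^sub>o Z)) \<cdot> lu' Z"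
    by (simp add: arr_assoc)
  also have "\<dots> = lu' (\<I> \<otimes>\<^sub>o Z') \<cdot> (\<I> \<rhd> z) \<cdot> lu' Z"
    by (subst lunit_inv_natural[of "\<I> \<rhd> z" "\<I> \<otimes>\<^sub>o Z" "\<I> \<otimes>\<^sub>o Z'", symmetric]) (simp_all add: arr_assoc)
  also have "\<dots> = (lu' (\<I> \<otimes>\<^sub>o Z') \<cdot> lu' Z') \<cdot> z"
    by (subst lunit_inv_natural[of z Z Z', symmetric]) (simp_all add: arr_assoc)
  finally show "(\<I> \<rhd> \<I> \<rhd> z) \<cdot> lu' (\<I> \<otimes>\<^sub>o Z) \<cdot> lu' Z = (lu' (\<I> \<otimes>\<^sub>o Z') \<cdot> lu' Z') \<cdot> z" .
qed (simp_all add: cap_natural dual_unit_def snake_rwhisker)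

text \<open>By \<open>ev_dual_tensor\<close> the evaluation of \<open>A \<otimes>\<^sub>o B\<close>
  becomes two nested evaluations, so the dual of the product disappears from the formula.\<close>

lemma dual_arr_dual_tensor_rwhisker:
  assumes [simp]: "ty f = X \<Rrightarrow> A \<otimes>\<^sub>o B" "A \<in> Obj C" "B \<in> Obj C" "W \<in> Obj C"
  shows "((dual_arr C f \<cdot> dual_tensor C A B) \<lhd> W)
    = ev B (X\<^sup>\<star> \<otimes>\<^sub>o W) \<cdot> (B\<^sup>\<star> \<rhd> ev A (B \<otimes>\<^sub>o X\<^sup>\<star> \<otimes>\<^sub>o W)) \<cdot> (B\<^sup>\<star> \<rhd> A\<^sup>\<star> \<rhd> spl f A B (X\<^sup>\<star> \<otimes>\<^sub>o W))
      \<cdot> (B\<^sup>\<star> \<rhd> A\<^sup>\<star> \<rhd> coev X W) \<cdot> \<alpha> B\<^sup>\<star> A\<^sup>\<star> W"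
proof -
  note [simp] = ty_Obj(1)[OF assms(1)]
  let ?T = "A \<otimes>\<^sub>o B" and ?A = "B\<^sup>\<star> \<otimes>\<^sub>o A\<^sup>\<star>"
  let ?g = "(f \<lhd> X\<^sup>\<star> \<otimes>\<^sub>o W) \<cdot> coev X W"
  have "(dual_arr C f \<cdot> dual_tensor C A B) \<lhd> W
    = ev ?T (X\<^sup>\<star> \<otimes>\<^sub>o W) \<cdot> ((?T\<^sup>\<star> \<rhd> ?g) \<cdot> (dual_tensor C A B \<lhd> W))"
    by (simp add: rwhisker_comp dual_arr_rwhisker lwhisker_comp arr_assoc)
  also have "\<dots> = (ev ?T (X\<^sup>\<star> \<otimes>\<^sub>o W) \<cdot> (dual_tensor C A B \<lhd> ?T \<otimes>\<^sub>o X\<^sup>\<star> \<otimes>\<^sub>o W)) \<cdot> (?A \<rhd> ?g)"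
    by (subst rwhisker_natural[of _ ?A "?T\<^sup>\<star>" _ W "?T \<otimes>\<^sub>o X\<^sup>\<star> \<otimes>\<^sub>o W"]) (simp_all add: arr_assoc)
  finally show ?thesis
    by (simp add: ev_dual_tensor cap_Ev_tensor assoc_natural_ident spl_def lwhisker_comp arr_assoc)
qed

end

section \<open>The braiding\<close>

context braided_category
begin

section \<open>The braiding on right-nested products\<close>

definition br :: "'o \<Rightarrow> 'o \<Rightarrow> 'o \<Rightarrow> 'm" where
  "br X Y Z = \<alpha> Y X Z \<cdot> (c X Y \<lhd> Z) \<cdot> \<alpha>' X Y Z"

lemma ty_braid [simp]: "\<lbrakk>X \<in> Obj C; Y \<in> Obj C\<rbrakk> \<Longrightarrow> ty (c X Y) = X \<otimes>\<^sub>o Y \<Rrightarrow> Y \<otimes>\<^sub>o X"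
  using braid_Hom by (simp add: arity_eq_iff)

lemma braid_natural_ty:
  "\<lbrakk>ty f = X \<Rrightarrow> X'; ty g = Y \<Rrightarrow> Y'\<rbrakk> \<Longrightarrow> c X' Y' \<cdot> (f \<otimes>\<^sub>a g) = (g \<otimes>\<^sub>a f) \<cdot> c X Y"
  using braid_natural by (auto simp: arity_eq_iff)

declare braid_iso [simp]

lemma ty_br [simp]: "\<lbrakk>X \<in> Obj C; Y \<in> Obj C; Z \<in> Obj C\<rbrakk> \<Longrightarrow> ty (br X Y Z) = X \<otimes>\<^sub>o Y \<otimes>\<^sub>o Z \<Rrightarrow> Y \<otimes>\<^sub>o X \<otimes>\<^sub>o Z"
  by (simp add: br_def)

lemma iso_br [simp]:
  assumes [simp]: "X \<in> Obj C" "Y \<in> Obj C" "Z \<in> Obj C"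
  shows "iso_arr C (br X Y Z)"
proof -
  have "iso_arr C ((c X Y \<lhd> Z) \<cdot> \<alpha>' X Y Z)"
    by (rule iso_comp[of _ _ "X \<otimes>\<^sub>o Y \<otimes>\<^sub>o Z" "(X \<otimes>\<^sub>o Y) \<otimes>\<^sub>o Z" "(Y \<otimes>\<^sub>o X) \<otimes>\<^sub>o Z"])
       (simp_all add: iso_tensor)
  then show ?thesis
    unfolding br_def by (rule iso_comp) simp_all
qed

lemma br_natural:
  assumes [simp]: "X \<in> Obj C" "Y \<in> Obj C" "ty z = Z \<Rrightarrow> Z'"
  shows "(Y \<rhd> X \<rhd> z) \<cdot> br X Y Z = br X Y Z' \<cdot> (X \<rhd> Y \<rhd> z)"
proof -
  note [simp] = ty_Obj[OF assms(3)]
  have "br X Y Z' \<cdot> (X \<rhd> Y \<rhd> z) = \<alpha> Y X Z' \<cdot> ((c X Y \<lhd> Z') \<cdot> ((X \<otimes>\<^sub>o Y) \<rhd> z)) \<cdot> \<alpha>' X Y Z"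
    by (simp add: br_def arr_assoc assoc_lwhisker_natural(2))
  also have "\<dots> = (\<alpha> Y X Z' \<cdot> ((Y \<otimes>\<^sub>o X) \<rhd> z)) \<cdot> (c X Y \<lhd> Z) \<cdot> \<alpha>' X Y Z"
    by (simp flip: rwhisker_natural add: arr_assoc)
  also have "\<dots> = (Y \<rhd> X \<rhd> z) \<cdot> br X Y Z"
    by (simp add: assoc_lwhisker_natural br_def arr_assoc)
  finally show ?thesis by simp
qed

lemmas br_natural_assoc = br_natural[THEN comp_rewrite]

lemma br_rwhisker:
  assumes [simp]: "X \<in> Obj C" "Y \<in> Obj C" "V \<in> Obj C" "W \<in> Obj C"
  shows "br X Y V \<lhd> W = \<alpha>' Y (X \<otimes>\<^sub>o V) W \<cdot> (Y \<rhd> \<alpha>' X V W) \<cdot> br X Y (V \<otimes>\<^sub>o W)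
    \<cdot> (X \<rhd> \<alpha> Y V W) \<cdot> \<alpha> X (Y \<otimes>\<^sub>o V) W"
  by (simp add: br_def coherence)

lemma br_natural_middle:
  assumes [simp]: "E \<in> Obj C" "ty f = X \<Rrightarrow> Y" "Z \<in> Obj C"
  shows "br E Y Z \<cdot> (E \<rhd> f \<lhd> Z) = (f \<lhd> E \<otimes>\<^sub>o Z) \<cdot> br E X Z"
proof -
  note [simp] = ty_Obj[OF assms(2)]
  have "c E Y \<cdot> (E \<rhd> f) = (f \<lhd> E) \<cdot> c E X"
    by (subst braid_natural_ty) simp_all
  then have *: "(c E Y \<lhd> Z) \<cdot> ((E \<rhd> f) \<lhd> Z) = ((f \<lhd> E) \<lhd> Z) \<cdot> (c E X \<lhd> Z)"
    by (simp flip: rwhisker_comp)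
  have "br E Y Z \<cdot> (E \<rhd> f \<lhd> Z) = \<alpha> Y E Z \<cdot> ((c E Y \<lhd> Z) \<cdot> ((E \<rhd> f) \<lhd> Z)) \<cdot> \<alpha>' E X Z"
    by (simp add: br_def coherence)
  also have "\<dots> = (f \<lhd> E \<otimes>\<^sub>o Z) \<cdot> br E X Z"
    unfolding * by (simp add: br_def coherence)
  finally show ?thesis .
qed

text \<open>The first hexagon with a spectator: crossing a product means crossing its factors one
  after the other.\<close>

lemma hexagon_action:
  assumes [simp]: "E \<in> Obj C" "X \<in> Obj C" "Y \<in> Obj C" "Z \<in> Obj C"
  shows "\<alpha> X Y (E \<otimes>\<^sub>o Z) \<cdot> br E (X \<otimes>\<^sub>o Y) Z \<cdot> (E \<rhd> \<alpha>' X Y Z) = (X \<rhd> br E Y Z) \<cdot> br E X (Y \<otimes>\<^sub>o Z)"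
proof -
  let ?l = "\<lambda>h. (X \<rhd> \<alpha> Y E Z) \<cdot> \<alpha> X (Y \<otimes>\<^sub>o E) Z \<cdot> (h \<lhd> Z) \<cdot> \<alpha>' (E \<otimes>\<^sub>o X) Y Z \<cdot> \<alpha>' E X (Y \<otimes>\<^sub>o Z)"
  have "\<alpha> X Y (E \<otimes>\<^sub>o Z) \<cdot> br E (X \<otimes>\<^sub>o Y) Z \<cdot> (E \<rhd> \<alpha>' X Y Z) = ?l (\<alpha> X Y E \<cdot> c E (X \<otimes>\<^sub>o Y) \<cdot> \<alpha> E X Y)"
    by (simp add: br_def coherence)
  also have "\<dots> = ?l ((X \<rhd> c E Y) \<cdot> \<alpha> X E Y \<cdot> (c E X \<lhd> Y))"
    by (simp add: hexagon1)
  also have "\<dots> = (X \<rhd> br E Y Z) \<cdot> br E X (Y \<otimes>\<^sub>o Z)"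
    by (simp add: br_def coherence)
  finally show ?thesis .
qed

lemma br_tensor:
  assumes [simp]: "E \<in> Obj C" "X \<in> Obj C" "Y \<in> Obj C" "Z \<in> Obj C"
  shows "br E (X \<otimes>\<^sub>o Y) Z = \<alpha>' X Y (E \<otimes>\<^sub>o Z) \<cdot> (X \<rhd> br E Y Z) \<cdot> br E X (Y \<otimes>\<^sub>o Z) \<cdot> (E \<rhd> \<alpha> X Y Z)"
proof -
  have "br E (X \<otimes>\<^sub>o Y) Z = \<alpha>' X Y (E \<otimes>\<^sub>o Z) \<cdot>
      (\<alpha> X Y (E \<otimes>\<^sub>o Z) \<cdot> br E (X \<otimes>\<^sub>o Y) Z \<cdot> (E \<rhd> \<alpha>' X Y Z)) \<cdot> (E \<rhd> \<alpha> X Y Z)"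
    by (simp add: arr_assoc)
  then show ?thesis
    unfolding hexagon_action[OF assms] by (simp add: arr_assoc)
qed

text \<open>Triviality of the crossing with the unit follows from the hexagon: crossing
  \<open>\<I> \<otimes>\<^sub>o \<I>\<close> is crossing \<open>\<I>\<close> twice, but by
  naturality along \<open>lu \<I>\<close> also once, so one crossing cancels.\<close>

lemma br_unit:
  assumes [simp]: "E \<in> Obj C" "Z \<in> Obj C"
  shows "lu (E \<otimes>\<^sub>o Z) \<cdot> br E \<I> Z = E \<rhd> lu Z"
proof -
  \<comment> \<open>The cancellation leaves a unit inside the spectator; naturality along
    \<open>lu Z\<close> removes it afterwards.\<close>
  have *: "lu (E \<otimes>\<^sub>o \<I> \<otimes>\<^sub>o Z) \<cdot> br E \<I> (\<I> \<otimes>\<^sub>o Z) = E \<rhd> lu (\<I> \<otimes>\<^sub>o Z)"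
  proof (rule iso_cancel_left)
    have "br E \<I> Z \<cdot> lu (E \<otimes>\<^sub>o \<I> \<otimes>\<^sub>o Z) \<cdot> br E \<I> (\<I> \<otimes>\<^sub>o Z) \<cdot> (E \<rhd> \<alpha> \<I> \<I> Z)
      = lu (\<I> \<otimes>\<^sub>o E \<otimes>\<^sub>o Z) \<cdot> (\<I> \<rhd> br E \<I> Z) \<cdot> br E \<I> (\<I> \<otimes>\<^sub>o Z) \<cdot> (E \<rhd> \<alpha> \<I> \<I> Z)"
      by (simp add: lunit_natural[THEN comp_rewrite] arr_assoc)
    also have "\<dots> = (lu \<I> \<lhd> E \<otimes>\<^sub>o Z) \<cdot> br E (\<I> \<otimes>\<^sub>o \<I>) Z"
      by (simp add: br_tensor lunit_rwhisker arr_assoc)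
    also have "\<dots> = br E \<I> Z \<cdot> (E \<rhd> lu \<I> \<lhd> Z)"
      by (simp add: br_natural_middle)
    also have "\<dots> = (br E \<I> Z \<cdot> (E \<rhd> lu (\<I> \<otimes>\<^sub>o Z))) \<cdot> (E \<rhd> \<alpha> \<I> \<I> Z)"
      by (simp add: lunit_rwhisker lwhisker_comp arr_assoc)
    finally have "(br E \<I> Z \<cdot> lu (E \<otimes>\<^sub>o \<I> \<otimes>\<^sub>o Z) \<cdot> br E \<I> (\<I> \<otimes>\<^sub>o Z)) \<cdot> (E \<rhd> \<alpha> \<I> \<I> Z)
      = (br E \<I> Z \<cdot> (E \<rhd> lu (\<I> \<otimes>\<^sub>o Z))) \<cdot> (E \<rhd> \<alpha> \<I> \<I> Z)"
      by (simp add: arr_assoc)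
    then show "br E \<I> Z \<cdot> lu (E \<otimes>\<^sub>o \<I> \<otimes>\<^sub>o Z) \<cdot> br E \<I> (\<I> \<otimes>\<^sub>o Z) = br E \<I> Z \<cdot> (E \<rhd> lu (\<I> \<otimes>\<^sub>o Z))"
      by (rule iso_cancel_right[rotated]) (simp_all add: iso_tensor)
  qed simp_all
  have "(lu (E \<otimes>\<^sub>o Z) \<cdot> br E \<I> Z) \<cdot> (E \<rhd> \<I> \<rhd> lu Z) = (lu (E \<otimes>\<^sub>o Z) \<cdot> (\<I> \<rhd> E \<rhd> lu Z)) \<cdot> br E \<I> (\<I> \<otimes>\<^sub>o Z)"
    by (simp add: br_natural arr_assoc)
  also have "\<dots> = (E \<rhd> lu Z) \<cdot> lu (E \<otimes>\<^sub>o \<I> \<otimes>\<^sub>o Z) \<cdot> br E \<I> (\<I> \<otimes>\<^sub>o Z)"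
    by (simp add: lunit_natural arr_assoc)
  also have "\<dots> = (E \<rhd> lu Z) \<cdot> (E \<rhd> \<I> \<rhd> lu Z)"
    using lunit_natural[of "lu Z" "\<I> \<otimes>\<^sub>o Z" Z] by (simp add: * flip: lwhisker_comp)
  finally show ?thesis
    by (rule iso_cancel_right[rotated]) (simp_all add: iso_tensor)
qed

lemma br_unit_inv:
  assumes [simp]: "E \<in> Obj C" "Z \<in> Obj C"
  shows "br E \<I> Z \<cdot> (E \<rhd> lu' Z) = lu' (E \<otimes>\<^sub>o Z)"
proof (rule iso_cancel_left)
  show "lu (E \<otimes>\<^sub>o Z) \<cdot> br E \<I> Z \<cdot> (E \<rhd> lu' Z) = lu (E \<otimes>\<^sub>o Z) \<cdot> lu' (E \<otimes>\<^sub>o Z)"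
    by (simp add: br_unit[THEN comp_rewrite])
qed simp_all

section \<open>Sliding a strand past caps, splittings, cups and crossings\<close>

lemma cap_slide:
  assumes [simp]: "ty k = X \<otimes>\<^sub>o Y \<Rrightarrow> \<I>" "X \<in> Obj C" "Y \<in> Obj C" "E \<in> Obj C" "Z \<in> Obj C"
  shows "cap k X Y (E \<otimes>\<^sub>o Z) \<cdot> (X \<rhd> br E Y Z) \<cdot> br E X (Y \<otimes>\<^sub>o Z) = E \<rhd> cap k X Y Z"
proof -
  have "cap k X Y (E \<otimes>\<^sub>o Z) \<cdot> (X \<rhd> br E Y Z) \<cdot> br E X (Y \<otimes>\<^sub>o Z)
    = lu (E \<otimes>\<^sub>o Z) \<cdot> ((k \<lhd> E \<otimes>\<^sub>o Z) \<cdot> br E (X \<otimes>\<^sub>o Y) Z) \<cdot> (E \<rhd> \<alpha>' X Y Z)"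
    by (simp add: cap_def br_tensor arr_assoc)
  \<comment> \<open>Naturality moves \<open>E\<close> from the two legs of \<open>k\<close> to the
    unit that \<open>k\<close> leaves, where the crossing is trivial.\<close>
  also have "\<dots> = (lu (E \<otimes>\<^sub>o Z) \<cdot> br E \<I> Z) \<cdot> (E \<rhd> k \<lhd> Z) \<cdot> (E \<rhd> \<alpha>' X Y Z)"
    by (simp add: arr_assoc flip: br_natural_middle)
  also have "\<dots> = E \<rhd> cap k X Y Z"
    by (simp add: br_unit cap_def lwhisker_comp)
  finally show ?thesis .
qed

text \<open>Naturality of the braiding in \<open>f\<close>, with the crossing of
  \<open>A \<otimes>\<^sub>o B\<close> resolved by the hexagon.\<close>

lemma spl_slide:
  assumes [simp]: "ty f = X \<Rrightarrow> A \<otimes>\<^sub>o B" "A \<in> Obj C" "B \<in> Obj C" "E \<in> Obj C" "Z \<in> Obj C"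
  shows "(A \<rhd> br E B Z) \<cdot> br E A (B \<otimes>\<^sub>o Z) \<cdot> (E \<rhd> spl f A B Z) = spl f A B (E \<otimes>\<^sub>o Z) \<cdot> br E X Z"
proof -
  note [simp] = ty_Obj(1)[OF assms(1)]
  have "spl f A B (E \<otimes>\<^sub>o Z) \<cdot> br E X Z = \<alpha> A B (E \<otimes>\<^sub>o Z) \<cdot> br E (A \<otimes>\<^sub>o B) Z \<cdot> (E \<rhd> f \<lhd> Z)"
    by (simp add: spl_def arr_assoc br_natural_middle)
  then show ?thesis
    by (simp add: br_tensor arr_assoc spl_def lwhisker_comp)
qed

text \<open>A cup is a splitting of the unit, and crossing the unit is trivial.\<close>

lemma cup_slide:
  assumes [simp]: "ty h = \<I> \<Rrightarrow> A \<otimes>\<^sub>o B" "A \<in> Obj C" "B \<in> Obj C" "E \<in> Obj C" "Z \<in> Obj C"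
  shows "(A \<rhd> br E B Z) \<cdot> br E A (B \<otimes>\<^sub>o Z) \<cdot> (E \<rhd> cup h A B Z) = cup h A B (E \<otimes>\<^sub>o Z)"
proof -
  have cup: "cup h A B W = spl h A B W \<cdot> lu' W" if "W \<in> Obj C" for W
    using that by (simp add: cup_def spl_def arr_assoc)
  have "(A \<rhd> br E B Z) \<cdot> br E A (B \<otimes>\<^sub>o Z) \<cdot> (E \<rhd> cup h A B Z)
    = ((A \<rhd> br E B Z) \<cdot> br E A (B \<otimes>\<^sub>o Z) \<cdot> (E \<rhd> spl h A B Z)) \<cdot> (E \<rhd> lu' Z)"
    by (simp add: cup arr_assoc lwhisker_comp)
  also have "\<dots> = cup h A B (E \<otimes>\<^sub>o Z)"
    by (simp add: spl_slide arr_assoc br_unit_inv cup)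
  finally show ?thesis .
qed

text \<open>This is \<open>spl_slide\<close> for \<open>c A B\<close>, viewed as a splitting of
  \<open>A \<otimes>\<^sub>o B\<close>.\<close>

lemma yang_baxter:
  assumes [simp]: "A \<in> Obj C" "B \<in> Obj C" "E \<in> Obj C" "Z \<in> Obj C"
  shows "(B \<rhd> br E A Z) \<cdot> br E B (A \<otimes>\<^sub>o Z) \<cdot> (E \<rhd> br A B Z)
    = br A B (E \<otimes>\<^sub>o Z) \<cdot> (A \<rhd> br E B Z) \<cdot> br E A (B \<otimes>\<^sub>o Z)"
proof -
  have br: "br A B W = spl (c A B) B A W \<cdot> \<alpha>' A B W" if "W \<in> Obj C" for W
    using that by (simp add: br_def spl_def arr_assoc)
  have "(B \<rhd> br E A Z) \<cdot> br E B (A \<otimes>\<^sub>o Z) \<cdot> (E \<rhd> br A B Z)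
    = ((B \<rhd> br E A Z) \<cdot> br E B (A \<otimes>\<^sub>o Z) \<cdot> (E \<rhd> spl (c A B) B A Z)) \<cdot> (E \<rhd> \<alpha>' A B Z)"
    by (subst br) (simp_all add: arr_assoc lwhisker_comp)
  also have "\<dots> = spl (c A B) B A (E \<otimes>\<^sub>o Z) \<cdot> br E (A \<otimes>\<^sub>o B) Z \<cdot> (E \<rhd> \<alpha>' A B Z)"
    by (simp add: spl_slide arr_assoc)
  also have "\<dots> = br A B (E \<otimes>\<^sub>o Z) \<cdot> (A \<rhd> br E B Z) \<cdot> br E A (B \<otimes>\<^sub>o Z)"
    by (subst br) (simp_all add: br_tensor arr_assoc)
  finally show ?thesis .
qed

lemma br_natural_left:
  assumes [simp]: "E \<in> Obj C" "ty f = X \<Rrightarrow> Y" "Z \<in> Obj C"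
  shows "br Y E Z \<cdot> (f \<lhd> E \<otimes>\<^sub>o Z) = (E \<rhd> f \<lhd> Z) \<cdot> br X E Z"
proof -
  note [simp] = ty_Obj[OF assms(2)]
  have "c Y E \<cdot> (f \<lhd> E) = (E \<rhd> f) \<cdot> c X E"
    by (subst braid_natural_ty) simp_all
  then have *: "(c Y E \<lhd> Z) \<cdot> ((f \<lhd> E) \<lhd> Z) = ((E \<rhd> f) \<lhd> Z) \<cdot> (c X E \<lhd> Z)"
    by (simp flip: rwhisker_comp)
  have "br Y E Z \<cdot> (f \<lhd> E \<otimes>\<^sub>o Z) = \<alpha> E Y Z \<cdot> ((c Y E \<lhd> Z) \<cdot> ((f \<lhd> E) \<lhd> Z)) \<cdot> \<alpha>' X E Z"
    by (simp add: br_def coherence)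
  also have "\<dots> = (E \<rhd> f \<lhd> Z) \<cdot> br X E Z"
    unfolding * by (simp add: br_def coherence)
  finally show ?thesis .
qed

end

section \<open>Transparent objects\<close>

locale transparent_object = rigid_category C + braided_category C c
  for C :: "('o, 'm, 'k::field, 'z) rigidcat_scheme" (structure)
    and c :: "'o \<Rightarrow> 'o \<Rightarrow> 'm" +
  fixes \<epsilon> :: 'o
  assumes eps_Obj [simp]: "\<epsilon> \<in> Obj C"
    and transparent: "Y \<in> Obj C \<Longrightarrow> c Y \<epsilon> \<cdot> c \<epsilon> Y = \<ii> (\<epsilon> \<otimes>\<^sub>o Y)"
begin

text \<open>The left dual of an odd arrow \<open>X \<rightarrow> Y\<close>, expressed in \<open>C\<close>.\<close>

definition odd_dual :: "'o \<Rightarrow> 'o \<Rightarrow> 'm \<Rightarrow> 'm" where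
  "odd_dual X Y f = (\<epsilon> \<rhd> lu X\<^sup>\<star>) \<cdot> (\<epsilon> \<rhd> Ev C Y \<lhd> X\<^sup>\<star>) \<cdot> \<alpha> \<epsilon> (Y\<^sup>\<star> \<otimes>\<^sub>o Y) X\<^sup>\<star>
     \<cdot> ((br Y\<^sup>\<star> \<epsilon> Y \<cdot> (Y\<^sup>\<star> \<rhd> f)) \<lhd> X\<^sup>\<star>) \<cdot> \<alpha>' Y\<^sup>\<star> X X\<^sup>\<star> \<cdot> (Y\<^sup>\<star> \<rhd> Coev C X) \<cdot> ru' Y\<^sup>\<star>"

lemma ty_odd_dual [simp]:
  "\<lbrakk>ty f = X \<Rrightarrow> \<epsilon> \<otimes>\<^sub>o Y; X \<in> Obj C; Y \<in> Obj C\<rbrakk> \<Longrightarrow> ty (odd_dual X Y f) = Y\<^sup>\<star> \<Rrightarrow> \<epsilon> \<otimes>\<^sub>o X\<^sup>\<star>"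
  by (simp add: odd_dual_def)

text \<open>The formula of \<open>odd_dual\<close> as a string diagram: create the pair
  \<open>X\<close>, \<open>X\<^sup>\<star>\<close>, apply \<open>f\<close>, pull
  \<open>\<epsilon>\<close> to the left across \<open>Y\<^sup>\<star>\<close>, and evaluate
  \<open>Y\<close>.\<close>

lemma spl_odd_dual:
  assumes [simp]: "ty f = X \<Rrightarrow> \<epsilon> \<otimes>\<^sub>o Y" "X \<in> Obj C" "Y \<in> Obj C" "Z \<in> Obj C"
  shows "spl (odd_dual X Y f) \<epsilon> X\<^sup>\<star> Z = (\<epsilon> \<rhd> ev Y (X\<^sup>\<star> \<otimes>\<^sub>o Z)) \<cdot> br Y\<^sup>\<star> \<epsilon> (Y \<otimes>\<^sub>o X\<^sup>\<star> \<otimes>\<^sub>o Z)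
    \<cdot> (Y\<^sup>\<star> \<rhd> spl f \<epsilon> Y (X\<^sup>\<star> \<otimes>\<^sub>o Z)) \<cdot> (Y\<^sup>\<star> \<rhd> coev X Z)"
  by (simp add: odd_dual_def spl_def cap_def cup_def br_rwhisker br_natural_assoc coherence)

section \<open>Consequences of transparency\<close>

lemma br_cancel [simp]:
  assumes [simp]: "X \<in> Obj C" "Z \<in> Obj C"
  shows "br X \<epsilon> Z \<cdot> br \<epsilon> X Z = \<ii> (\<epsilon> \<otimes>\<^sub>o X \<otimes>\<^sub>o Z)"
    and "br \<epsilon> X Z \<cdot> br X \<epsilon> Z = \<ii> (X \<otimes>\<^sub>o \<epsilon> \<otimes>\<^sub>o Z)"
proof -
  have "br X \<epsilon> Z \<cdot> br \<epsilon> X Z = \<alpha> \<epsilon> X Z \<cdot> ((c X \<epsilon> \<cdot> c \<epsilon> X) \<lhd> Z) \<cdot> \<alpha>' \<epsilon> X Z"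
    by (simp add: br_def coherence)
  then show *: "br X \<epsilon> Z \<cdot> br \<epsilon> X Z = \<ii> (\<epsilon> \<otimes>\<^sub>o X \<otimes>\<^sub>o Z)"
    by (simp add: transparent)
  \<comment> \<open>\<open>br X \<epsilon> Z\<close> is invertible, so its one-sided inverse is
    two-sided.\<close>
  show "br \<epsilon> X Z \<cdot> br X \<epsilon> Z = \<ii> (X \<otimes>\<^sub>o \<epsilon> \<otimes>\<^sub>o Z)"
  proof (rule iso_cancel_left)
    show "br X \<epsilon> Z \<cdot> br \<epsilon> X Z \<cdot> br X \<epsilon> Z = br X \<epsilon> Z \<cdot> \<ii> (X \<otimes>\<^sub>o \<epsilon> \<otimes>\<^sub>o Z)"
      by (simp add: *[THEN comp_rewrite])
  qed simp_all
qed

lemmas br_cancel_assoc [simp] = br_cancel[THEN comp_rewrite]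

text \<open>\<open>cap_slide\<close> takes \<open>\<epsilon>\<close> across both legs of
  \<open>k\<close>, and its crossing with \<open>X\<close> cancels against
  \<open>br X \<epsilon>\<close>. Hence \<open>\<epsilon>\<close> may leave a cap on either
  side.\<close>

lemma cap_transparent:
  assumes [simp]: "ty k = X \<otimes>\<^sub>o Y \<Rrightarrow> \<I>" "X \<in> Obj C" "Y \<in> Obj C" "Z \<in> Obj C"
  shows "(\<epsilon> \<rhd> cap k X Y Z) \<cdot> br X \<epsilon> (Y \<otimes>\<^sub>o Z) = cap k X Y (\<epsilon> \<otimes>\<^sub>o Z) \<cdot> (X \<rhd> br \<epsilon> Y Z)"
  by (simp add: arr_assoc flip: cap_slide)

text \<open>
  The braiding makes \<open>\<epsilon>\<^sup>\<star>\<close> also a right dual of \<open>\<epsilon>\<close>; this is the corresponding coevaluation.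
\<close>

definition coev_eps :: "'o \<Rightarrow> 'm" where
  "coev_eps Z = br \<epsilon> \<epsilon>\<^sup>\<star> Z \<cdot> coev \<epsilon> Z"

lemma ty_coev_eps [simp]: "Z \<in> Obj C \<Longrightarrow> ty (coev_eps Z) = Z \<Rrightarrow> \<epsilon>\<^sup>\<star> \<otimes>\<^sub>o \<epsilon> \<otimes>\<^sub>o Z"
  by (simp add: coev_eps_def)

lemma coev_eps_natural:
  assumes z [simp]: "ty z = Z \<Rrightarrow> Z'"
  shows "(\<epsilon>\<^sup>\<star> \<rhd> \<epsilon> \<rhd> z) \<cdot> coev_eps Z = coev_eps Z' \<cdot> z"
  using ty_Obj[OF z] br_natural[THEN comp_rewrite, of \<epsilon> "\<epsilon>\<^sup>\<star>" z Z Z' "coev \<epsilon> Z"]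
  by (simp add: coev_eps_def cup_natural arr_assoc)

text \<open>The pairing in the first identity, evaluation after braiding, is what
  \<open>piv \<epsilon>\<close> becomes, up to a scalar, when \<open>a \<epsilon>\<close> is a
  multiple of the Drinfeld isomorphism. The second identity lets an \<open>\<epsilon>\<close> that
  crosses the created one cancel against \<open>\<epsilon>\<^sup>\<star>\<close>.\<close>

lemma zigzag_coev_eps:
  assumes [simp]: "Z \<in> Obj C"
  shows "ev \<epsilon> (\<epsilon> \<otimes>\<^sub>o Z) \<cdot> br \<epsilon> \<epsilon>\<^sup>\<star> (\<epsilon> \<otimes>\<^sub>o Z) \<cdot> (\<epsilon> \<rhd> coev_eps Z) = \<ii> (\<epsilon> \<otimes>\<^sub>o Z)"
    and "ev \<epsilon> (\<epsilon> \<otimes>\<^sub>o Z) \<cdot> (\<epsilon>\<^sup>\<star> \<rhd> br \<epsilon> \<epsilon> Z) \<cdot> coev_eps (\<epsilon> \<otimes>\<^sub>o Z) = \<ii> (\<epsilon> \<otimes>\<^sub>o Z)"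
proof -
  have slide: "ev \<epsilon> (\<epsilon> \<otimes>\<^sub>o Z) \<cdot> (\<epsilon>\<^sup>\<star> \<rhd> br \<epsilon> \<epsilon> Z) \<cdot> br \<epsilon> \<epsilon>\<^sup>\<star> (\<epsilon> \<otimes>\<^sub>o Z) = \<epsilon> \<rhd> ev \<epsilon> Z"
    by (simp add: cap_slide)
  then show "ev \<epsilon> (\<epsilon> \<otimes>\<^sub>o Z) \<cdot> (\<epsilon>\<^sup>\<star> \<rhd> br \<epsilon> \<epsilon> Z) \<cdot> coev_eps (\<epsilon> \<otimes>\<^sub>o Z) = \<ii> (\<epsilon> \<otimes>\<^sub>o Z)"
    using arr_assoc[of "coev \<epsilon> (\<epsilon> \<otimes>\<^sub>o Z)"] by (simp add: coev_eps_def flip: arr_assoc)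
  \<comment> \<open>By transparency \<open>br \<epsilon> \<epsilon>\<close> is its own inverse;
    inserting it twice makes Yang-Baxter applicable, after which the cap and the cup can slide
    off.\<close>
  have "ev \<epsilon> (\<epsilon> \<otimes>\<^sub>o Z) \<cdot> br \<epsilon> \<epsilon>\<^sup>\<star> (\<epsilon> \<otimes>\<^sub>o Z) \<cdot> (\<epsilon> \<rhd> br \<epsilon> \<epsilon>\<^sup>\<star> Z) \<cdot> (\<epsilon> \<rhd> coev \<epsilon> Z)
    = ev \<epsilon> (\<epsilon> \<otimes>\<^sub>o Z) \<cdot> (br \<epsilon> \<epsilon>\<^sup>\<star> (\<epsilon> \<otimes>\<^sub>o Z) \<cdot> (\<epsilon> \<rhd> br \<epsilon> \<epsilon>\<^sup>\<star> Z) \<cdot> br \<epsilon> \<epsilon> (\<epsilon>\<^sup>\<star> \<otimes>\<^sub>o Z))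
        \<cdot> br \<epsilon> \<epsilon> (\<epsilon>\<^sup>\<star> \<otimes>\<^sub>o Z) \<cdot> (\<epsilon> \<rhd> coev \<epsilon> Z)"
    by (simp add: arr_assoc)
  also have "\<dots> = (ev \<epsilon> (\<epsilon> \<otimes>\<^sub>o Z) \<cdot> (\<epsilon>\<^sup>\<star> \<rhd> br \<epsilon> \<epsilon> Z) \<cdot> br \<epsilon> \<epsilon>\<^sup>\<star> (\<epsilon> \<otimes>\<^sub>o Z))
      \<cdot> (\<epsilon> \<rhd> br \<epsilon> \<epsilon>\<^sup>\<star> Z) \<cdot> br \<epsilon> \<epsilon> (\<epsilon>\<^sup>\<star> \<otimes>\<^sub>o Z) \<cdot> (\<epsilon> \<rhd> coev \<epsilon> Z)"
    by (subst yang_baxter[symmetric]) (simp_all add: arr_assoc)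
  also have "\<dots> = \<ii> (\<epsilon> \<otimes>\<^sub>o Z)"
    unfolding slide by (simp add: cup_slide)
  finally show "ev \<epsilon> (\<epsilon> \<otimes>\<^sub>o Z) \<cdot> br \<epsilon> \<epsilon>\<^sup>\<star> (\<epsilon> \<otimes>\<^sub>o Z) \<cdot> (\<epsilon> \<rhd> coev_eps Z) = \<ii> (\<epsilon> \<otimes>\<^sub>o Z)"
    by (simp add: coev_eps_def lwhisker_comp)
qed

text \<open>
  An \<open>\<epsilon>\<close> emitted by \<open>f\<close> can be carried to the far right either through the braiding or by cancelling it
  against one half of a previously created pair \<open>\<epsilon>\<^sup>\<star> \<otimes> \<epsilon>\<close>.  The latter form exhibits \<open>f\<^sup>\<star>\<close>.
\<close>

lemma eps_around_coev:
  assumes [simp]: "ty f = X \<Rrightarrow> \<epsilon> \<otimes>\<^sub>o Y" "X \<in> Obj C" "Y \<in> Obj C" "Z \<in> Obj C"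
  shows "ev \<epsilon> (Y \<otimes>\<^sub>o X\<^sup>\<star> \<otimes>\<^sub>o \<epsilon> \<otimes>\<^sub>o Z) \<cdot> (\<epsilon>\<^sup>\<star> \<rhd> spl f \<epsilon> Y (X\<^sup>\<star> \<otimes>\<^sub>o \<epsilon> \<otimes>\<^sub>o Z))
      \<cdot> (\<epsilon>\<^sup>\<star> \<rhd> coev X (\<epsilon> \<otimes>\<^sub>o Z)) \<cdot> coev_eps Z
    = (Y \<rhd> br \<epsilon> X\<^sup>\<star> Z) \<cdot> br \<epsilon> Y (X\<^sup>\<star> \<otimes>\<^sub>o Z) \<cdot> spl f \<epsilon> Y (X\<^sup>\<star> \<otimes>\<^sub>o Z) \<cdot> coev X Z"
proof -
  let ?W = "X\<^sup>\<star> \<otimes>\<^sub>o Z" and ?V = "X\<^sup>\<star> \<otimes>\<^sub>o \<epsilon> \<otimes>\<^sub>o Z"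
  \<comment> \<open>The pair \<open>X\<close>, \<open>X\<^sup>\<star>\<close> is created to the left
    of \<open>\<epsilon>\<close>; by \<open>cup_slide\<close>, \<open>\<epsilon>\<close> may instead
    start to the left of the pair and cross it. It then slides past \<open>f\<close> and so crosses
    the \<open>\<epsilon>\<close> emitted by \<open>f\<close>.\<close>
  have "spl f \<epsilon> Y ?V \<cdot> coev X (\<epsilon> \<otimes>\<^sub>o Z)
    = (spl f \<epsilon> Y ?V \<cdot> (X \<rhd> br \<epsilon> X\<^sup>\<star> Z)) \<cdot> br \<epsilon> X ?W \<cdot> (\<epsilon> \<rhd> coev X Z)"
    by (simp add: arr_assoc flip: cup_slide)
  also have "\<dots> = (\<epsilon> \<rhd> Y \<rhd> br \<epsilon> X\<^sup>\<star> Z) \<cdot> (spl f \<epsilon> Y (\<epsilon> \<otimes>\<^sub>o ?W) \<cdot> br \<epsilon> X ?W) \<cdot> (\<epsilon> \<rhd> coev X Z)"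
    by (simp add: arr_assoc flip: spl_natural)
  also have "\<dots> = (\<epsilon> \<rhd> Y \<rhd> br \<epsilon> X\<^sup>\<star> Z) \<cdot> (\<epsilon> \<rhd> br \<epsilon> Y ?W) \<cdot> br \<epsilon> \<epsilon> (Y \<otimes>\<^sub>o ?W) \<cdot> (\<epsilon> \<rhd> (spl f \<epsilon> Y ?W \<cdot> coev X Z))"
    by (simp add: arr_assoc lwhisker_comp flip: spl_slide)
  finally have inner: "spl f \<epsilon> Y ?V \<cdot> coev X (\<epsilon> \<otimes>\<^sub>o Z) = \<dots>" .
  have "ev \<epsilon> (Y \<otimes>\<^sub>o ?V) \<cdot> (\<epsilon>\<^sup>\<star> \<rhd> spl f \<epsilon> Y ?V) \<cdot> (\<epsilon>\<^sup>\<star> \<rhd> coev X (\<epsilon> \<otimes>\<^sub>o Z)) \<cdot> coev_eps Z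
    = ev \<epsilon> (Y \<otimes>\<^sub>o ?V) \<cdot> (\<epsilon>\<^sup>\<star> \<rhd> (spl f \<epsilon> Y ?V \<cdot> coev X (\<epsilon> \<otimes>\<^sub>o Z))) \<cdot> coev_eps Z"
    by (simp add: lwhisker_comp arr_assoc)
  also have "\<dots> = (ev \<epsilon> (Y \<otimes>\<^sub>o ?V) \<cdot> (\<epsilon>\<^sup>\<star> \<rhd> \<epsilon> \<rhd> ((Y \<rhd> br \<epsilon> X\<^sup>\<star> Z) \<cdot> br \<epsilon> Y ?W))) \<cdot> (\<epsilon>\<^sup>\<star> \<rhd> br \<epsilon> \<epsilon> (Y \<otimes>\<^sub>o ?W))
      \<cdot> ((\<epsilon>\<^sup>\<star> \<rhd> \<epsilon> \<rhd> (spl f \<epsilon> Y ?W \<cdot> coev X Z)) \<cdot> coev_eps Z)"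
    unfolding inner by (simp add: lwhisker_comp arr_assoc)
  \<comment> \<open>The single crossing between the two copies of \<open>\<epsilon>\<close> is the
    one in the second identity of \<open>zigzag_coev_eps\<close>, which now appears in the
    middle.\<close>
  also have "\<dots> = ((Y \<rhd> br \<epsilon> X\<^sup>\<star> Z) \<cdot> br \<epsilon> Y ?W)
      \<cdot> (ev \<epsilon> (\<epsilon> \<otimes>\<^sub>o Y \<otimes>\<^sub>o ?W) \<cdot> (\<epsilon>\<^sup>\<star> \<rhd> br \<epsilon> \<epsilon> (Y \<otimes>\<^sub>o ?W)) \<cdot> coev_eps (\<epsilon> \<otimes>\<^sub>o Y \<otimes>\<^sub>o ?W))
      \<cdot> spl f \<epsilon> Y ?W \<cdot> coev X Z"
    by (subst cap_natural, simp, simp, simp, simp, subst coev_eps_natural, simp) (simp add: arr_assoc)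
  finally show ?thesis
    by (simp add: zigzag_coev_eps arr_assoc)
qed

text \<open>Reduces the odd dual to the ordinary one: transparency lets \<open>\<epsilon>\<close>
  leave to the right of \<open>Y\<close> instead of crossing \<open>Y\<^sup>\<star>\<close>, and
  \<open>eps_around_coev\<close> then brings out the dual of \<open>f\<close> as an arrow of
  \<open>C\<close>.\<close>

lemma br_spl_odd_dual:
  assumes [simp]: "ty f = X \<Rrightarrow> \<epsilon> \<otimes>\<^sub>o Y" "X \<in> Obj C" "Y \<in> Obj C" "Z \<in> Obj C"
  shows "br \<epsilon> X\<^sup>\<star> Z \<cdot> spl (odd_dual X Y f) \<epsilon> X\<^sup>\<star> Z
    = ((dual_arr C f \<cdot> dual_tensor C \<epsilon> Y) \<lhd> \<epsilon> \<otimes>\<^sub>o Z) \<cdot> \<alpha>' Y\<^sup>\<star> \<epsilon>\<^sup>\<star> (\<epsilon> \<otimes>\<^sub>o Z) \<cdot> (Y\<^sup>\<star> \<rhd> coev_eps Z)"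
proof -
  let ?W = "X\<^sup>\<star> \<otimes>\<^sub>o Z"
  have "br \<epsilon> X\<^sup>\<star> Z \<cdot> spl (odd_dual X Y f) \<epsilon> X\<^sup>\<star> Z
    = br \<epsilon> X\<^sup>\<star> Z \<cdot> ((\<epsilon> \<rhd> ev Y ?W) \<cdot> br Y\<^sup>\<star> \<epsilon> (Y \<otimes>\<^sub>o ?W)) \<cdot> (Y\<^sup>\<star> \<rhd> spl f \<epsilon> Y ?W) \<cdot> (Y\<^sup>\<star> \<rhd> coev X Z)"
    by (simp add: spl_odd_dual arr_assoc)
  also have "\<dots> = (br \<epsilon> X\<^sup>\<star> Z \<cdot> ev Y (\<epsilon> \<otimes>\<^sub>o ?W)) \<cdot> (Y\<^sup>\<star> \<rhd> br \<epsilon> Y ?W) \<cdot> (Y\<^sup>\<star> \<rhd> spl f \<epsilon> Y ?W) \<cdot> (Y\<^sup>\<star> \<rhd> coev X Z)"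
    by (simp add: cap_transparent arr_assoc)
  also have "br \<epsilon> X\<^sup>\<star> Z \<cdot> ev Y (\<epsilon> \<otimes>\<^sub>o ?W) = ev Y (X\<^sup>\<star> \<otimes>\<^sub>o \<epsilon> \<otimes>\<^sub>o Z) \<cdot> (Y\<^sup>\<star> \<rhd> Y \<rhd> br \<epsilon> X\<^sup>\<star> Z)"
    by (simp add: cap_natural)
  also have "(ev Y (X\<^sup>\<star> \<otimes>\<^sub>o \<epsilon> \<otimes>\<^sub>o Z) \<cdot> (Y\<^sup>\<star> \<rhd> Y \<rhd> br \<epsilon> X\<^sup>\<star> Z)) \<cdot> (Y\<^sup>\<star> \<rhd> br \<epsilon> Y ?W) \<cdot> (Y\<^sup>\<star> \<rhd> spl f \<epsilon> Y ?W) \<cdot> (Y\<^sup>\<star> \<rhd> coev X Z)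
    = ev Y (X\<^sup>\<star> \<otimes>\<^sub>o \<epsilon> \<otimes>\<^sub>o Z) \<cdot> (Y\<^sup>\<star> \<rhd> ((Y \<rhd> br \<epsilon> X\<^sup>\<star> Z) \<cdot> br \<epsilon> Y ?W \<cdot> spl f \<epsilon> Y ?W \<cdot> coev X Z))"
    by (simp add: lwhisker_comp arr_assoc)
  also have "\<dots> = ((dual_arr C f \<cdot> dual_tensor C \<epsilon> Y) \<lhd> \<epsilon> \<otimes>\<^sub>o Z) \<cdot> \<alpha>' Y\<^sup>\<star> \<epsilon>\<^sup>\<star> (\<epsilon> \<otimes>\<^sub>o Z) \<cdot> (Y\<^sup>\<star> \<rhd> coev_eps Z)"
    unfolding eps_around_coev[OF assms, symmetric]
    by (simp add: dual_arr_dual_tensor_rwhisker lwhisker_comp arr_assoc)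
  finally show ?thesis .
qed

end

section \<open>Pivotal structures\<close>

context braided_pivotal_fusion_category
begin

lemma ty_pivotal [simp]: "X \<in> Obj C \<Longrightarrow> ty (a X) = X \<Rrightarrow> X\<^sup>\<star>\<^sup>\<star>"
  using pivotal by (simp add: monoidal_iso_to_bidual_def arity_eq_iff)

lemma iso_pivotal: "X \<in> Obj C \<Longrightarrow> iso_arr C (a X)"
  using pivotal by (simp add: monoidal_iso_to_bidual_def)

lemma pivotal_natural: "ty f = X \<Rrightarrow> Y \<Longrightarrow> a Y \<cdot> f = dual_arr C (dual_arr C f) \<cdot> a X"
  using pivotal ty_Arr[of f X Y] ty_Dom[of f X Y] ty_Cod[of f X Y]
  unfolding monoidal_iso_to_bidual_def Bid_def by metis

lemma pivotal_tensor:
  "\<lbrakk>X \<in> Obj C; Y \<in> Obj C\<rbrakk> \<Longrightarrow> a (X \<otimes>\<^sub>o Y)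
    = (dual_arr C (inv_arr C (dual_tensor C X Y)) \<cdot> dual_tensor C Y\<^sup>\<star> X\<^sup>\<star>) \<cdot> (a X \<otimes>\<^sub>a a Y)"
  using pivotal by (simp add: monoidal_iso_to_bidual_def bidual_tensor_def)

text \<open>
  In this form \<open>a\<^bsub>X\<^esub>\<close> becomes an evaluation \<open>X \<otimes> X\<^sup>\<star> \<rightarrow> \<one>\<close>.
\<close>

definition Piv :: "'o \<Rightarrow> 'm" where
  "Piv X = Ev C X\<^sup>\<star> \<cdot> (a X \<lhd> X\<^sup>\<star>)"

abbreviation piv :: "'o \<Rightarrow> 'o \<Rightarrow> 'm" where
  "piv X Z \<equiv> cap (Piv X) X X\<^sup>\<star> Z"

lemma ty_Piv [simp]: "X \<in> Obj C \<Longrightarrow> ty (Piv X) = X \<otimes>\<^sub>o X\<^sup>\<star> \<Rrightarrow> \<I>"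
  by (simp add: Piv_def)

lemma piv_eq: "\<lbrakk>X \<in> Obj C; Z \<in> Obj C\<rbrakk> \<Longrightarrow> piv X Z = ev X\<^sup>\<star> Z \<cdot> (a X \<lhd> X\<^sup>\<star> \<otimes>\<^sub>o Z)"
  by (simp add: Piv_def cap_comp_left)

text \<open>Naturality of \<open>a\<close> exchanges \<open>f\<close> for its bidual, and
  \<open>ev_dual_arr\<close> moves that to the other leg as a single dual.\<close>

lemma piv_dual_arr:
  assumes [simp]: "ty f = X \<Rrightarrow> Y" "Z \<in> Obj C"
  shows "piv X Z \<cdot> (X \<rhd> dual_arr C f \<lhd> Z) = piv Y Z \<cdot> (f \<lhd> Y\<^sup>\<star> \<otimes>\<^sub>o Z)"
proof -
  note [simp] = ty_Obj[OF assms(1)]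
  have "piv Y Z \<cdot> (f \<lhd> Y\<^sup>\<star> \<otimes>\<^sub>o Z) = ev Y\<^sup>\<star> Z \<cdot> ((a Y \<cdot> f) \<lhd> Y\<^sup>\<star> \<otimes>\<^sub>o Z)"
    by (simp add: piv_eq rwhisker_comp arr_assoc)
  also have "\<dots> = (ev Y\<^sup>\<star> Z \<cdot> (dual_arr C (dual_arr C f) \<lhd> Y\<^sup>\<star> \<otimes>\<^sub>o Z)) \<cdot> (a X \<lhd> Y\<^sup>\<star> \<otimes>\<^sub>o Z)"
    by (simp add: pivotal_natural[OF assms(1)] rwhisker_comp arr_assoc)
  also have "\<dots> = ev X\<^sup>\<star> Z \<cdot> (X\<^sup>\<star>\<^sup>\<star> \<rhd> dual_arr C f \<lhd> Z) \<cdot> (a X \<lhd> Y\<^sup>\<star> \<otimes>\<^sub>o Z)"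
    by (simp add: ev_dual_arr[of "dual_arr C f" "Y\<^sup>\<star>" "X\<^sup>\<star>"] arr_assoc)
  also have "\<dots> = piv X Z \<cdot> (X \<rhd> dual_arr C f \<lhd> Z)"
    by (simp add: piv_eq arr_assoc rwhisker_natural[of "a X" X])
  finally show ?thesis by simp
qed

text \<open>Monoidality of \<open>a\<close> brings in the dual of the inverse of
  \<open>dual_tensor C X Y\<close>. Moved around the evaluation, it cancels against the given
  \<open>dual_tensor C X Y\<close>, and nested pairings remain.\<close>

lemma piv_tensor:
  assumes [simp]: "X \<in> Obj C" "Y \<in> Obj C" "Z \<in> Obj C"
  shows "piv (X \<otimes>\<^sub>o Y) Z \<cdot> ((X \<otimes>\<^sub>o Y) \<rhd> dual_tensor C X Y \<lhd> Z)
    = piv X Z \<cdot> (X \<rhd> piv Y (X\<^sup>\<star> \<otimes>\<^sub>o Z)) \<cdot> (X \<rhd> Y \<rhd> \<alpha> Y\<^sup>\<star> X\<^sup>\<star> Z) \<cdot> \<alpha> X Y ((Y\<^sup>\<star> \<otimes>\<^sub>o X\<^sup>\<star>) \<otimes>\<^sub>o Z)"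
proof -
  let ?T = "X \<otimes>\<^sub>o Y" and ?D = "Y\<^sup>\<star> \<otimes>\<^sub>o X\<^sup>\<star>" and ?d = "dual_tensor C X Y" and ?A = "a X \<otimes>\<^sub>a a Y"
  let ?e = "dual_tensor C Y\<^sup>\<star> X\<^sup>\<star>"
  have [simp]: "ty (inv_arr C ?d) = ?T\<^sup>\<star> \<Rrightarrow> ?D"
    by (rule ty_inv) simp_all
  have "piv ?T Z \<cdot> (?T \<rhd> ?d \<lhd> Z)
    = ev ?T\<^sup>\<star> Z \<cdot> ((a ?T \<lhd> ?T\<^sup>\<star> \<otimes>\<^sub>o Z) \<cdot> (?T \<rhd> ?d \<lhd> Z))"
    by (simp add: piv_eq arr_assoc)
  also have "\<dots> = ev ?T\<^sup>\<star> Z \<cdot> (?T\<^sup>\<star>\<^sup>\<star> \<rhd> ?d \<lhd> Z) \<cdot> (a ?T \<lhd> ?D \<otimes>\<^sub>o Z)"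
    by (subst rwhisker_natural[of "a ?T" ?T]) simp_all
  also have "\<dots> = ev ?T\<^sup>\<star> Z \<cdot> ((?T\<^sup>\<star>\<^sup>\<star> \<rhd> ?d \<lhd> Z) \<cdot> (dual_arr C (inv_arr C ?d) \<lhd> ?D \<otimes>\<^sub>o Z)) \<cdot> (?e \<lhd> ?D \<otimes>\<^sub>o Z) \<cdot> (?A \<lhd> ?D \<otimes>\<^sub>o Z)"
    by (simp add: pivotal_tensor rwhisker_comp arr_assoc)
  also have "\<dots> = (ev ?T\<^sup>\<star> Z \<cdot> (dual_arr C (inv_arr C ?d) \<lhd> ?T\<^sup>\<star> \<otimes>\<^sub>o Z)) \<cdot> (?D\<^sup>\<star> \<rhd> ?d \<lhd> Z) \<cdot> (?e \<lhd> ?D \<otimes>\<^sub>o Z) \<cdot> (?A \<lhd> ?D \<otimes>\<^sub>o Z)"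
    by (subst rwhisker_natural[of "dual_arr C (inv_arr C ?d)" "?D\<^sup>\<star>" "?T\<^sup>\<star>\<^sup>\<star>" "?d \<lhd> Z" "?D \<otimes>\<^sub>o Z" "?T\<^sup>\<star> \<otimes>\<^sub>o Z"])
      (simp_all add: arr_assoc)
  also have "\<dots> = ev ?D Z \<cdot> (?D\<^sup>\<star> \<rhd> ((inv_arr C ?d \<cdot> ?d) \<lhd> Z)) \<cdot> (?e \<lhd> ?D \<otimes>\<^sub>o Z) \<cdot> (?A \<lhd> ?D \<otimes>\<^sub>o Z)"
    by (simp add: ev_dual_arr[of "inv_arr C ?d" "?T\<^sup>\<star>" ?D] arr_assoc rwhisker_comp lwhisker_comp)
  also have "inv_arr C ?d \<cdot> ?d = \<ii> ?D"
    by (rule inv_left) simp_all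
  also have "ev ?D Z \<cdot> (?D\<^sup>\<star> \<rhd> (\<ii> ?D \<lhd> Z)) \<cdot> (?e \<lhd> ?D \<otimes>\<^sub>o Z) \<cdot> (?A \<lhd> ?D \<otimes>\<^sub>o Z)
    = (ev ?D Z \<cdot> (?e \<lhd> ?D \<otimes>\<^sub>o Z)) \<cdot> (?A \<lhd> ?D \<otimes>\<^sub>o Z)"
    by (simp add: arr_assoc)
  also have "\<dots> = ev X\<^sup>\<star> Z \<cdot> (X\<^sup>\<star>\<^sup>\<star> \<rhd> ev Y\<^sup>\<star> (X\<^sup>\<star> \<otimes>\<^sub>o Z)) \<cdot> (X\<^sup>\<star>\<^sup>\<star> \<rhd> Y\<^sup>\<star>\<^sup>\<star> \<rhd> \<alpha> Y\<^sup>\<star> X\<^sup>\<star> Z)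
      \<cdot> (a X \<otimes>\<^sub>a (a Y \<lhd> ?D \<otimes>\<^sub>o Z)) \<cdot> \<alpha> X Y (?D \<otimes>\<^sub>o Z)"
    by (simp add: ev_dual_tensor cap_Ev_tensor arr_assoc assoc_natural)
  also have "\<dots> = ev X\<^sup>\<star> Z \<cdot> ((a X \<lhd> X\<^sup>\<star> \<otimes>\<^sub>o Z) \<cdot> (X \<rhd> (ev Y\<^sup>\<star> (X\<^sup>\<star> \<otimes>\<^sub>o Z) \<cdot> (Y\<^sup>\<star>\<^sup>\<star> \<rhd> \<alpha> Y\<^sup>\<star> X\<^sup>\<star> Z) \<cdot> (a Y \<lhd> ?D \<otimes>\<^sub>o Z))))
      \<cdot> \<alpha> X Y (?D \<otimes>\<^sub>o Z)"
    by (simp add: tensor_comp arr_assoc tensor_comp[THEN comp_rewrite])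
  also have "\<dots> = piv X Z \<cdot> (X \<rhd> piv Y (X\<^sup>\<star> \<otimes>\<^sub>o Z)) \<cdot> (X \<rhd> Y \<rhd> \<alpha> Y\<^sup>\<star> X\<^sup>\<star> Z) \<cdot> \<alpha> X Y (?D \<otimes>\<^sub>o Z)"
    by (simp add: piv_eq lwhisker_comp arr_assoc rwhisker_natural[of "a Y" Y])
  finally show ?thesis .
qed

lemma drinfeld_eq_snake:
  assumes [simp]: "X \<in> Obj C"
  shows "drinfeld C c X = snake C X X\<^sup>\<star> X\<^sup>\<star>\<^sup>\<star> (Ev C X \<cdot> c X X\<^sup>\<star>) (Coev C X\<^sup>\<star>)"
  by (simp add: drinfeld_def Let_def snake_def rwhisker_comp arr_assoc)

lemma ty_drinfeld [simp]: "X \<in> Obj C \<Longrightarrow> ty (drinfeld C c X) = X \<Rrightarrow> X\<^sup>\<star>\<^sup>\<star>"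
  by (simp add: drinfeld_eq_snake)

text \<open>The Drinfeld isomorphism corresponds to the pairing
  \<open>Ev C X \<cdot> c X X\<^sup>\<star>\<close>, so \<open>ev_snake\<close> evaluates
  it.\<close>

lemma piv_drinfeld:
  assumes "a X = Scale C s (drinfeld C c X)" and [simp]: "X \<in> Obj C" "Z \<in> Obj C"
  shows "piv X Z = Scale C s (ev X Z \<cdot> br X X\<^sup>\<star> Z)"
proof -
  have "piv X Z = Scale C s (ev X\<^sup>\<star> Z \<cdot> (drinfeld C c X \<lhd> X\<^sup>\<star> \<otimes>\<^sub>o Z))"
    using assms(1) by (simp add: piv_eq scale_tensor scale_comp)
  also have "ev X\<^sup>\<star> Z \<cdot> (drinfeld C c X \<lhd> X\<^sup>\<star> \<otimes>\<^sub>o Z) = ev X Z \<cdot> br X X\<^sup>\<star> Z"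
    by (simp add: drinfeld_eq_snake ev_snake) (simp add: cap_def br_def coherence)
  finally show ?thesis .
qed

end

section \<open>Odd arrows and their biduals\<close>

locale pivotal_transparent_object = braided_pivotal_fusion_category C c a + transparent_object C c \<epsilon>
  for C :: "('o, 'm, 'k::field, 'z) rigidcat_scheme" (structure)
    and c :: "'o \<Rightarrow> 'o \<Rightarrow> 'm" and a :: "'o \<Rightarrow> 'm" and \<epsilon> :: 'o +
  fixes s :: 'k
  assumes a_eps: "a \<epsilon> = Scale C s (drinfeld C c \<epsilon>)"
begin

text \<open>The odd analogue of \<open>piv_dual_arr\<close>: \<open>f\<close> moves around the
  pairing at the cost of the factor \<open>s\<close>.\<close>

lemma piv_odd_dual:
  assumes [simp]: "ty f = X \<Rrightarrow> \<epsilon> \<otimes>\<^sub>o Y" "X \<in> Obj C" "Y \<in> Obj C" "Z \<in> Obj C"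
  shows "(\<epsilon> \<rhd> piv X Z) \<cdot> br X \<epsilon> (X\<^sup>\<star> \<otimes>\<^sub>o Z) \<cdot> (X \<rhd> spl (odd_dual X Y f) \<epsilon> X\<^sup>\<star> Z)
    = Scale C s ((\<epsilon> \<rhd> piv Y Z) \<cdot> spl f \<epsilon> Y (Y\<^sup>\<star> \<otimes>\<^sub>o Z))"
proof -
  let ?T = "\<epsilon> \<otimes>\<^sub>o Y" and ?E = "\<epsilon> \<otimes>\<^sub>o Z" and ?d = "dual_tensor C \<epsilon> Y"
  let ?h = "\<alpha>' Y\<^sup>\<star> \<epsilon>\<^sup>\<star> (\<epsilon> \<otimes>\<^sub>o Z) \<cdot> (Y\<^sup>\<star> \<rhd> coev_eps Z)"
  have "(\<epsilon> \<rhd> piv X Z) \<cdot> br X \<epsilon> (X\<^sup>\<star> \<otimes>\<^sub>o Z) \<cdot> (X \<rhd> spl (odd_dual X Y f) \<epsilon> X\<^sup>\<star> Z)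
    = ((\<epsilon> \<rhd> piv X Z) \<cdot> br X \<epsilon> (X\<^sup>\<star> \<otimes>\<^sub>o Z)) \<cdot> (X \<rhd> spl (odd_dual X Y f) \<epsilon> X\<^sup>\<star> Z)"
    by (simp add: arr_assoc)
  also have "\<dots> = piv X ?E \<cdot> (X \<rhd> (br \<epsilon> X\<^sup>\<star> Z \<cdot> spl (odd_dual X Y f) \<epsilon> X\<^sup>\<star> Z))"
    by (simp add: cap_transparent arr_assoc lwhisker_comp)
  also have "\<dots> = (piv X ?E \<cdot> (X \<rhd> dual_arr C f \<lhd> ?E)) \<cdot> (X \<rhd> ((?d \<lhd> ?E) \<cdot> ?h))"
    by (simp add: br_spl_odd_dual arr_assoc lwhisker_comp rwhisker_comp)
  also have "\<dots> = piv ?T ?E \<cdot> ((f \<lhd> ?T\<^sup>\<star> \<otimes>\<^sub>o ?E) \<cdot> (X \<rhd> ((?d \<lhd> ?E) \<cdot> ?h)))"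
    by (simp add: piv_dual_arr[OF assms(1)] arr_assoc)
  also have "\<dots> = (piv ?T ?E \<cdot> (?T \<rhd> ?d \<lhd> ?E)) \<cdot> (?T \<rhd> ?h) \<cdot> (f \<lhd> Y\<^sup>\<star> \<otimes>\<^sub>o Z)"
    by (subst rwhisker_natural[OF assms(1), of _ "Y\<^sup>\<star> \<otimes>\<^sub>o Z", symmetric]) (simp_all add: arr_assoc lwhisker_comp)
  \<comment> \<open>Monoidality splits the pairing on \<open>\<epsilon> \<otimes>\<^sub>o Y\<close>
    and uses up \<open>?d\<close>, so that the pairing on \<open>\<epsilon>\<close> can meet
    \<open>coev_eps\<close>.\<close>
  also have "\<dots> = piv \<epsilon> ?E \<cdot> (\<epsilon> \<rhd> (piv Y (\<epsilon>\<^sup>\<star> \<otimes>\<^sub>o ?E) \<cdot> (Y \<rhd> Y\<^sup>\<star> \<rhd> coev_eps Z))) \<cdot> spl f \<epsilon> Y (Y\<^sup>\<star> \<otimes>\<^sub>o Z)"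
    by (simp only: piv_tensor eps_Obj assms TensorObj_Obj) (simp add: assoc_natural_ident spl_def lwhisker_comp arr_assoc)
  also have "\<dots> = piv \<epsilon> ?E \<cdot> (\<epsilon> \<rhd> coev_eps Z) \<cdot> (\<epsilon> \<rhd> piv Y Z) \<cdot> spl f \<epsilon> Y (Y\<^sup>\<star> \<otimes>\<^sub>o Z)"
    by (simp add: cap_natural lwhisker_comp arr_assoc)
  \<comment> \<open>Here \<open>a_eps\<close> enters: the pairing on \<open>\<epsilon>\<close> is
    \<open>s\<close> times the one that cancels against \<open>coev_eps\<close>.\<close>
  also have "\<dots> = Scale C s ((ev \<epsilon> ?E \<cdot> br \<epsilon> \<epsilon>\<^sup>\<star> ?E \<cdot> (\<epsilon> \<rhd> coev_eps Z)) \<cdot> (\<epsilon> \<rhd> piv Y Z) \<cdot> spl f \<epsilon> Y (Y\<^sup>\<star> \<otimes>\<^sub>o Z))"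
    by (simp add: piv_drinfeld[OF a_eps] scale_comp arr_assoc)
  finally show ?thesis
    unfolding zigzag_coev_eps[OF assms(4)] by simp
qed

text \<open>Only the outer odd dual is unfolded. There \<open>a X\<close> turns the evaluation into
  \<open>piv X\<close>, and \<open>piv_odd_dual\<close> removes the inner odd dual and yields
  \<open>s\<close>.\<close>

lemma odd_bidual_natural:
  assumes [simp]: "ty f = X \<Rrightarrow> \<epsilon> \<otimes>\<^sub>o Y" "X \<in> Obj C" "Y \<in> Obj C"
  shows "odd_dual Y\<^sup>\<star> X\<^sup>\<star> (odd_dual X Y f) \<cdot> a X = Scale C s ((\<epsilon> \<rhd> a Y) \<cdot> f)"
proof (rule spl_inj)
  let ?g = "odd_dual X Y f" and ?W = "Y\<^sup>\<star>\<^sup>\<star> \<otimes>\<^sub>o \<I>"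
  have "spl (odd_dual Y\<^sup>\<star> X\<^sup>\<star> ?g \<cdot> a X) \<epsilon> Y\<^sup>\<star>\<^sup>\<star> \<I> = spl (odd_dual Y\<^sup>\<star> X\<^sup>\<star> ?g) \<epsilon> Y\<^sup>\<star>\<^sup>\<star> \<I> \<cdot> (a X \<lhd> \<I>)"
    by (simp add: spl_def rwhisker_comp arr_assoc)
  also have "\<dots> = (\<epsilon> \<rhd> ev X\<^sup>\<star> ?W) \<cdot> br X\<^sup>\<star>\<^sup>\<star> \<epsilon> (X\<^sup>\<star> \<otimes>\<^sub>o ?W) \<cdot> ((X\<^sup>\<star>\<^sup>\<star> \<rhd> (spl ?g \<epsilon> X\<^sup>\<star> ?W \<cdot> coev Y\<^sup>\<star> \<I>)) \<cdot> (a X \<lhd> \<I>))"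
    by (simp add: spl_odd_dual lwhisker_comp arr_assoc)
  also have "\<dots> = (\<epsilon> \<rhd> ev X\<^sup>\<star> ?W) \<cdot> (br X\<^sup>\<star>\<^sup>\<star> \<epsilon> (X\<^sup>\<star> \<otimes>\<^sub>o ?W) \<cdot> (a X \<lhd> \<epsilon> \<otimes>\<^sub>o X\<^sup>\<star> \<otimes>\<^sub>o ?W)) \<cdot> (X \<rhd> (spl ?g \<epsilon> X\<^sup>\<star> ?W \<cdot> coev Y\<^sup>\<star> \<I>))"
    by (subst rwhisker_natural[of "a X" X]) (simp_all add: arr_assoc)
  also have "\<dots> = ((\<epsilon> \<rhd> piv X ?W) \<cdot> br X \<epsilon> (X\<^sup>\<star> \<otimes>\<^sub>o ?W) \<cdot> (X \<rhd> spl ?g \<epsilon> X\<^sup>\<star> ?W)) \<cdot> (X \<rhd> coev Y\<^sup>\<star> \<I>)"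
    by (simp add: br_natural_left piv_eq lwhisker_comp arr_assoc)
  also have "\<dots> = Scale C s ((\<epsilon> \<rhd> piv Y ?W) \<cdot> (spl f \<epsilon> Y (Y\<^sup>\<star> \<otimes>\<^sub>o ?W) \<cdot> (X \<rhd> coev Y\<^sup>\<star> \<I>)))"
    by (simp add: piv_odd_dual scale_comp arr_assoc)
  also have "\<dots> = Scale C s ((\<epsilon> \<rhd> (piv Y ?W \<cdot> (Y \<rhd> coev Y\<^sup>\<star> \<I>))) \<cdot> spl f \<epsilon> Y \<I>)"
    by (simp add: lwhisker_comp arr_assoc flip: spl_natural)
  \<comment> \<open>The remaining coevaluation straightens the pairing back into
    \<open>a Y\<close>.\<close>
  also have "piv Y ?W \<cdot> (Y \<rhd> coev Y\<^sup>\<star> \<I>) = a Y \<lhd> \<I>"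
  proof -
    have "piv Y ?W \<cdot> (Y \<rhd> coev Y\<^sup>\<star> \<I>) = (ev Y\<^sup>\<star> ?W \<cdot> (Y\<^sup>\<star>\<^sup>\<star> \<rhd> coev Y\<^sup>\<star> \<I>)) \<cdot> (a Y \<lhd> \<I>)"
      by (simp add: piv_eq arr_assoc rwhisker_natural[of "a Y" Y] del: zigzag_dual)
    then show ?thesis by simp
  qed
  also have "Scale C s ((\<epsilon> \<rhd> (a Y \<lhd> \<I>)) \<cdot> spl f \<epsilon> Y \<I>) = spl (Scale C s ((\<epsilon> \<rhd> a Y) \<cdot> f)) \<epsilon> Y\<^sup>\<star>\<^sup>\<star> \<I>"
    by (simp add: spl_def scale_tensor scale_comp coherence)
  finally show "spl (odd_dual Y\<^sup>\<star> X\<^sup>\<star> ?g \<cdot> a X) \<epsilon> Y\<^sup>\<star>\<^sup>\<star> \<I> = spl (Scale C s ((\<epsilon> \<rhd> a Y) \<cdot> f)) \<epsilon> Y\<^sup>\<star>\<^sup>\<star> \<I>" .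
qed simp_all

end

section \<open>The associated supercategory\<close>

locale associated_supercategory = transparent_object C c \<epsilon>
  for C :: "('o, 'm, 'k::field, 'z) rigidcat_scheme" (structure)
    and c :: "'o \<Rightarrow> 'o \<Rightarrow> 'm" and \<epsilon> :: 'o +
  fixes \<xi> :: 'm
  assumes ty_xi [simp]: "ty \<xi> = \<epsilon> \<otimes>\<^sub>o \<epsilon> \<Rrightarrow> \<I>"
begin

abbreviation S :: "('o, 'm \<times> 'm, 'k) rigid_supercat" where "S \<equiv> hat_supercategory C c \<epsilon> \<xi>"
abbreviation emb :: "'m \<Rightarrow> 'm \<times> 'm" where "emb \<equiv> as_even C \<epsilon>"

lemma S_simps [simp]:
  "Obj S = Obj C" "Dom S (f0, f1) = Dom C f0" "Cod S (f0, f1) = Cod C f0"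
  "Ident S X = emb (\<ii> X)"
  "Add S (f0, f1) (g0, g1) = (Add C f0 g0, Add C f1 g1)"
  "Scale S r (f0, f1) = (Scale C r f0, Scale C r f1)"
  "TensorObj S = TensorObj C" "UnitObj S = \<I>"
  "Assoc S X Y Z = emb (\<alpha> X Y Z)" "LUnit S X = emb (lu X)" "RUnit S X = emb (ru X)"
  "Dual S = Dual C" "Ev S X = emb (Ev C X)" "Coev S X = emb (Coev C X)"
  "EvenPart S (f0, f1) = emb f0" "OddPart S (f0, f1) = (Zero C (Dom C f0) (Cod C f0), f1)"
  by (simp_all add: hat_supercategory_def)

section \<open>Even arrows inside the supercategory\<close>

lemma even_eq: "ty f = X \<Rrightarrow> Y \<Longrightarrow> emb f = (f, Zero C X (\<epsilon> \<otimes>\<^sub>o Y))"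
  by (simp add: as_even_def)

lemma Dom_even [simp]: "ty f = X \<Rrightarrow> Y \<Longrightarrow> Dom S (emb f) = X"
  and Cod_even [simp]: "ty f = X \<Rrightarrow> Y \<Longrightarrow> Cod S (emb f) = Y"
  by (simp_all add: even_eq)

lemma Arr_S: "(f0, f1) \<in> Arr S \<longleftrightarrow> (\<exists>X Y. ty f0 = X \<Rrightarrow> Y \<and> ty f1 = X \<Rrightarrow> \<epsilon> \<otimes>\<^sub>o Y)"
proof
  assume "(f0, f1) \<in> Arr S"
  then have "f0 \<in> Arr C" "f1 \<in> Hom C (Dom C f0) (\<epsilon> \<otimes>\<^sub>o Cod C f0)"
    by (auto simp: hat_supercategory_def)
  then show "\<exists>X Y. ty f0 = X \<Rrightarrow> Y \<and> ty f1 = X \<Rrightarrow> \<epsilon> \<otimes>\<^sub>o Y"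
    using ty_ArrI[of f0] arity_eq_iff[of C f1 "Dom C f0" "\<epsilon> \<otimes>\<^sub>o Cod C f0"] by blast
next
  assume "\<exists>X Y. ty f0 = X \<Rrightarrow> Y \<and> ty f1 = X \<Rrightarrow> \<epsilon> \<otimes>\<^sub>o Y"
  then obtain X Y where f: "ty f0 = X \<Rrightarrow> Y" "ty f1 = X \<Rrightarrow> \<epsilon> \<otimes>\<^sub>o Y"
    by blast
  then have "f1 \<in> Hom C X (\<epsilon> \<otimes>\<^sub>o Y)"
    by (simp flip: arity_eq_iff)
  then show "(f0, f1) \<in> Arr S"
    using f(1) by (simp add: hat_supercategory_def)
qed

lemma Hom_S: "(f0, f1) \<in> Hom S X Y \<longleftrightarrow> ty f0 = X \<Rrightarrow> Y \<and> ty f1 = X \<Rrightarrow> \<epsilon> \<otimes>\<^sub>o Y"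
proof
  assume "(f0, f1) \<in> Hom S X Y"
  then have XY: "X = Dom C f0" "Y = Cod C f0" and "(f0, f1) \<in> Arr S"
    by (simp_all add: Hom_def)
  then obtain X' Y' where f: "ty f0 = X' \<Rrightarrow> Y'" "ty f1 = X' \<Rrightarrow> \<epsilon> \<otimes>\<^sub>o Y'"
    using Arr_S by blast
  then show "ty f0 = X \<Rrightarrow> Y \<and> ty f1 = X \<Rrightarrow> \<epsilon> \<otimes>\<^sub>o Y"
    unfolding XY by simp
next
  assume f: "ty f0 = X \<Rrightarrow> Y \<and> ty f1 = X \<Rrightarrow> \<epsilon> \<otimes>\<^sub>o Y"
  then have "(f0, f1) \<in> Arr S"
    using Arr_S by blast
  then show "(f0, f1) \<in> Hom S X Y"
    using f by (simp add: Hom_def)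
qed

lemma even_Hom: "ty f = X \<Rrightarrow> Y \<Longrightarrow> emb f \<in> Hom S X Y"
  using ty_Obj[of f X Y] by (simp add: even_eq Hom_S)

lemma xi_cancel_eq_cap: "xi_cancel C \<epsilon> \<xi> Z = cap \<xi> \<epsilon> \<epsilon> Z"
  by (simp add: xi_cancel_def cap_def)

lemma eps_pull_eq_br: "eps_pull C c \<epsilon> X Y = br X \<epsilon> Y"
  by (simp add: eps_pull_def br_def)

lemma Comp_S:
  assumes "ty g0 = Y \<Rrightarrow> Z"
  shows "(g0, g1) \<cdot>\<^bsub>S\<^esub> (f0, f1) = (Add C (g0 \<cdot> f0) (cap \<xi> \<epsilon> \<epsilon> Z \<cdot> (\<epsilon> \<rhd> g1) \<cdot> f1), Add C (g1 \<cdot> f0) ((\<epsilon> \<rhd> g0) \<cdot> f1))"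
  using assms by (simp add: hat_supercategory_def xi_cancel_eq_cap)

lemma TensorArr_S:
  assumes "ty f0 = X \<Rrightarrow> Y" "ty g0 = X' \<Rrightarrow> Y'"
  shows "(f0, f1) \<otimes>\<^sub>a\<^bsub>S\<^esub> (g0, g1) =
    (Add C (f0 \<otimes>\<^sub>a g0) (Scale C (-1) (cap \<xi> \<epsilon> \<epsilon> (Y \<otimes>\<^sub>o Y') \<cdot> (\<epsilon> \<rhd> br Y \<epsilon> Y') \<cdot> \<alpha> \<epsilon> Y (\<epsilon> \<otimes>\<^sub>o Y') \<cdot> (f1 \<otimes>\<^sub>a g1))),
     Add C (\<alpha> \<epsilon> Y Y' \<cdot> (f1 \<otimes>\<^sub>a g0)) (br Y \<epsilon> Y' \<cdot> (f0 \<otimes>\<^sub>a g1)))"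
  using assms by (simp add: hat_supercategory_def xi_cancel_eq_cap eps_pull_eq_br Let_def)

text \<open>The zero odd part of \<open>emb g\<close> kills the \<open>\<xi>\<close> term, so the
  even and the odd part compose separately.\<close>

lemma even_comp [simp]:
  assumes [simp]: "ty f0 = X \<Rrightarrow> Y" "ty f1 = X \<Rrightarrow> \<epsilon> \<otimes>\<^sub>o Y" "ty g = Y' \<Rrightarrow> Z" "Y' = Y"
  shows "emb g \<cdot>\<^bsub>S\<^esub> (f0, f1) = (g \<cdot> f0, (\<epsilon> \<rhd> g) \<cdot> f1)"
  using ty_Obj[OF assms(1)] ty_Obj[OF assms(3)] assms(3)
  by (simp add: even_eq[of g Y Z] Comp_S[of _ Y Z])

lemma comp_even [simp]:
  assumes [simp]: "ty f = X \<Rrightarrow> Y" "ty g0 = Y' \<Rrightarrow> Z" "ty g1 = Y' \<Rrightarrow> \<epsilon> \<otimes>\<^sub>o Z" "Y' = Y"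
  shows "(g0, g1) \<cdot>\<^bsub>S\<^esub> emb f = (g0 \<cdot> f, g1 \<cdot> f)"
  using ty_Obj[OF assms(1)] ty_Obj[OF assms(2)] assms(2,3)
  by (simp add: even_eq[of f X Y] Comp_S[of _ Y Z])

lemma even_comp_even [simp]:
  assumes [simp]: "ty f = X \<Rrightarrow> Y" "ty g = Y' \<Rrightarrow> Z" "Y' = Y"
  shows "emb g \<cdot>\<^bsub>S\<^esub> emb f = emb (g \<cdot> f)"
  using ty_Obj[OF assms(1)] ty_Obj[OF assms(2)] even_eq[of "g \<cdot> f" X Z] even_comp[of f X Y "Zero C X (\<epsilon> \<otimes>\<^sub>o Y)" g Y Z] assms(2)
  by (simp add: even_eq[of f X Y])

lemma even_tensor_even [simp]:
  assumes [simp]: "ty f = X \<Rrightarrow> Y" "ty g = X' \<Rrightarrow> Y'"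
  shows "emb f \<otimes>\<^sub>a\<^bsub>S\<^esub> emb g = emb (f \<otimes>\<^sub>a g)"
  using ty_Obj[OF assms(1)] ty_Obj[OF assms(2)]
  by (simp add: even_eq[of f X Y] even_eq[of g X' Y'] even_eq[of "f \<otimes>\<^sub>a g" "X \<otimes>\<^sub>o X'" "Y \<otimes>\<^sub>o Y'"]
      TensorArr_S[of _ X Y _ X' Y'])

text \<open>The \<open>\<epsilon>\<close> emitted by \<open>f1\<close> has to cross
  \<open>Z\<close>; this is the source of the crossing in \<open>odd_dual\<close>.\<close>

lemma even_ident_tensor [simp]:
  assumes [simp]: "ty f0 = X \<Rrightarrow> Y" "ty f1 = X \<Rrightarrow> \<epsilon> \<otimes>\<^sub>o Y" "Z \<in> Obj C"
  shows "emb (\<ii> Z) \<otimes>\<^sub>a\<^bsub>S\<^esub> (f0, f1) = (Z \<rhd> f0, br Z \<epsilon> Y \<cdot> (Z \<rhd> f1))"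
  using ty_Obj[OF assms(1)]
  by (simp add: even_eq[of "\<ii> Z" Z Z] TensorArr_S[of _ Z Z _ X Y])

lemma tensor_even_ident [simp]:
  assumes [simp]: "ty f0 = X \<Rrightarrow> Y" "ty f1 = X \<Rrightarrow> \<epsilon> \<otimes>\<^sub>o Y" "Z \<in> Obj C"
  shows "(f0, f1) \<otimes>\<^sub>a\<^bsub>S\<^esub> emb (\<ii> Z) = (f0 \<lhd> Z, \<alpha> \<epsilon> Y Z \<cdot> (f1 \<lhd> Z))"
  using ty_Obj[OF assms(1)]
  by (simp add: even_eq[of "\<ii> Z" Z Z] TensorArr_S[of _ X Y _ Z Z])

text \<open>The odd part of an inverse of \<open>emb f\<close> composes with \<open>f\<close> to
  zero and hence vanishes. The equivalence supplies the uniqueness that the description in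
  \<open>inv_arr\<close> needs over \<open>S\<close>.\<close>

lemma inverse_even:
  assumes "iso_arr C f" "ty f = X \<Rrightarrow> Y"
  shows "inverse_arr S (emb f) g \<longleftrightarrow> g = emb (inv_arr C f)"
proof
  note [simp] = assms(2) ty_Obj[OF assms(2)] ty_inv[OF assms] inv_left[OF assms] inv_right[OF assms]
  assume g: "inverse_arr S (emb f) g"
  obtain g0 g1 where g_eq: "g = (g0, g1)"
    by fastforce
  have [simp]: "ty g0 = Y \<Rrightarrow> X" "ty g1 = Y \<Rrightarrow> \<epsilon> \<otimes>\<^sub>o X"
    and "(g0 \<cdot> f, g1 \<cdot> f) = emb (\<ii> X)"
    using g Hom_S[of g0 g1 Y X] comp_even[OF assms(2), of g0 Y X g1]
    by (auto simp: inverse_arr_def g_eq)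
  then have gf: "g0 \<cdot> f = \<ii> X" "g1 \<cdot> f = Zero C X (\<epsilon> \<otimes>\<^sub>o X)"
    by (simp_all add: even_eq[of "\<ii> X" X X])
  have "g0 = (g0 \<cdot> f) \<cdot> inv_arr C f" "g1 = (g1 \<cdot> f) \<cdot> inv_arr C f"
    by (simp_all add: arr_assoc)
  then show "g = emb (inv_arr C f)"
    unfolding gf by (simp add: g_eq even_eq[of "inv_arr C f" Y X])
next
  note [simp] = assms(2) ty_Obj[OF assms(2)] ty_inv[OF assms] inv_left[OF assms] inv_right[OF assms]
  have "emb f \<in> Arr S" "emb (inv_arr C f) \<in> Hom S Y X"
    using even_Hom[OF assms(2)] even_Hom[OF ty_inv[OF assms]] by (auto simp: Hom_def)
  then show "inverse_arr S (emb f) g" if "g = emb (inv_arr C f)"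
    unfolding that by (simp add: inverse_arr_def)
qed

lemma inv_even [simp]: "\<lbrakk>iso_arr C f; ty f = X \<Rrightarrow> Y\<rbrakk> \<Longrightarrow> inv_arr S (emb f) = emb (inv_arr C f)"
  unfolding inv_arr_def[of S] by (rule the_equality) (simp_all add: inverse_even)

lemma iso_even: "\<lbrakk>iso_arr C f; ty f = X \<Rrightarrow> Y\<rbrakk> \<Longrightarrow> iso_arr S (emb f)"
  unfolding iso_arr_def[of S] using inverse_even by blast

section \<open>Duals and biduals in the supercategory\<close>

lemma snake_even [simp]:
  "\<lbrakk>ty e = A \<otimes>\<^sub>o X \<Rrightarrow> \<I>; ty h = \<I> \<Rrightarrow> X \<otimes>\<^sub>o B; A \<in> Obj C; X \<in> Obj C; B \<in> Obj C\<rbrakk>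
    \<Longrightarrow> snake S A X B (emb e) (emb h) = emb (snake C A X B e h)"
  by (simp add: snake_def)

lemma dual_tensor_S [simp]:
  "\<lbrakk>X \<in> Obj C; Y \<in> Obj C\<rbrakk> \<Longrightarrow> dual_tensor S X Y = emb (dual_tensor C X Y)"
  by (simp add: dual_tensor_def Let_def)

lemma dual_unit_S [simp]: "dual_unit S = emb (dual_unit C)"
  by (simp add: dual_unit_def)

text \<open>All factors of \<open>dual_arr S\<close> other than the given arrow are even, so its two
  parts pass through separately, and the odd part becomes the formula of
  \<open>odd_dual\<close>.\<close>

lemma dual_arr_S [simp]:
  assumes [simp]: "ty f0 = X \<Rrightarrow> Y" "ty f1 = X \<Rrightarrow> \<epsilon> \<otimes>\<^sub>o Y"
  shows "dual_arr S (f0, f1) = (dual_arr C f0, odd_dual X Y f1)"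
  using ty_Obj[OF assms(1)]
  by (simp add: dual_arr_def[of S] dual_arr_def[of C] odd_dual_def Let_def arr_assoc)

lemma dual_arr_zero [simp]:
  "\<lbrakk>X \<in> Obj C; Y \<in> Obj C\<rbrakk> \<Longrightarrow> dual_arr C (Zero C X Y) = Zero C Y\<^sup>\<star> X\<^sup>\<star>"
  "\<lbrakk>X \<in> Obj C; Y \<in> Obj C\<rbrakk> \<Longrightarrow> odd_dual X Y (Zero C X (\<epsilon> \<otimes>\<^sub>o Y)) = Zero C Y\<^sup>\<star> (\<epsilon> \<otimes>\<^sub>o X\<^sup>\<star>)"
  by (simp_all add: dual_arr_def odd_dual_def Let_def)

lemma dual_arr_even [simp]: "ty f = X \<Rrightarrow> Y \<Longrightarrow> dual_arr S (emb f) = emb (dual_arr C f)"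
  using ty_Obj[of f X Y] by (simp add: even_eq[of f X Y] even_eq[of "dual_arr C f" "Y\<^sup>\<star>" "X\<^sup>\<star>"])

lemma bidual_tensor_S:
  assumes [simp]: "X \<in> Obj C" "Y \<in> Obj C"
  shows "bidual_tensor S X Y = emb (bidual_tensor C X Y)"
proof -
  have [simp]: "ty (inv_arr C (dual_tensor C X Y)) = (X \<otimes>\<^sub>o Y)\<^sup>\<star> \<Rrightarrow> Y\<^sup>\<star> \<otimes>\<^sub>o X\<^sup>\<star>"
    by (rule ty_inv) simp_all
  show ?thesis
    by (simp add: bidual_tensor_def)
qed

lemma bidual_unit_S: "bidual_unit S = emb (bidual_unit C)"
proof -
  have [simp]: "ty (inv_arr C (dual_unit C)) = \<I>\<^sup>\<star> \<Rrightarrow> \<I>"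
    by (rule ty_inv) simp_all
  show ?thesis
    by (simp add: bidual_unit_def)
qed

lemma Bid_S:
  assumes [simp]: "ty f0 = X \<Rrightarrow> Y" "ty f1 = X \<Rrightarrow> \<epsilon> \<otimes>\<^sub>o Y"
  shows "Bid S (f0, f1) = (Bid C f0, odd_dual Y\<^sup>\<star> X\<^sup>\<star> (odd_dual X Y f1))"
  using ty_Obj[OF assms(1)] by (simp add: Bid_def)

lemma sBid_S:
  assumes [simp]: "ty f0 = X \<Rrightarrow> Y" "ty f1 = X \<Rrightarrow> \<epsilon> \<otimes>\<^sub>o Y"
  shows "sBid S (f0, f1) = (Bid C f0, Scale C (-1) (odd_dual Y\<^sup>\<star> X\<^sup>\<star> (odd_dual X Y f1)))"
  using ty_Obj[OF assms(1)]
  by (simp add: sBid_def even_eq[of f0 X Y] Bid_S[of _ X Y] Bid_def)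

end

section \<open>Transfer of the pivotal structure to the supercategory\<close>

locale pivotal_supercategory = pivotal_transparent_object C c a \<epsilon> s + associated_supercategory C c \<epsilon> \<xi>
  for C :: "('o, 'm, 'k::field, 'z) rigidcat_scheme" (structure)
    and c :: "'o \<Rightarrow> 'o \<Rightarrow> 'm" and a :: "'o \<Rightarrow> 'm" and \<epsilon> :: 'o and s :: 'k and \<xi> :: 'm
begin

text \<open>\<open>t\<close> is the factor that \<open>B\<close> puts on odd arrows, 1 for
  \<open>Bid\<close> and -1 for \<open>sBid\<close>, while \<open>s\<close> relates
  \<open>a \<epsilon>\<close> to the Drinfeld isomorphism. Naturality on odd arrows holds because
  the two cancel.\<close>

lemma monoidal_iso_to_bidual_S:
  assumes B: "\<And>f0 f1 X Y. \<lbrakk>ty f0 = X \<Rrightarrow> Y; ty f1 = X \<Rrightarrow> \<epsilon> \<otimes>\<^sub>o Y\<rbrakk>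
      \<Longrightarrow> B (f0, f1) = (Bid C f0, Scale C t (odd_dual Y\<^sup>\<star> X\<^sup>\<star> (odd_dual X Y f1)))"
    and t: "t * s = 1"
  shows "monoidal_iso_to_bidual S B (\<lambda>X. emb (a X))"
  unfolding monoidal_iso_to_bidual_def
proof (intro conjI ballI)
  fix X assume "X \<in> Obj S"
  then have X: "X \<in> Obj C" by simp
  show "emb (a X) \<in> Hom S X (Dual S (Dual S X))" "iso_arr S (emb (a X))"
    using even_Hom[OF ty_pivotal[OF X]] iso_even[OF iso_pivotal ty_pivotal, OF X X] by simp_all
  fix Y assume "Y \<in> Obj S"
  then have Y: "Y \<in> Obj C" by simp
  have "ty (bidual_tensor C X Y) = X\<^sup>\<star>\<^sup>\<star> \<otimes>\<^sub>o Y\<^sup>\<star>\<^sup>\<star> \<Rrightarrow> (X \<otimes>\<^sub>o Y)\<^sup>\<star>\<^sup>\<star>"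
    using X Y ty_inv[of "dual_tensor C X Y" "Y\<^sup>\<star> \<otimes>\<^sub>o X\<^sup>\<star>" "(X \<otimes>\<^sub>o Y)\<^sup>\<star>"] by (simp add: bidual_tensor_def)
  then show "emb (a (X \<otimes>\<^sub>o\<^bsub>S\<^esub> Y)) = bidual_tensor S X Y \<cdot>\<^bsub>S\<^esub> (emb (a X) \<otimes>\<^sub>a\<^bsub>S\<^esub> emb (a Y))"
    using X Y pivotal by (simp add: bidual_tensor_S monoidal_iso_to_bidual_def)
next
  fix f assume "f \<in> Arr S"
  then obtain f0 f1 X Y where f: "f = (f0, f1)" "ty f0 = X \<Rrightarrow> Y" "ty f1 = X \<Rrightarrow> \<epsilon> \<otimes>\<^sub>o Y"
    using Arr_S by (cases f) blast
  note [simp] = f(2,3) ty_Obj[OF f(2)]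
  \<comment> \<open>The odd component of naturality at \<open>f\<close>; the even component is
    naturality of \<open>a\<close> in \<open>C\<close>.\<close>
  have "Scale C t (odd_dual Y\<^sup>\<star> X\<^sup>\<star> (odd_dual X Y f1)) \<cdot> a X = (\<epsilon> \<rhd> a Y) \<cdot> f1"
    by (simp add: scale_comp odd_bidual_natural scale_scale t)
  moreover have "ty (Bid C f0) = X\<^sup>\<star>\<^sup>\<star> \<Rrightarrow> Y\<^sup>\<star>\<^sup>\<star>" "a Y \<cdot> f0 = Bid C f0 \<cdot> a X"
    using pivotal_natural[OF f(2)] by (simp_all add: Bid_def)
  ultimately show "emb (a (Cod S f)) \<cdot>\<^bsub>S\<^esub> f = B f \<cdot>\<^bsub>S\<^esub> emb (a (Dom S f))"
    by (simp add: f(1) B[OF f(2,3)])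
next
  show "emb (a \<I>\<^bsub>S\<^esub>) = bidual_unit S"
    using pivotal by (simp add: bidual_unit_S monoidal_iso_to_bidual_def)
qed

lemma even_pivotal: "X \<in> Obj C \<Longrightarrow> even_arr S (emb (a X))"
  using even_Hom[OF ty_pivotal[of X]] even_eq[OF ty_pivotal[of X]] by (simp add: even_arr_def Hom_def)

lemma pivotal_structure_S: "s = 1 \<Longrightarrow> pivotal_structure S (\<lambda>X. emb (a X))"
  unfolding pivotal_structure_def
  using monoidal_iso_to_bidual_S[of "Bid S" 1] Bid_S even_pivotal ty_Obj by simp

lemma superpivotal_structure_S: "s = -1 \<Longrightarrow> superpivotal_structure S (\<lambda>X. emb (a X))"
  unfolding superpivotal_structure_def
  using monoidal_iso_to_bidual_S[of "sBid S" "-1"] sBid_S even_pivotal by simp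

end

section \<open>From the symmetric center to a transparent object\<close>

theorem proposition4p3:
  fixes C :: "('o, 'm, 'k::{alg_closed_field, field_char_0}) rigidcat"
    and c :: "'o \<Rightarrow> 'o \<Rightarrow> 'm"
    and a :: "'o \<Rightarrow> 'm"
    and \<epsilon> :: 'o
    and \<xi> :: 'm
  assumes "braided_pivotal_fusion_category C c a"
    and "slightly_degenerate C c"
    and "simple_object (symmetric_center C c) \<epsilon>"
    and "\<not> isomorphic (symmetric_center C c) \<epsilon> \<I>\<^bsub>C\<^esub>"
    and "\<xi> \<in> Hom C (\<epsilon> \<otimes>\<^sub>o\<^bsub>C\<^esub> \<epsilon>) \<I>\<^bsub>C\<^esub>"
    and "iso_arr C \<xi>"
  shows "(a \<epsilon> = drinfeld C c \<epsilon> \<longrightarrow>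
            pivotal_structure (hat_supercategory C c \<epsilon> \<xi>) (\<lambda>X. as_even C \<epsilon> (a X))) \<and>
         (a \<epsilon> = Scale C (-1) (drinfeld C c \<epsilon>) \<longrightarrow>
            superpivotal_structure (hat_supercategory C c \<epsilon> \<xi>) (\<lambda>X. as_even C \<epsilon> (a X)))"
proof -
  interpret braided_pivotal_fusion_category C c a
    by (rule assms(1))
  \<comment> \<open>A simple object of the symmetric center is in particular one of its objects,
    which means that it is transparent.\<close>
  have center: "\<epsilon> \<in> Obj C" "c Y \<epsilon> \<cdot>\<^bsub>C\<^esub> c \<epsilon> Y = \<ii>\<^bsub>C\<^esub> (\<epsilon> \<otimes>\<^sub>o\<^bsub>C\<^esub> Y)" if "Y \<in> Obj C" for Y
    using assms(3) that
    by (auto simp: simple_object_def symmetric_center_def full_subcategory_def)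
  have loc: "pivotal_supercategory C c a \<epsilon> s \<xi>" if "a \<epsilon> = Scale C s (drinfeld C c \<epsilon>)" for s
    \<comment> \<open>The first fact of \<open>center\<close> also carries the premise on
      \<open>Y\<close>; the unit object discharges it.\<close>
    by unfold_locales (fact center(1)[OF UnitObj_Obj] center(2) that assms(5)[folded arity_eq_iff])+
  \<comment> \<open>Puts the hypothesis \<open>a \<epsilon> = drinfeld C c \<epsilon>\<close> into
    the scalar form with \<open>s = 1\<close>.\<close>
  have "drinfeld C c \<epsilon> = Scale C 1 (drinfeld C c \<epsilon>)"
    using center(1)[OF UnitObj_Obj] by simp
  then show ?thesis
    using pivotal_supercategory.pivotal_structure_S[OF loc, of 1]
      pivotal_supercategory.superpivotal_structure_S[OF loc, of "-1"] by auto
qed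

end
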